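(* Let $n\ge1$, $i,j_1,j_2\in\{1,2,\ldots,n\}$. For any $a(z)\in\langle\mathcal{Y}_i(z)\rangle$ we have $$x_{j_1}^+(z)_\bullet x_{j_2}^-(z)_\bullet a(z)-x_{j_2}^-(z)_\bullet x_{j_1}^+(z)_\bullet a(z)=\frac{\delta_{j_1 j_2}}{q-q^{-1}}\big(\psi_{j_1}(z)-\phi_{j_1}(z)\big)_\bullet a(z).$$
   Context: **Notation.** $n\ge1$ is an integer, $q$ an indeterminate, $F=\mathbb{C}(q^{1/2})$, $[m]=\frac{q^m-q^{-m}}{q-q^{-1}}$. $(a_{ij})_{i,j=1}^n$ is the Cartan matrix of type $A_n$; $\alpha_1,\ldots,\alpha_n$ and $\lambda_1,\ldots,\lambda_n$ are the simple roots and fundamental weights of $\mathfrak{sl}_{n+1}$; $Q=\bigoplus\mathbb{Z}\alpha_i\subset P=\bigoplus\mathbb{Z}\lambda_i$; $(\cdot,\cdot)$ is the symmetric bilinear form with $(\alpha_i,\alpha_j)=a_{ij}$, $(\lambda_i,\alpha_j)=\delta_{ij}$. **The space $V$.** $K(1)$ is the symmetric algebra over $F$ on the symbols $a_i(-r)$, $1\le i\le n$, $r\in\mathbb{Z}_{>0}$; $a_i(-r)$ acts by multiplication and $a_i(r)$, $r>0$, acts as the derivation annihilating $1$ such that $[a_i(r),a_j(s)]=\delta_{r+s,0}\frac{[a_{ij}r][r]}{r}$ for all $r,s\in\mathbb{Z}\setminus\{0\}$. $\mathbb{C}\{P\}$ is the (twisted group) algebra, with scalars in $F$, generated by the invertible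 elements $e^{\alpha_2},\ldots,e^{\alpha_n},e^{\lambda_n}$ with relations $e^{\alpha_i}e^{\alpha_j}=(-1)^{(\alpha_i,\alpha_j)}e^{\alpha_j}e^{\alpha_i}$, $e^{\alpha_i}e^{\lambda_n}=(-1)^{\delta_{in}}e^{\lambda_n}e^{\alpha_i}$ ($2\le i,j\le n$). For $\alpha=m_2\alpha_2+\cdots+m_n\alpha_n+m_{n+1}\lambda_n\in P$ put $e^\alpha=(e^{\alpha_2})^{m_2}\cdots(e^{\alpha_n})^{m_n}(e^{\lambda_n})^{m_{n+1}}$. Let $V=K(1)\otimes\mathbb{C}\{P\}$, $1=1\otimes e^0\in V$. The $e^\alpha$ act by left multiplication on $\mathbb{C}\{P\}$; $z^{\partial_\alpha}e^\beta=z^{(\alpha,\beta)}e^\beta$; $(-1)^{m\partial_\alpha}e^\beta=(-1)^{m(\alpha,\beta)}e^\beta$ with $(-1)^s=e^{\pi\sqrt{-1}s}$; $K_j^{\pm1}$ acts by $K_j^{\pm1}(v\otimes e^\beta)=q^{\pm(\alpha_j,\beta)}v\otimes e^\beta$. **Operators.** For $j=1,\ldots,n$: $$x_j^\pm(z)=\exp\Big(\pm\sum_{r\ge1}\tfrac{q^{\mp r/2}}{[r]}a_j(-r)z^r\Big)\exp\Big(\mp\sum_{r\ge1}\tfrac{q^{\mp r/2}}{[r]}a_j(r)z^{-r}\Big)\otimes e^{\pm\alpha_j}z^{\pm\partial_{\alpha_j}},$$ $$\psi_j(z)=K_j\exp\Big((q-q^{-1})\sum_{r\ge1}a_j(r)z^{-r}\Big),\qquad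 \phi_j(z)=K_j^{-1}\exp\Big(-(q-q^{-1})\sum_{r\ge1}a_j(-r)z^{r}\Big),$$ elements of $\mathrm{Hom}(V,V((z)))$. For $l\ne0$ let $a_i^*(l)=\sum_{j=1}^n m_i^{(j)}a_j(l)$ with $m_i^{(j)}=\frac{[jl][(n-i+1)l]}{[(n+1)l][l]}$ if $j\le i$ and $m_i^{(j)}=\frac{[il][(n-j+1)l]}{[(n+1)l][l]}$ if $j>i$. For $i=1,\ldots,n$, $$\mathcal{Y}_i(z)=\exp\Big(\sum_{r\ge1}\tfrac{q^{r/2}}{[r]}a_i^*(-r)z^r\Big)\exp\Big(-\sum_{r\ge1}\tfrac{q^{r/2}}{[r]}a_i^*(r)z^{-r}\Big)\otimes e^{\lambda_i}(-1)^{(1-\delta_{in})i\,\partial_{\lambda_n}}z^{\partial_{\lambda_i}}\in\mathrm{Hom}(V,V((z^{1/(n+1)}))).$$ **Products.** A pair $(a(z),b(z))$, $a(z)\in\mathrm{Hom}(V,V((z)))$, $b(z)\in\mathrm{Hom}(V,V((z^{1/(n+1)})))$, is quasi compatible if there is a nonzero polynomial $p(z_1,z_2)\in F[z_1,z_2]$ with $p(z_1,z_2)a(z_1)b(z_2)\in\mathrm{Hom}(V,V((z_1,z_2^{1/(n+1)})))$. For such a pair, the products $a(z)_rb(z)$, $r\in\mathbb{Z}$, are defined by $$\sum_{r\in\mathbb{Z}}(a(z)_rb(z))z_0^{-r-1}=\iota_{z,z_0}\big(p(z_0+z,z)^{-1}\big)\,\big(p(z_1,z)a(z_1)b(z)\big)\big|_{z_1=z+z_0},$$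 where $\iota_{z,z_0}$ expands in $F((z))((z_0))$ (i.e. in nonnegative powers of $z_0$ up to a finite pole), and $z_1=z+z_0$ is likewise expanded in nonnegative powers of $z_0$; this is independent of $p$. For $c(z)\in\mathrm{Hom}(V,V((z^{1/(n+1)})))$ write $\mathrm{wt}\,c(z)=\alpha\in P$ if $c(z)1=d(z)\otimes e^\alpha$ for some $d(z)\in K(1)((z^{1/(n+1)}))$; e.g. $\mathrm{wt}\,x_j^\pm(z)=\pm\alpha_j$, $\mathrm{wt}\,\psi_j(z)=\mathrm{wt}\,\phi_j(z)=0$, $\mathrm{wt}\,\mathcal{Y}_i(z)=\lambda_i$. For a quasi compatible pair define $$a(z)_\bullet b(z)=\sum_{t\in\frac12\mathbb{Z}}\Big(\frac{1}{zq^t}\Big)^{(\mathrm{wt}\,a(z),\mathrm{wt}\,b(z))+1}q^t\,a(zq^t)_0b(z)$$ (a finite sum; $a(zq^t)_0b(z)$ is the zeroth product of the operators $a(zq^t)$ and $b(z)$), extended linearly in $b(z)$ to sums of operators with different weights. Iterated products are nested from the right: $a_1(z)_\bullet a_2(z)_\bullet b(z)=a_1(z)_\bullet(a_2(z)_\bullet b(z))$. Also $(\psi_j(z)-\phi_j(z))_\bullet a(z)=\psi_j(z)_\bullet a(z)-\phi_j(z)_\bullet a(z)$. **The space $\langle\mathcal{Y}_i(z)\rangle$.** It is the $F$-span of all $a_1(z)_\bullet\cdots{}_\bullet a_k(z)_\bullet\mathcal{Y}_i(z)$ with $k\ge0$ and each $a_s(z)\in\{x_j^\pm(z),\psi_j(z),\phi_j(z):j=1,\ldots,n\}$.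 *)

theory Defs
  imports
    Complex_Main
    "HOL-Library.Poly_Mapping"
    "HOL-Library.Function_Algebras"
    "HOL-Computational_Algebra.Formal_Laurent_Series"
    "HOL-Computational_Algebra.Polynomial_FPS"
    "HOL-Computational_Algebra.Fraction_Field"
    "HOL-Analysis.Finite_Cartesian_Product"
begin

no_notation fps_nth (infixl \<open>$\<close> 75)
notation fls_nth (infixl \<open>$$\<close> 75)


section \<open>Scalars\<close>

text \<open>The field \<open>F\<close> of rational functions over the complex numbers in one indeterminate, which is
  called \<open>qh\<close> and plays the role of \<open>q\<^bsup>1/2\<^esup>\<close>. All powers \<open>q\<^sup>t\<close> with half-integral \<open>t\<close> are written
  \<open>qh powi (2 * t)\<close>.\<close>

type_synonym qfield = "complex poly fract"

instance fract :: ("{idom, ring_char_0}") field_char_0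
  by standard (auto simp: inj_def of_nat_fract eq_fract)

definition of_complex_q :: "complex \<Rightarrow> qfield" where
  "of_complex_q c = Fract [:c:] 1"

definition qh :: qfield where
  "qh = Fract [:0, 1:] 1"

definition qq :: qfield where
  "qq = qh ^ 2"

definition qint :: "int \<Rightarrow> qfield" where
  "qint m = (qq powi m - qq powi (- m)) / (qq - inverse qq)"

text \<open>\<open>(-1)\<^sup>s = exp (\<pi> \<i> s)\<close> for rational \<open>s\<close>.\<close>

definition minus_one_rat_pow :: "rat \<Rightarrow> qfield" where
  "minus_one_rat_pow s = of_complex_q (exp (complex_of_real pi * \<i> * complex_of_real (of_rat s)))"


section \<open>Root data of type A\<close>

text \<open>The index set \<open>{1, \<dots>, n}\<close> is an arbitrary finite linearly ordered type \<open>'n\<close>, so that \<open>n\<close> is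
  \<open>CARD('n)\<close>; its element \<open>i\<close> stands for the number \<open>pos i\<close> (see \<open>bij_betw_pos\<close>).\<close>

definition pos :: "'n::{finite,linorder} \<Rightarrow> nat" where
  "pos i = card {j. j \<le> i}"

lemma pos_less_iff: "pos i < pos j \<longleftrightarrow> i < (j :: 'n::{finite,linorder})"
proof -
  have *: "pos i < pos j" if "i < j" for i j :: 'n
  proof -
    have "{k. k \<le> i} \<subset> {k. k \<le> j}" using that by (auto simp: psubset_eq set_eq_iff) (meson leD order_refl)+
    then show ?thesis unfolding pos_def by (intro psubset_card_mono) auto
  qed
  show ?thesis using *[of i j] *[of j i] by (cases i j rule: linorder_cases) auto
qed

lemma pos_eq_iff: "pos i = pos j \<longleftrightarrow> i = (j :: 'n::{finite,linorder})"
  by (metis pos_less_iff linorder_neqE less_irrefl)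

lemma bij_betw_pos: "bij_betw pos (UNIV :: 'n::{finite,linorder} set) {1..CARD('n)}"
proof -
  have inj: "inj (pos :: 'n \<Rightarrow> nat)" by (auto simp: inj_def pos_eq_iff)
  have sub: "pos ` (UNIV :: 'n set) \<subseteq> {1..CARD('n)}"
  proof clarify
    fix i :: 'n
    have "card {j. j \<le> i} > 0" by (auto simp: card_gt_0_iff)
    moreover have "card {j. j \<le> i} \<le> CARD('n)" by (rule card_mono) auto
    ultimately show "pos i \<in> {1..CARD('n)}" unfolding pos_def atLeastAtMost_iff by linarith
  qed
  have "pos ` (UNIV :: 'n set) = {1..CARD('n)}"
    by (rule card_subset_eq[OF _ sub]) (auto simp: card_image[OF inj])
  with inj show ?thesis by (simp add: bij_betw_def)
qed

lemma pos_bounds: "1 \<le> pos (i :: 'n::{finite,linorder})" "pos i \<le> CARD('n)"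
  using bij_betw_pos[where 'n='n] by (auto simp: bij_betw_def)

lemma pos_Max: "pos (Max (UNIV :: 'n::{finite,linorder} set)) = CARD('n)"
  by (simp add: pos_def)

definition cartan :: "'n::{finite,linorder} \<Rightarrow> 'n \<Rightarrow> int" where
  "cartan i j = (if i = j then 2 else if \<bar>int (pos i) - int (pos j)\<bar> = 1 then -1 else 0)"

text \<open>A weight is given by its coordinates with respect to the fundamental weights.\<close>

type_synonym 'n weight = "int ^ 'n"

definition fund_weight :: "'n::{finite,linorder} \<Rightarrow> 'n weight" where
  "fund_weight i = (\<chi> k. if k = i then 1 else 0)"

definition simple_root :: "'n::{finite,linorder} \<Rightarrow> 'n weight" where
  "simple_root j = (\<chi> k. cartan j k)"

text \<open>The bilinear form is given by the inverse Cartan matrix; see \<open>form_root_root\<close> and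
  \<open>form_fund_root\<close> for its defining values.\<close>

definition inv_cartan :: "'n::{finite,linorder} \<Rightarrow> 'n \<Rightarrow> rat" where
  "inv_cartan i j =
     of_nat (min (pos i) (pos j)) * of_nat (CARD('n) + 1 - max (pos i) (pos j)) / of_nat (CARD('n) + 1)"

definition form :: "'n::{finite,linorder} weight \<Rightarrow> 'n weight \<Rightarrow> rat" where
  "form \<alpha> \<beta> = (\<Sum>i\<in>UNIV. \<Sum>j\<in>UNIV. of_int (\<alpha> $ i) * of_int (\<beta> $ j) * inv_cartan i j)"

lemma sum_pos: "(\<Sum>k\<in>UNIV. f (pos (k :: 'n::{finite,linorder}))) = (\<Sum>k=1..CARD('n). f k)"
  by (rule sum.reindex_bij_betw[OF bij_betw_pos])

lemma sum_second_difference: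
  fixes g :: "nat \<Rightarrow> 'a::comm_ring_1"
  assumes "1 \<le> j" "j \<le> n"
  shows "(\<Sum>k=1..n. (if j = k then 2 else if \<bar>int j - int k\<bar> = 1 then -1 else 0) * g k) =
         2 * g j - (if j = 1 then 0 else g (j - 1)) - (if j = n then 0 else g (j + 1))"
proof -
  obtain p where p: "j = Suc p" using assms by (cases j) auto
  have "(\<Sum>k=1..n. (if j = k then 2 else if \<bar>int j - int k\<bar> = 1 then -1 else 0) * g k) =
     (\<Sum>k=1..n. (if k = j then 2 * g k else 0) - (if k = p then g k else 0) - (if k = j + 1 then g k else 0))"
    by (intro sum.cong) (auto simp: p)
  also have "\<dots> = 2 * g j - (if j = 1 then 0 else g (j - 1)) - (if j = n then 0 else g (j + 1))"
    using assms by (auto simp: sum_subtractf p)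
  finally show ?thesis .
qed

lemma sum_cartan_pos:
  fixes g :: "nat \<Rightarrow> 'a::comm_ring_1" and j :: "'n::{finite,linorder}"
  shows "(\<Sum>k\<in>UNIV. of_int (cartan j k) * g (pos k)) =
    2 * g (pos j) - (if pos j = 1 then 0 else g (pos j - 1)) - (if pos j = CARD('n) then 0 else g (pos j + 1))"
proof -
  have "(\<Sum>k\<in>UNIV. of_int (cartan j k) * g (pos k)) =
     (\<Sum>k\<in>(UNIV :: 'n set). (if pos j = pos k then 2 else if \<bar>int (pos j) - int (pos k)\<bar> = 1 then -1 else 0) * g (pos k))"
    by (intro sum.cong) (auto simp: cartan_def pos_eq_iff)
  then show ?thesis
    using sum_pos[of "\<lambda>k. (if pos j = k then 2 else if \<bar>int (pos j) - int k\<bar> = 1 then -1 else 0) * g k", where 'n='n]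
      sum_second_difference[OF pos_bounds[of j], of g] by simp
qed

lemma sum_cartan:
  fixes g :: "nat \<Rightarrow> 'a::comm_ring_1" and j :: "'n::{finite,linorder}"
  assumes "g 0 = 0" "g (CARD('n) + 1) = 0"
  shows "(\<Sum>k\<in>UNIV. of_int (cartan j k) * g (pos k)) = 2 * g (pos j) - g (pos j - 1) - g (pos j + 1)"
proof -
  have "(\<Sum>k\<in>UNIV. of_int (cartan j k) * g (pos k)) =
     (\<Sum>k\<in>(UNIV :: 'n set). (if pos j = pos k then 2 else if \<bar>int (pos j) - int (pos k)\<bar> = 1 then -1 else 0) * g (pos k))"
    by (intro sum.cong) (auto simp: cartan_def pos_eq_iff)
  also have "\<dots> = 2 * g (pos j) - (if pos j = 1 then 0 else g (pos j - 1)) - (if pos j = CARD('n) then 0 else g (pos j + 1))"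
    using sum_pos[of "\<lambda>k. (if pos j = k then 2 else if \<bar>int (pos j) - int k\<bar> = 1 then -1 else 0) * g k", where 'n='n]
      sum_second_difference[OF pos_bounds[of j], of g] by simp
  finally show ?thesis using assms by (auto split: if_splits)
qed

lemma cartan_sym: "cartan i j = cartan j i"
  by (auto simp: cartan_def)

lemma form_sym: "form \<alpha> \<beta> = form \<beta> \<alpha>"
  unfolding form_def inv_cartan_def
  by (subst sum.swap) (simp add: mult.commute min.commute max.commute)

lemma form_add: "form (\<alpha> + \<beta>) \<gamma> = form \<alpha> \<gamma> + form \<beta> \<gamma>"
  by (simp add: form_def algebra_simps sum.distrib)

lemma form_root: "form \<beta> (simple_root j) = of_int (\<beta> $ j)"
  for \<beta> :: "'n::{finite,linorder} weight"
proof -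
  define N :: rat where "N = of_nat (CARD('n) + 1)"
  have N: "N \<noteq> 0" by (simp add: N_def del: of_nat_Suc)
  define g :: "nat \<Rightarrow> nat \<Rightarrow> rat" where
    "g i k = of_nat (min i k) * (N - of_nat (max i k)) / N" for i k
  have *: "(\<Sum>k\<in>UNIV. of_int (cartan j k) * inv_cartan i k) = (if i = j then 1 else 0)" for i :: 'n
  proof -
    have "inv_cartan i k = g (pos i) (pos k)" for k :: 'n
      using pos_bounds[of i] pos_bounds[of k]
      by (simp add: inv_cartan_def g_def N_def of_nat_diff del: of_nat_Suc)
    then have "(\<Sum>k\<in>UNIV. of_int (cartan j k) * inv_cartan i k) = 2 * g (pos i) (pos j) - g (pos i) (pos j - 1) - g (pos i) (pos j + 1)"
      using sum_cartan[of "g (pos i)" j] pos_bounds[of i] by (simp add: g_def N_def max_def)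
    also have "\<dots> = (if pos i = pos j then 1 else 0)"
    proof -
      obtain p where p: "pos j = Suc p" using pos_bounds[of j] by (cases "pos j") auto
      consider "pos i \<le> p" | "pos i = Suc p" | "pos i \<ge> p + 2" by linarith
      then show ?thesis
        by cases (use N in \<open>auto simp: p g_def max_def min_def field_simps\<close>)
    qed
    finally show ?thesis by (simp add: pos_eq_iff)
  qed
  have "form \<beta> (simple_root j) = (\<Sum>i\<in>UNIV. of_int (\<beta> $ i) * (\<Sum>k\<in>UNIV. of_int (cartan j k) * inv_cartan i k))"
    by (simp add: form_def simple_root_def sum_distrib_left mult.assoc)
  also have "\<dots> = of_int (\<beta> $ j)"
    by (simp add: * if_distrib cong: if_cong)
  finally show ?thesis .
qed

lemma form_root_root: "form (simple_root i) (simple_root j) = of_int (cartan i j)"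
  by (simp add: form_root simple_root_def[of i])

lemma form_fund_root: "form (fund_weight i) (simple_root j) = (if i = j then 1 else 0)"
  by (simp add: form_root fund_weight_def)

text \<open>If one of the arguments lies in the root lattice then \<open>form\<close> is integral and the rounding in
  \<open>iform\<close> has no effect; \<open>iform\<close> is used only in that situation.\<close>

definition iform :: "'n::{finite,linorder} weight \<Rightarrow> 'n weight \<Rightarrow> int" where
  "iform \<alpha> \<beta> = \<lfloor>form \<alpha> \<beta>\<rfloor>"

text \<open>The twisted group algebra of the weight lattice uses the basis \<open>\<alpha>\<^sub>2, \<dots>, \<alpha>\<^sub>n, \<lambda>\<^sub>n\<close> of that
  lattice, indexed here by \<open>2, \<dots>, n, n + 1\<close> in this order; \<open>bcoord k \<beta>\<close> is the coordinate \<open>m\<^sub>k\<close> of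
  \<open>\<beta>\<close> (see \<open>weight_bcoord\<close>).\<close>

definition bcoord :: "nat \<Rightarrow> 'n::{finite,linorder} weight \<Rightarrow> int" where
  "bcoord k \<beta> =
     (if k \<le> CARD('n) then - (\<Sum>j | pos j < k. (int k - int (pos j)) * \<beta> $ j)
      else (\<Sum>j\<in>UNIV. (int k - int (pos j)) * \<beta> $ j))"

lemma bcoord_eq:
  assumes "l \<le> CARD('n) + 1"
  shows "bcoord l (\<beta> :: 'n::{finite,linorder} weight) =
    (if l \<le> CARD('n) then -1 else 1) * (\<Sum>j\<in>UNIV. max 0 (int l - int (pos j)) * \<beta> $ j)"
proof (cases "l \<le> CARD('n)")
  case True
  have "(\<Sum>j | pos j < l. (int l - int (pos j)) * \<beta> $ j) = (\<Sum>j\<in>UNIV. max 0 (int l - int (pos j)) * \<beta> $ j)"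
    by (rule sum.mono_neutral_cong_left) auto
  with True show ?thesis by (simp add: bcoord_def)
next
  case False
  have "(\<Sum>j\<in>UNIV. (int l - int (pos j)) * \<beta> $ j) = (\<Sum>j\<in>UNIV. max 0 (int l - int (pos j)) * \<beta> $ j)"
  proof (rule sum.cong)
    show "(int l - int (pos j)) * \<beta> $ j = max 0 (int l - int (pos j)) * \<beta> $ j" for j
      using pos_bounds(2)[of j] False by auto
  qed simp
  with False show ?thesis by (simp add: bcoord_def)
qed

lemma weight_bcoord:
  fixes \<beta> :: "'n::{finite,linorder} weight"
  shows "\<beta> = (\<Sum>j | 2 \<le> pos j. bcoord (pos j) \<beta> *s simple_root j) + bcoord (CARD('n) + 1) \<beta> *s fund_weight (Max UNIV)"
proof -
  define M where "M l = (\<Sum>j\<in>UNIV. max 0 (int l - int (pos j)) * \<beta> $ j)" for l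
  have M01: "M l = 0" if "l \<le> 1" for l
  proof -
    have "max 0 (int l - int (pos j)) = 0" for j :: 'n
      using that pos_bounds(1)[of j] by simp
    then show ?thesis by (simp add: M_def)
  qed
  have M2: "M (Suc p) * 2 - M p - M (Suc (Suc p)) = - \<beta> $ k" if "pos k = Suc p" for k p
  proof -
    have "M (Suc p) * 2 - M p - M (Suc (Suc p)) = (\<Sum>j\<in>UNIV. if j = k then - \<beta> $ j else 0)"
      unfolding M_def sum_subtractf[symmetric] sum_distrib_right
    proof (rule sum.cong)
      show "max 0 (int (Suc p) - int (pos j)) * \<beta> $ j * 2 - max 0 (int p - int (pos j)) * \<beta> $ j -
         max 0 (int (Suc (Suc p)) - int (pos j)) * \<beta> $ j = (if j = k then - \<beta> $ j else 0)" for j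
        using that pos_eq_iff[of j k] by (cases "pos j" "Suc p" rule: linorder_cases) (auto simp: max_def algebra_simps)
    qed simp
    then show ?thesis by simp
  qed
  have "((\<Sum>j | 2 \<le> pos j. bcoord (pos j) \<beta> *s simple_root j) + bcoord (CARD('n) + 1) \<beta> *s fund_weight (Max UNIV)) $ k = \<beta> $ k" for k
  proof -
    obtain p where p: "pos k = Suc p" using pos_bounds[of k] by (cases "pos k") auto
    have "(\<Sum>j | 2 \<le> pos j. bcoord (pos j) \<beta> * cartan j k) = - (\<Sum>j\<in>UNIV. cartan k j * M (pos j))"
      unfolding sum_negf[symmetric]
    proof (rule sum.mono_neutral_cong_left)
      fix j :: 'n assume "j \<in> {j. 2 \<le> pos j}"
      show "bcoord (pos j) \<beta> * cartan j k = - (cartan k j * M (pos j))"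
        using pos_bounds(2)[of j] by (simp add: bcoord_eq M_def cartan_sym[of j])
    qed (use M01 in auto)
    moreover have "(\<Sum>j\<in>UNIV. cartan k j * M (pos j)) =
      M (Suc p) * 2 - M p - (if Suc p = CARD('n) then 0 else M (Suc (Suc p)))"
      using sum_cartan_pos[of k M] M01[of 0] by (simp add: p)
    moreover have "bcoord (CARD('n) + 1) \<beta> = M (CARD('n) + 1)"
      by (simp add: bcoord_eq M_def)
    moreover have "fund_weight (Max UNIV) $ k = (if pos k = CARD('n) then 1 else 0)"
      by (simp add: fund_weight_def pos_Max[where 'n='n, symmetric] pos_eq_iff)
    ultimately show ?thesis using M2[OF p] p
      by (cases "Suc p = CARD('n)") (auto simp: simple_root_def)
  qed
  then show ?thesis by (simp add: vec_eq_iff)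
qed

lemma bcoord_root:
  fixes j :: "'n::{finite,linorder}"
  assumes "l \<le> CARD('n) + 1" "2 \<le> pos j"
  shows "bcoord l (simple_root j) = (if l = pos j then 1 else 0)"
proof -
  define h where "h i = max 0 (int l - int i)" for i
  obtain p where p: "pos j = Suc p" "p \<ge> 1" using assms by (cases "pos j") auto
  have "(\<Sum>k\<in>UNIV. h (pos k) * cartan j k) = 2 * h (Suc p) - h p - (if Suc p = CARD('n) then 0 else h (Suc (Suc p)))"
    using sum_cartan_pos[of j h] p by (simp add: mult.commute)
  also have "Suc p = CARD('n) \<Longrightarrow> h (Suc (Suc p)) = 0"
    using assms by (simp add: h_def)
  then have "(if Suc p = CARD('n) then 0 else h (Suc (Suc p))) = h (Suc (Suc p))" by simp
  also have "2 * h (Suc p) - h p - h (Suc (Suc p)) = (if l = pos j then -1 else 0)"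
    by (cases "l" "Suc p" rule: linorder_cases) (auto simp: h_def p max_def)
  finally show ?thesis
    using assms pos_bounds(2)[of j] by (auto simp: bcoord_eq simple_root_def h_def)
qed

lemma bcoord_fund:
  assumes "l \<le> CARD('n) + 1"
  shows "bcoord l (fund_weight (Max (UNIV :: 'n::{finite,linorder} set))) = (if l = CARD('n) + 1 then 1 else 0)"
  using assms by (auto simp: bcoord_eq fund_weight_def pos_Max if_distrib cong: if_cong)

lemma bcoord_add: "bcoord l (\<alpha> + \<beta>) = bcoord l \<alpha> + bcoord l \<beta>"
  by (simp add: bcoord_def distrib_left sum.distrib)

text \<open>The twisted group algebra has the basis of the ordered monomials
  \<open>e(\<beta>) = e(\<alpha>\<^sub>2)\<^bsup>m\<^sub>2\<^esup> \<dots> e(\<alpha>\<^sub>n)\<^bsup>m\<^sub>n\<^esup> e(\<lambda>\<^sub>n)\<^bsup>m\<^sub>n\<^sub>+\<^sub>1\<^esup>\<close>, and \<open>e(\<alpha>) e(\<beta>) = twist \<alpha> \<beta> e(\<alpha> + \<beta>)\<close>. Two distinct generators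
  anticommute if they are neighbours in the above order, and commute otherwise; hence reordering the
  product of two ordered monomials produces a sign for each generator number \<open>k + 1\<close> in the left
  factor and each generator number \<open>k\<close> in the right factor. The relations are verified in
  \<open>twist_root_root\<close>, \<open>twist_root_fund\<close>, \<open>twist_cocycle\<close> and \<open>twist_ordered\<close>.\<close>

definition twist :: "'n::{finite,linorder} weight \<Rightarrow> 'n weight \<Rightarrow> qfield" where
  "twist \<alpha> \<beta> = (-1) powi (\<Sum>k=2..CARD('n). bcoord (k + 1) \<alpha> * bcoord k \<beta>)"


lemma twist_cocycle: "twist \<alpha> \<beta> * twist (\<alpha> + \<beta>) \<gamma> = twist \<alpha> (\<beta> + \<gamma>) * twist \<beta> \<gamma>"
  by (simp add: twist_def power_int_add[symmetric] bcoord_add algebra_simps sum.distrib)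

lemma bcoord_zero: "bcoord l 0 = 0"
  using bcoord_add[of l 0 0] by simp

lemma twist_zero: "twist 0 \<beta> = 1" "twist \<beta> 0 = 1"
  by (simp_all add: twist_def bcoord_zero)

lemma twist_root_root:
  fixes i j :: "'n::{finite,linorder}"
  assumes "2 \<le> pos i" "2 \<le> pos j"
  shows "twist (simple_root i) (simple_root j) = (-1) powi cartan i j * twist (simple_root j) (simple_root i)"
proof -
  have *: "(\<Sum>k=2..CARD('n). bcoord (k + 1) (simple_root i) * bcoord k (simple_root j)) = (if pos i = pos j + 1 then 1 else 0)"
    if "2 \<le> pos i" "2 \<le> pos j" for i j :: 'n
  proof -
    have "(\<Sum>k=2..CARD('n). bcoord (k + 1) (simple_root i) * bcoord k (simple_root j)) =
      (\<Sum>k=2..CARD('n). if k = pos j then (if pos i = pos j + 1 then 1 else 0) else 0)"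
      using that by (intro sum.cong) (auto simp: bcoord_root)
    then show ?thesis using that pos_bounds(2)[of j] by simp
  qed
  show ?thesis using *[OF assms] *[OF assms(2,1)] pos_eq_iff[of i j]
    by (auto simp: twist_def cartan_def)
qed

lemma twist_root_fund:
  fixes i :: "'n::{finite,linorder}"
  assumes "2 \<le> pos i"
  shows "twist (simple_root i) (fund_weight (Max UNIV)) =
    (-1) powi (if i = Max UNIV then 1 else 0) * twist (fund_weight (Max UNIV)) (simple_root i)"
proof -
  let ?m = "Max (UNIV :: 'n set)"
  have "(\<Sum>k=2..CARD('n). bcoord (k + 1) (simple_root i) * bcoord k (fund_weight ?m)) = 0"
    by (intro sum.neutral) (auto simp: bcoord_fund)
  moreover have "(\<Sum>k=2..CARD('n). bcoord (k + 1) (fund_weight ?m) * bcoord k (simple_root i)) =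
     (\<Sum>k=2..CARD('n). if k = CARD('n) then (if i = ?m then 1 else 0) else 0)"
    using assms pos_eq_iff[of i ?m] by (intro sum.cong) (auto simp: bcoord_fund bcoord_root pos_Max)
  moreover have "2 \<le> CARD('n)" using assms pos_bounds(2)[of i] by simp
  ultimately show ?thesis by (simp add: twist_def)
qed

lemma twist_ordered:
  fixes \<alpha> \<beta> :: "'n::{finite,linorder} weight"
  assumes "\<And>l. 2 \<le> l \<Longrightarrow> l \<le> CARD('n) + 1 \<Longrightarrow> l \<noteq> k \<Longrightarrow> bcoord l \<alpha> = 0"
    and "\<And>l. 2 \<le> l \<Longrightarrow> l < k \<Longrightarrow> bcoord l \<beta> = 0"
  shows "twist \<alpha> \<beta> = 1"
proof -
  have "(\<Sum>l=2..CARD('n). bcoord (l + 1) \<alpha> * bcoord l \<beta>) = 0"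
  proof (intro sum.neutral ballI)
    fix l assume "l \<in> {2..CARD('n)}"
    then show "bcoord (l + 1) \<alpha> * bcoord l \<beta> = 0"
      using assms(1)[of "l + 1"] assms(2)[of l] by (cases "l + 1 = k") auto
  qed
  then show ?thesis by (simp add: twist_def)
qed


section \<open>The space V\<close>

text \<open>\<open>K(1)\<close> is the polynomial algebra in the variables \<open>a\<^sub>i(-r)\<close>, \<open>r \<ge> 1\<close>; the variable \<open>a\<^sub>i(-r)\<close> is
  indexed by the pair \<open>(i, r - 1)\<close>. The tensor product of \<open>K(1)\<close> with the twisted group algebra
  consists of the finite sums of \<open>v\<^sub>\<beta> \<otimes> e(\<beta>)\<close>, given as the finitely supported function
  \<open>\<beta> \<mapsto> v\<^sub>\<beta>\<close>.\<close>

type_synonym 'n fock = "(('n \<times> nat) \<Rightarrow>\<^sub>0 nat) \<Rightarrow>\<^sub>0 qfield"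
type_synonym 'n vspace = "'n weight \<Rightarrow>\<^sub>0 'n fock"

definition fock_scale :: "qfield \<Rightarrow> 'n fock \<Rightarrow> 'n fock" where
  "fock_scale c p = Poly_Mapping.single 0 c * p"

definition v_scale :: "qfield \<Rightarrow> 'n::finite vspace \<Rightarrow> 'n vspace" where
  "v_scale c v = Poly_Mapping.map (fock_scale c) v"

definition tensor_e :: "'n fock \<Rightarrow> 'n::finite weight \<Rightarrow> 'n vspace" where
  "tensor_e p \<beta> = Poly_Mapping.single \<beta> p"

definition vac :: "'n::finite vspace" where
  "vac = tensor_e 1 0"

definition fock_var :: "'n \<times> nat \<Rightarrow> 'n fock" where
  "fock_var x = Poly_Mapping.single (Poly_Mapping.single x 1) 1"

text \<open>The derivation of the polynomial algebra that maps each variable \<open>x\<close> to the scalar \<open>c x\<close>.\<close>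

definition fock_deriv :: "('n \<times> nat \<Rightarrow> qfield) \<Rightarrow> 'n fock \<Rightarrow> 'n fock" where
  "fock_deriv c p =
     (\<Sum>m\<in>Poly_Mapping.keys p. \<Sum>x\<in>Poly_Mapping.keys m.
        Poly_Mapping.single (m - Poly_Mapping.single x 1)
          (Poly_Mapping.lookup p m * of_nat (Poly_Mapping.lookup m x) * c x))"

lemma fock_deriv_eq:
  assumes "finite K" "Poly_Mapping.keys p \<subseteq> K"
  shows "fock_deriv c p = (\<Sum>m\<in>K. \<Sum>x\<in>Poly_Mapping.keys m.
        Poly_Mapping.single (m - Poly_Mapping.single x 1)
          (Poly_Mapping.lookup p m * of_nat (Poly_Mapping.lookup m x) * c x))"
  unfolding fock_deriv_def
  by (rule sum.mono_neutral_left) (use assms in \<open>auto simp: in_keys_iff\<close>)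

lemma fock_deriv_add: "fock_deriv c (p + r) = fock_deriv c p + fock_deriv c r"
proof -
  let ?K = "Poly_Mapping.keys p \<union> Poly_Mapping.keys r"
  have K: "finite ?K" "Poly_Mapping.keys (p + r) \<subseteq> ?K" by (simp_all add: Poly_Mapping.keys_add)
  show ?thesis
    by (subst (1 2 3) fock_deriv_eq[of ?K])
       (use K in \<open>auto simp: lookup_add algebra_simps single_add sum.distrib\<close>)
qed

lemma fock_deriv_single:
  "fock_deriv c (Poly_Mapping.single m a) = (\<Sum>x\<in>Poly_Mapping.keys m.
     Poly_Mapping.single (m - Poly_Mapping.single x 1) (a * of_nat (Poly_Mapping.lookup m x) * c x))"
  by (subst fock_deriv_eq[of "{m}"]) auto

lemma fock_deriv_scalar: "fock_deriv c (Poly_Mapping.single 0 a) = 0"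
  by (simp add: fock_deriv_single)

lemma fock_deriv_var: "fock_deriv c (fock_var x) = Poly_Mapping.single 0 (c x)"
  by (simp add: fock_var_def fock_deriv_single)

lemma fock_deriv_zero: "fock_deriv c 0 = 0"
  by (simp add: fock_deriv_def)

lemma fock_deriv_sum: "fock_deriv c (\<Sum>i\<in>I. f i) = (\<Sum>i\<in>I. fock_deriv c (f i))"
  by (induction I rule: infinite_finite_induct) (auto simp: fock_deriv_add fock_deriv_zero)

lemma fock_deriv_single_mult:
  "fock_deriv c (Poly_Mapping.single m a * Poly_Mapping.single m' b) =
   fock_deriv c (Poly_Mapping.single m a) * Poly_Mapping.single m' b +
   Poly_Mapping.single m a * fock_deriv c (Poly_Mapping.single m' b)"
proof -
  have *: "fock_deriv c (Poly_Mapping.single m a) = (\<Sum>x\<in>K.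
     Poly_Mapping.single (m - Poly_Mapping.single x 1) (a * of_nat (Poly_Mapping.lookup m x) * c x))"
    if "finite K" "Poly_Mapping.keys m \<subseteq> K" for K m a
    unfolding fock_deriv_single
    by (rule sum.mono_neutral_left) (use that in \<open>auto simp: in_keys_iff\<close>)
  let ?K = "Poly_Mapping.keys m \<union> Poly_Mapping.keys m'"
  have K: "finite ?K" "Poly_Mapping.keys (m + m') \<subseteq> ?K" by (simp_all add: Poly_Mapping.keys_add)
  have sub: "m + m' - Poly_Mapping.single x 1 = (m - Poly_Mapping.single x 1) + m'"
    if "Poly_Mapping.lookup m x \<noteq> 0" for x and m m' :: "'a \<times> nat \<Rightarrow>\<^sub>0 nat"
    using that by (intro poly_mapping_eqI) (auto simp: lookup_add lookup_minus lookup_single when_def)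
  have 1: "Poly_Mapping.single (m + m' - Poly_Mapping.single x 1) (a * b * of_nat (Poly_Mapping.lookup m x) * c x) =
     Poly_Mapping.single (m - Poly_Mapping.single x 1) (a * of_nat (Poly_Mapping.lookup m x) * c x) * Poly_Mapping.single m' b" for x
    by (cases "Poly_Mapping.lookup m x = 0") (auto simp: sub[unfolded One_nat_def] mult_single mult_ac add.commute[of "m - z" for z])
  have 2: "Poly_Mapping.single (m + m' - Poly_Mapping.single x 1) (a * b * of_nat (Poly_Mapping.lookup m' x) * c x) =
     Poly_Mapping.single m a * Poly_Mapping.single (m' - Poly_Mapping.single x 1) (b * of_nat (Poly_Mapping.lookup m' x) * c x)" for x
    by (cases "Poly_Mapping.lookup m' x = 0") (auto simp: sub[of m' _ m, unfolded One_nat_def add.commute[of m']] mult_single mult_ac add.commute[of "m' - z" for z])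
  have "fock_deriv c (Poly_Mapping.single (m + m') (a * b)) =
     (\<Sum>x\<in>?K. Poly_Mapping.single (m + m' - Poly_Mapping.single x 1) (a * b * of_nat (Poly_Mapping.lookup m x) * c x) +
       Poly_Mapping.single (m + m' - Poly_Mapping.single x 1) (a * b * of_nat (Poly_Mapping.lookup m' x) * c x))"
    by (subst *[OF K]) (simp add: lookup_add algebra_simps single_add[symmetric])
  also have "\<dots> = fock_deriv c (Poly_Mapping.single m a) * Poly_Mapping.single m' b +
   Poly_Mapping.single m a * fock_deriv c (Poly_Mapping.single m' b)"
    unfolding 1 2 sum.distrib
    by (subst (1 2) *[of ?K]) (auto simp: sum_distrib_left sum_distrib_right)
  finally show ?thesis by (simp add: mult_single)
qed

lemma fock_sum_singles:
  "(\<Sum>m\<in>Poly_Mapping.keys p. Poly_Mapping.single m (Poly_Mapping.lookup p m)) = (p :: 'n fock)"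
  by (rule poly_mapping_eqI) (auto simp: lookup_sum lookup_single when_def in_keys_iff)

lemma fock_deriv_mult: "fock_deriv c (p * r) = fock_deriv c p * r + p * fock_deriv c r"
proof -
  have 1: "fock_deriv c (Poly_Mapping.single m a * (\<Sum>i\<in>I. Poly_Mapping.single i (f i))) =
     fock_deriv c (Poly_Mapping.single m a) * (\<Sum>i\<in>I. Poly_Mapping.single i (f i)) +
     Poly_Mapping.single m a * fock_deriv c (\<Sum>i\<in>I. Poly_Mapping.single i (f i))" for m a f and I :: "('a \<times> nat \<Rightarrow>\<^sub>0 nat) set"
    by (simp only: sum_distrib_left fock_deriv_sum fock_deriv_single_mult sum.distrib)
  have 2: "fock_deriv c (Poly_Mapping.single m a * r) =
     fock_deriv c (Poly_Mapping.single m a) * r + Poly_Mapping.single m a * fock_deriv c r" for m a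
    using 1[of m a "Poly_Mapping.lookup r" "Poly_Mapping.keys r"] by (simp only: fock_sum_singles)
  have "fock_deriv c ((\<Sum>i\<in>I. Poly_Mapping.single i (f i)) * r) =
     fock_deriv c (\<Sum>i\<in>I. Poly_Mapping.single i (f i)) * r +
     (\<Sum>i\<in>I. Poly_Mapping.single i (f i)) * fock_deriv c r" for f and I :: "('a \<times> nat \<Rightarrow>\<^sub>0 nat) set"
    by (simp only: sum_distrib_right fock_deriv_sum 2 sum.distrib)
  from this[of "Poly_Mapping.lookup p" "Poly_Mapping.keys p"] show ?thesis
    by (simp only: fock_sum_singles)
qed

text \<open>The operator \<open>a\<^sub>i(l)\<close>, \<open>l \<noteq> 0\<close>, on \<open>K(1)\<close>.\<close>

definition heis :: "'n::{finite,linorder} \<Rightarrow> int \<Rightarrow> 'n fock \<Rightarrow> 'n fock" where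
  "heis i l p =
     (if l < 0 then fock_var (i, nat (- l) - 1) * p
      else if l > 0 then
        fock_deriv (\<lambda>(j, s). if l = int s + 1 then qint (cartan i j * l) * qint l / of_int l else 0) p
      else 0)"

lemma heis_commute_pos_neg:
  fixes i j :: "'n::{finite,linorder}"
  assumes "r > 0" "s > 0"
  shows "heis i r (heis j (- s) p) - heis j (- s) (heis i r p) =
    fock_scale (if r = s then qint (cartan i j * r) * qint r / of_int r else 0) p"
  using assms by (auto simp: heis_def fock_deriv_mult fock_deriv_var fock_scale_def)

definition mcoeff :: "'n::{finite,linorder} \<Rightarrow> 'n \<Rightarrow> int \<Rightarrow> qfield" where
  "mcoeff i j l =
     (let n = int CARD('n) in
      if j \<le> i then qint (int (pos j) * l) * qint ((n - int (pos i) + 1) * l) / (qint ((n + 1) * l) * qint l)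
      else qint (int (pos i) * l) * qint ((n - int (pos j) + 1) * l) / (qint ((n + 1) * l) * qint l))"

definition heis_star :: "'n::{finite,linorder} \<Rightarrow> int \<Rightarrow> 'n fock \<Rightarrow> 'n fock" where
  "heis_star i l p = (\<Sum>j\<in>UNIV. fock_scale (mcoeff i j l) (heis j l p))"


section \<open>Formal series of operators\<close>

text \<open>An element of \<open>Hom(V, V((u)))\<close> is a map \<open>'n vspace \<Rightarrow> 'n vspace fls\<close>. Elements of
  \<open>Hom(V, V((z)))\<close> are represented with \<open>u = z\<close>, whereas elements of
  \<open>Hom(V, V((z\<^bsup>1/(n+1)\<^esup>)))\<close> are represented with \<open>u = z\<^bsup>1/(n+1)\<^esup>\<close>. In the latter case the
  coefficient at \<open>z\<^sup>k\<close> is therefore the one with index \<open>(n + 1) * k\<close>. In the products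
  below, the left factor is always of the first kind and the right factor and the result are of the
  second kind.\<close>

type_synonym 'n vop = "'n vspace \<Rightarrow> 'n vspace fls"

definition series_scale :: "qfield \<Rightarrow> 'n::finite vspace fls \<Rightarrow> 'n vspace fls" where
  "series_scale c f = Abs_fls (\<lambda>k. v_scale c (f $$ k))"

definition op_scale :: "qfield \<Rightarrow> 'n::finite vop \<Rightarrow> 'n vop" where
  "op_scale c a = (\<lambda>v. series_scale c (a v))"

lemma fock_scale_simps:
  "fock_scale c (p + r) = fock_scale c p + fock_scale c r"
  "fock_scale (c + d) p = fock_scale c p + fock_scale d p"
  "fock_scale c (fock_scale d p) = fock_scale (c * d) p"
  "fock_scale 1 p = p"
  "fock_scale c 0 = 0"
  by (simp_all add: fock_scale_def algebra_simps single_add mult_single mult.assoc[symmetric])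

lemma v_scale_lookup: "Poly_Mapping.lookup (v_scale c v) \<beta> = fock_scale c (Poly_Mapping.lookup v \<beta>)"
  by (simp add: v_scale_def map.rep_eq fock_scale_def when_def)

lemma v_scale_zero: "v_scale c 0 = 0"
  by (rule poly_mapping_eqI) (simp add: v_scale_lookup fock_scale_def)

lemma series_scale_nth: "series_scale c f $$ k = v_scale c (f $$ k)"
proof -
  obtain L where "\<And>k. k < L \<Longrightarrow> f $$ k = 0" using fls_nth_vanishes_belowE[of f] by metis
  then show ?thesis unfolding series_scale_def
    by (subst nth_Abs_fls_lower_bound[of L]) (auto simp: v_scale_zero)
qed

interpretation op_space: vector_space "op_scale :: qfield \<Rightarrow> 'n::finite vop \<Rightarrow> 'n vop"
  by standard
     (auto intro!: fls_eqI poly_mapping_eqI simp: fun_eq_iff op_scale_def series_scale_nth v_scale_lookup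
       lookup_add fock_scale_simps)

text \<open>For operators \<open>A\<^sub>r\<close>, \<open>r \<ge> 1\<close>, the operators \<open>op_pow_coeff A m k\<close> and \<open>op_exp_coeff A k\<close> are the
  coefficients at \<open>\<zeta>\<^sup>k\<close> of the \<open>m\<close>-th power and of the exponential of \<open>\<Sum>\<^bsub>r\<ge>1\<^esub> A\<^sub>r \<zeta>\<^sup>r\<close>.\<close>

primrec op_pow_coeff :: "(nat \<Rightarrow> 'n fock \<Rightarrow> 'n fock) \<Rightarrow> nat \<Rightarrow> nat \<Rightarrow> 'n fock \<Rightarrow> 'n fock" where
  "op_pow_coeff A 0 k p = (if k = 0 then p else 0)"
| "op_pow_coeff A (Suc m) k p = (\<Sum>r=1..k. A r (op_pow_coeff A m (k - r) p))"

definition op_exp_coeff :: "(nat \<Rightarrow> 'n fock \<Rightarrow> 'n fock) \<Rightarrow> nat \<Rightarrow> 'n fock \<Rightarrow> 'n fock" where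
  "op_exp_coeff A k p = (\<Sum>m\<le>k. fock_scale (1 / fact m) (op_pow_coeff A m k p))"

text \<open>The operator \<open>exp (\<Sum>\<^bsub>r\<ge>1\<^esub> A\<^sub>r z\<^sup>r) exp (\<Sum>\<^bsub>r\<ge>1\<^esub> B\<^sub>r z\<^bsup>-r\<^esup>) \<otimes> T\<close> where
  \<open>T e(\<beta>) = \<sigma> \<beta> u\<^bsup>d \<beta>\<^esup> e(\<beta> + \<alpha>)\<close> and \<open>z = u\<^sup>N\<close>.\<close>

definition vertex_op ::
  "int \<Rightarrow> (nat \<Rightarrow> 'n fock \<Rightarrow> 'n fock) \<Rightarrow> (nat \<Rightarrow> 'n fock \<Rightarrow> 'n fock) \<Rightarrow>
   'n::finite weight \<Rightarrow> ('n weight \<Rightarrow> qfield) \<Rightarrow> ('n weight \<Rightarrow> int) \<Rightarrow> 'n vop" where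
  "vertex_op N A B \<alpha> \<sigma> d v = Abs_fls (\<lambda>m.
     \<Sum>\<beta>\<in>Poly_Mapping.keys v. Sum_any (\<lambda>l. Sum_any (\<lambda>k.
       if N * (int k - int l) + d \<beta> = m
       then tensor_e (fock_scale (\<sigma> \<beta>) (op_exp_coeff A k (op_exp_coeff B l (Poly_Mapping.lookup v \<beta>)))) (\<beta> + \<alpha>)
       else 0)))"

text \<open>\<open>x_op s j\<close> is \<open>x\<^sub>j\<^sup>+(z)\<close> for \<open>s = 1\<close> and \<open>x\<^sub>j\<^sup>-(z)\<close> for \<open>s = -1\<close>.\<close>

definition x_op :: "int \<Rightarrow> 'n::{finite,linorder} \<Rightarrow> 'n vop" where
  "x_op s j = vertex_op 1
     (\<lambda>r p. fock_scale (of_int s * qh powi (- s * int r) / qint (int r)) (heis j (- int r) p))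
     (\<lambda>r p. fock_scale (- (of_int s * qh powi (- s * int r) / qint (int r))) (heis j (int r) p))
     (s *s simple_root j)
     (\<lambda>\<beta>. twist (s *s simple_root j) \<beta>)
     (\<lambda>\<beta>. s * iform (simple_root j) \<beta>)"

definition x_plus :: "'n::{finite,linorder} \<Rightarrow> 'n vop" where
  "x_plus j = x_op 1 j"

definition x_minus :: "'n::{finite,linorder} \<Rightarrow> 'n vop" where
  "x_minus j = x_op (-1) j"

definition psi_op :: "'n::{finite,linorder} \<Rightarrow> 'n vop" where
  "psi_op j = vertex_op 1
     (\<lambda>r p. 0)
     (\<lambda>r p. fock_scale (qq - inverse qq) (heis j (int r) p))
     0
     (\<lambda>\<beta>. qq powi iform (simple_root j) \<beta>)
     (\<lambda>\<beta>. 0)"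

definition phi_op :: "'n::{finite,linorder} \<Rightarrow> 'n vop" where
  "phi_op j = vertex_op 1
     (\<lambda>r p. fock_scale (- (qq - inverse qq)) (heis j (- int r) p))
     (\<lambda>r p. 0)
     0
     (\<lambda>\<beta>. qq powi (- iform (simple_root j) \<beta>))
     (\<lambda>\<beta>. 0)"

definition Y_op :: "'n::{finite,linorder} \<Rightarrow> 'n vop" where
  "Y_op i = vertex_op (int CARD('n) + 1)
     (\<lambda>r p. fock_scale (qh powi int r / qint (int r)) (heis_star i (- int r) p))
     (\<lambda>r p. fock_scale (- (qh powi int r / qint (int r))) (heis_star i (int r) p))
     (fund_weight i)
     (\<lambda>\<beta>. twist (fund_weight i) \<beta> *
        minus_one_rat_pow
          ((if i = Max UNIV then 0 else of_nat (pos i)) * form (fund_weight (Max UNIV)) \<beta>))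
     (\<lambda>\<beta>. \<lfloor>of_nat (CARD('n) + 1) * form (fund_weight i) \<beta>\<rfloor>)"


section \<open>Products\<close>

text \<open>\<open>a(z\<^sub>1) b(z\<^sub>2) v\<close>, as the family of its coefficients; here and below the first index \<open>k\<close> refers to
  \<open>z\<^sub>1\<^sup>k\<close> and the second index \<open>l\<close> to \<open>z\<^sub>2\<^bsup>l/(n+1)\<^esup>\<close>.\<close>

definition two_point :: "'n::finite vop \<Rightarrow> 'n vop \<Rightarrow> 'n vspace \<Rightarrow> int \<Rightarrow> int \<Rightarrow> 'n vspace" where
  "two_point a b v k l = a (b v $$ l) $$ k"

text \<open>Multiplication by a polynomial \<open>p(z\<^sub>1, z\<^sub>2)\<close>, given as a polynomial in \<open>z\<^sub>1\<close> whose coefficients are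
  polynomials in \<open>z\<^sub>2\<close>.\<close>

definition poly2_mult ::
  "qfield poly poly \<Rightarrow> (int \<Rightarrow> int \<Rightarrow> 'n::finite vspace) \<Rightarrow> int \<Rightarrow> int \<Rightarrow> 'n vspace" where
  "poly2_mult p c k l =
     (\<Sum>r\<le>degree p. \<Sum>s\<le>degree (coeff p r).
        v_scale (coeff (coeff p r) s) (c (k - int r) (l - (int CARD('n) + 1) * int s)))"

definition in_laurent2 :: "(int \<Rightarrow> int \<Rightarrow> 'n::finite vspace) \<Rightarrow> bool" where
  "in_laurent2 c \<longleftrightarrow> (\<exists>L. \<forall>k l. k < L \<or> l < L \<longrightarrow> c k l = 0)"

definition qc_witness :: "qfield poly poly \<Rightarrow> 'n::finite vop \<Rightarrow> 'n vop \<Rightarrow> bool" where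
  "qc_witness p a b \<longleftrightarrow> p \<noteq> 0 \<and> (\<forall>v. in_laurent2 (poly2_mult p (two_point a b v)))"

text \<open>\<open>c(z\<^sub>1, z)\<close> at \<open>z\<^sub>1 = z + z\<^sub>0\<close>, expanded in nonnegative powers of \<open>z\<^sub>0\<close>. The outer series is in \<open>z\<^sub>0\<close>,
  the inner one in \<open>z\<^bsup>1/(n+1)\<^esup>\<close>.\<close>

definition subst_shift :: "(int \<Rightarrow> int \<Rightarrow> 'n::finite vspace) \<Rightarrow> 'n vspace fls fls" where
  "subst_shift c = Abs_fls (\<lambda>m. if m < 0 then 0 else
     Abs_fls (\<lambda>l. Sum_any (\<lambda>k :: int.
       v_scale (of_int k gchoose nat m) (c k (l - (int CARD('n) + 1) * (k - m))))))"

text \<open>\<open>p(z\<^sub>0 + z, z)\<close> as an element of the field \<open>F((z))((z\<^sub>0))\<close>; its expanded inverse is the inverse in that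
  field.\<close>

definition poly2_shift :: "qfield poly poly \<Rightarrow> qfield fls fls" where
  "poly2_shift p =
     poly (map_poly (\<lambda>c. fls_const (fps_to_fls (fps_of_poly c))) p) (fls_X + fls_const fls_X)"

text \<open>The action of \<open>F((z))\<close> on \<open>V((z\<^bsup>1/(n+1)\<^esup>))\<close> and that of \<open>F((z))((z\<^sub>0))\<close> on
  \<open>V((z\<^bsup>1/(n+1)\<^esup>))((z\<^sub>0))\<close>.\<close>

definition series_act :: "qfield fls \<Rightarrow> 'n::finite vspace fls \<Rightarrow> 'n vspace fls" where
  "series_act f g = Abs_fls (\<lambda>l. Sum_any (\<lambda>k. v_scale (f $$ k) (g $$ (l - (int CARD('n) + 1) * k))))"

definition series_act2 :: "qfield fls fls \<Rightarrow> 'n::finite vspace fls fls \<Rightarrow> 'n vspace fls fls" where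
  "series_act2 f g = Abs_fls (\<lambda>m. Sum_any (\<lambda>k. series_act (f $$ k) (g $$ (m - k))))"

text \<open>The product \<open>a(z)\<^sub>r b(z)\<close>, the coefficient at \<open>z\<^sub>0\<^bsup>-r-1\<^esup>\<close>; meaningful for quasi compatible pairs, for which
  it does not depend on the choice of \<open>p\<close>.\<close>

definition rprod :: "int \<Rightarrow> 'n::finite vop \<Rightarrow> 'n vop \<Rightarrow> 'n vop" where
  "rprod r a b = (let p = (SOME p. qc_witness p a b) in
     (\<lambda>v. series_act2 (inverse (poly2_shift p)) (subst_shift (poly2_mult p (two_point a b v))) $$ (- r - 1)))"

definition has_wt :: "'n::finite vop \<Rightarrow> 'n weight \<Rightarrow> bool" where
  "has_wt c \<alpha> \<longleftrightarrow> (\<exists>d :: 'n fock fls. \<forall>k. c vac $$ k = tensor_e (d $$ k) \<alpha>)"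

definition wt :: "'n::finite vop \<Rightarrow> 'n weight" where
  "wt c = (THE \<alpha>. has_wt c \<alpha>)"

text \<open>\<open>a(z q\<^bsup>s/2\<^esup>)\<close> for \<open>a(z)\<close> with integral powers of \<open>z\<close>.\<close>

definition q_dilate :: "int \<Rightarrow> 'n::finite vop \<Rightarrow> 'n vop" where
  "q_dilate s a = (\<lambda>v. Abs_fls (\<lambda>k. v_scale (qh powi (s * k)) (a v $$ k)))"

definition z_pow_mult :: "int \<Rightarrow> 'n::finite vop \<Rightarrow> 'n vop" where
  "z_pow_mult e b = (\<lambda>v. fls_shift (- (int CARD('n) + 1) * e) (b v))"

text \<open>The product of \<open>a(z)\<close> with an operator \<open>b(z)\<close> of weight \<open>\<gamma>\<close>; the summation variable is
  \<open>t = s / 2\<close>.\<close>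

definition bullet_wt :: "'n::{finite,linorder} weight \<Rightarrow> 'n vop \<Rightarrow> 'n vop \<Rightarrow> 'n vop" where
  "bullet_wt \<gamma> a b = (let e = iform (wt a) \<gamma> + 1 in
     Sum_any (\<lambda>s. op_scale ((1 / qh powi s) powi e * qh powi s)
                    (z_pow_mult (- e) (rprod 0 (q_dilate s a) b))))"

text \<open>The component of \<open>b(z)\<close> that maps each \<open>K(1) \<otimes> e(\<beta>)\<close> to \<open>K(1) \<otimes> e(\<gamma> + \<beta>)\<close>. It has weight \<open>\<gamma>\<close>. All operators
  obtained from \<open>\<Y>\<^sub>i(z)\<close> by iterated products are equal to one of their components. The linear extension of
  the product to sums of operators of different weights is taken along this decomposition, since \<open>has_wt\<close>
  only refers to the vacuum vector: an operator annihilating it has every weight, and nonzero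
  operators of this kind occur as linear combinations of iterated products.\<close>

definition op_component :: "'n::finite weight \<Rightarrow> 'n vop \<Rightarrow> 'n vop" where
  "op_component \<gamma> b = (\<lambda>v. Abs_fls (\<lambda>k. \<Sum>\<beta>\<in>Poly_Mapping.keys v.
     tensor_e (Poly_Mapping.lookup (b (tensor_e (Poly_Mapping.lookup v \<beta>) \<beta>) $$ k) (\<gamma> + \<beta>)) (\<gamma> + \<beta>)))"

lemma op_component_nth:
  "op_component \<gamma> b v $$ k = (\<Sum>\<beta>\<in>Poly_Mapping.keys v.
     tensor_e (Poly_Mapping.lookup (b (tensor_e (Poly_Mapping.lookup v \<beta>) \<beta>) $$ k) (\<gamma> + \<beta>)) (\<gamma> + \<beta>))"
proof -
  define c where "c \<beta> k = tensor_e (Poly_Mapping.lookup (b (tensor_e (Poly_Mapping.lookup v \<beta>) \<beta>) $$ k) (\<gamma> + \<beta>)) (\<gamma> + \<beta>)" for \<beta> k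
  have "\<forall>\<beta>. \<exists>L. \<forall>k<L. c \<beta> k = 0"
    unfolding c_def tensor_e_def using fls_nth_vanishes_belowE by (metis lookup_zero single_zero)
  then obtain L where L: "\<And>\<beta> k. k < L \<beta> \<Longrightarrow> c \<beta> k = 0" by metis
  define L' where "L' = Min (insert 0 (L ` Poly_Mapping.keys v))"
  have "(\<Sum>\<beta>\<in>Poly_Mapping.keys v. c \<beta> k) = 0" if "k < L'" for k
    using that by (intro sum.neutral ballI L) (auto simp: L'_def)
  then show ?thesis unfolding op_component_def c_def[symmetric]
    by (subst nth_Abs_fls_lower_bound[of L']) auto
qed

lemma has_wt_op_component: "has_wt (op_component \<gamma> b) \<gamma>"
proof -
  define d where "d = Abs_fls (\<lambda>k. Poly_Mapping.lookup (b vac $$ k) \<gamma>)"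
  obtain L where L: "\<And>k. k < L \<Longrightarrow> b vac $$ k = 0" using fls_nth_vanishes_belowE[of "b vac"] by metis
  have "d $$ k = Poly_Mapping.lookup (b vac $$ k) \<gamma>" for k
    unfolding d_def using L by (subst nth_Abs_fls_lower_bound[of L]) auto
  then have "op_component \<gamma> b vac $$ k = tensor_e (d $$ k) \<gamma>" for k
    by (simp add: op_component_nth) (simp add: vac_def tensor_e_def)
  then show ?thesis unfolding has_wt_def by blast
qed

definition bullet :: "'n::{finite,linorder} vop \<Rightarrow> 'n vop \<Rightarrow> 'n vop" (infixr \<open>\<bullet>\<^sub>q\<close> 70) where
  "a \<bullet>\<^sub>q b = Sum_any (\<lambda>\<gamma>. bullet_wt \<gamma> a (op_component \<gamma> b))"

lemma rprod_zero:
  fixes a :: "'a::finite vop"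
  assumes "a 0 = 0"
  shows "rprod r a 0 = 0"
proof -
  have 1: "poly2_mult p (two_point a 0 v) = (\<lambda>k l. 0)" for p v
    by (simp add: fun_eq_iff poly2_mult_def two_point_def assms v_scale_zero)
  have 2: "subst_shift (\<lambda>k l. 0 :: 'a vspace) = 0"
    by (simp add: subst_shift_def v_scale_zero zero_fls_def[symmetric] cong: if_cong)
  have "series_act f 0 = (0 :: 'a vspace fls)" for f
    by (simp add: series_act_def v_scale_zero zero_fls_def[symmetric])
  then have 3: "series_act2 f 0 = (0 :: 'a vspace fls fls)" for f
    by (simp add: series_act2_def zero_fls_def[symmetric])
  show ?thesis unfolding rprod_def Let_def 1 2 3 by (simp add: fun_eq_iff)
qed

lemma bullet_homogeneous:
  fixes a b :: "'a::{finite,linorder} vop"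
  assumes "a 0 = 0" "op_component \<gamma> b = b"
  shows "a \<bullet>\<^sub>q b = bullet_wt \<gamma> a b"
proof -
  have "op_component \<gamma>' b = 0" if "\<gamma>' \<noteq> \<gamma>" for \<gamma>'
  proof (intro ext fls_eqI)
    fix v k
    have "Poly_Mapping.lookup (b (tensor_e p \<beta>) $$ k) (\<gamma>' + \<beta>) = 0" for p \<beta>
      by (subst assms(2)[symmetric]) (use that in \<open>simp add: op_component_nth, simp add: tensor_e_def lookup_single\<close>)
    then show "op_component \<gamma>' b v $$ k = 0 v $$ k"
      by (simp add: op_component_nth) (simp add: tensor_e_def)
  qed
  moreover have "bullet_wt \<gamma>' a 0 = 0" for \<gamma>'
  proof -
    have "q_dilate s a 0 = 0" for s
      by (simp add: q_dilate_def assms v_scale_zero zero_fls_def[symmetric])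
    then have "rprod 0 (q_dilate s a) 0 = 0" for s by (rule rprod_zero)
    moreover have "z_pow_mult e 0 = (0 :: 'a vop)" for e
      by (intro ext) (simp add: z_pow_mult_def)
    ultimately show ?thesis by (simp add: bullet_wt_def Let_def)
  qed
  ultimately have "bullet_wt \<gamma>' a (op_component \<gamma>' b) = (if \<gamma>' = \<gamma> then bullet_wt \<gamma> a b else 0)" for \<gamma>'
    using assms(2) by auto
  then show ?thesis by (simp add: bullet_def)
qed


section \<open>The space generated by \<open>\<Y>\<^sub>i(z)\<close>\<close>

definition generators :: "'n::{finite,linorder} vop set" where
  "generators = range x_plus \<union> range x_minus \<union> range psi_op \<union> range phi_op"

inductive_set Y_words :: "'n::{finite,linorder} \<Rightarrow> 'n vop set" for i where
  base: "Y_op i \<in> Y_words i"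
| step: "a \<in> generators \<Longrightarrow> b \<in> Y_words i \<Longrightarrow> a \<bullet>\<^sub>q b \<in> Y_words i"

definition Y_space :: "'n::{finite,linorder} \<Rightarrow> 'n vop set" where
  "Y_space i = op_space.span (Y_words i)"

end

theory Submission
  imports Defs
begin

text \<open>Every iterated product is a scalar multiple of one normally ordered vertex operator. As far as
  contractions are concerned, its creation part is a monomial of the q-character of the fundamental
  representation with highest weight \<open>\<lambda>\<^sub>i\<close>; these monomials are indexed by subsets \<open>S\<close> of \<open>{1, \<dots>, n + 1}\<close>. Since this
  representation is minuscule, the contraction of \<open>x\<^sub>j\<^sup>\<plusminus>(w)\<close> or \<open>\<psi>\<^sub>j(w)\<close> with such an operator at \<open>z\<close> has at
  most one pole, a simple one at some \<open>w = q\<^sup>t z\<close>, and the bullet product is the normally ordered product with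
  \<open>w = q\<^sup>t z\<close> substituted, up to a scalar. The operator \<open>x\<^sub>j\<^sup>-\<close> moves \<open>j \<in> S\<close> to \<open>j + 1\<close> and \<open>x\<^sub>j\<^sup>+\<close> moves it back. In a
  product of both the creation parts cancel and the annihilation parts combine to that of \<open>\<psi>\<^sub>j\<close>. The operator \<open>\<phi>\<^sub>j\<close>
  has no annihilation part, so that its products vanish.\<close>

section \<open>Scalar coefficients of series with values in V\<close>

text \<open>The bullet product is not bilinear by construction: \<open>rprod\<close> selects its
  polynomial by Hilbert choice, and \<open>bullet\<close> sums over all weights and dilations.
  Additivity therefore has to be earned by exhibiting witnesses and finite supports, which is
  possible for single operators with an explicit pole; sums of states are treated only afterwards.
  Generators always stand on the left, so a contraction pairs the annihilation part of a generator
  with the creation part of the right factor. Of the latter, a state fixes exactly these pairings.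
  If they are (u^r - u'^r) / r, the contraction of operators at w and z is (1 - u' z/w) / (1 - u
  z/w), and taking the residue at w = u z leaves the factor 1 - u'/u. At a pole of x^+ or x^- one
  has u' = 0 and this factor is 1. For psi it is 1 - q^(-2) or 1 - q^2; together with the power of q
  coming from K_j it becomes plus or minus (q - 1/q) times q^b, where b is the pairing with alpha_j
  of the weight acted upon. This is the origin of the constant in the theorem, and the two signs
  correspond to the two orders of the factors in the commutator.\<close>

text \<open>Identities between series with values in V are verified on scalar coefficients: there the action of
  \<open>F((z))((z\<^sub>0))\<close> becomes multiplication in the field \<open>F((u))((z\<^sub>0))\<close>.\<close>

definition coef :: "'n weight \<Rightarrow> (('n \<times> nat) \<Rightarrow>\<^sub>0 nat) \<Rightarrow> 'n::finite vspace \<Rightarrow> qfield" where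
  "coef \<beta> m v = Poly_Mapping.lookup (Poly_Mapping.lookup v \<beta>) m"

lemma coef_zero [simp]: "coef \<beta> m 0 = 0"
  by (simp add: coef_def)

lemma coef_add: "coef \<beta> m (v + w) = coef \<beta> m v + coef \<beta> m w"
  by (simp add: coef_def lookup_add)

lemma coef_sum: "coef \<beta> m (sum f A) = (\<Sum>x\<in>A. coef \<beta> m (f x))"
  by (induction A rule: infinite_finite_induct) (auto simp: coef_add)

lemma lookup_fock_scale: "Poly_Mapping.lookup (fock_scale c p) m = c * Poly_Mapping.lookup p m"
proof -
  have "fock_scale c p = Poly_Mapping.map ((*) c) p"
    unfolding fock_scale_def by (rule mult_map_scale_conv_mult[symmetric])
  then show ?thesis by (simp add: Poly_Mapping.map.rep_eq when_def)
qed

lemma coef_scale: "coef \<beta> m (v_scale c v) = c * coef \<beta> m v"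
  by (simp add: coef_def v_scale_lookup lookup_fock_scale)

lemma vspace_eqI: "(\<And>\<beta> m. coef \<beta> m v = coef \<beta> m w) \<Longrightarrow> v = w"
  unfolding coef_def by (intro poly_mapping_eqI)

lemma coef_Sum_any:
  assumes "finite {x. f x \<noteq> 0}"
  shows "coef \<beta> m (Sum_any f) = (Sum_any (\<lambda>x. coef \<beta> m (f x)))"
  using assms by (subst (1 2) Sum_any.expand_superset[OF assms]) (auto simp: coef_sum)

lemma v_scale_simps:
  "v_scale c (v + w) = v_scale c v + v_scale c w"
  "v_scale (c + d) v = v_scale c v + v_scale d v"
  "v_scale c (v_scale d v) = v_scale (c * d) v"
  "v_scale 1 v = v"
  "v_scale 0 v = 0"
  by (intro vspace_eqI, simp add: coef_scale coef_add algebra_simps)+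

lemma v_scale_sum: "v_scale c (sum f A) = (\<Sum>x\<in>A. v_scale c (f x))"
  by (intro vspace_eqI) (simp add: coef_scale coef_sum sum_distrib_left)

definition fls_map :: "('a::zero \<Rightarrow> 'b::zero) \<Rightarrow> 'a fls \<Rightarrow> 'b fls" where
  "fls_map h f = Abs_fls (\<lambda>k. h (f $$ k))"

lemma fls_map_nth: "h 0 = 0 \<Longrightarrow> fls_map h f $$ k = h (f $$ k)"
  unfolding fls_map_def using fls_nth_vanishes_belowE[of f]
  by (metis (mono_tags, lifting) nth_Abs_fls_lower_bound)

text \<open>The actions \<open>series_act\<close> and \<open>series_act2\<close> are convolutions
  over all integers, so the product of Laurent series is brought to the same form.\<close>

lemma fls_mult_nth_Sum_any:
  fixes f g :: "'a::semiring_0 fls"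
  shows "(f * g) $$ n = (Sum_any (\<lambda>i. f $$ i * g $$ (n - i)))"
proof -
  have "f $$ i * g $$ (n - i) = 0" if "i < fls_subdegree f \<or> i > n - fls_subdegree g" for i
  proof -
    have "f $$ i = 0 \<or> g $$ (n - i) = 0" using that
      by (metis diff_less_eq add.commute less_diff_eq fls_eq0_below_subdegree)
    then show ?thesis by auto
  qed
  then have "{i. f $$ i * g $$ (n - i) \<noteq> 0} \<subseteq> {fls_subdegree f..n - fls_subdegree g}"
    by (auto simp: not_less) (meson not_less)+
  then show ?thesis
    by (simp add: fls_times_nth(2) Sum_any.expand_superset[of "{fls_subdegree f..n - fls_subdegree g}"])
qed

definition coef_series :: "'n weight \<Rightarrow> (('n \<times> nat) \<Rightarrow>\<^sub>0 nat) \<Rightarrow> 'n::finite vspace fls fls \<Rightarrow> qfield fls fls" where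
  "coef_series \<beta> m = fls_map (fls_map (coef \<beta> m))"

lemma coef_series_nth: "coef_series \<beta> m X $$ k $$ l = coef \<beta> m (X $$ k $$ l)"
proof -
  have "fls_map (coef \<beta> m) 0 = 0" by (intro fls_eqI) (simp add: fls_map_nth)
  then show ?thesis by (simp add: coef_series_def fls_map_nth)
qed

text \<open>The embedding \<open>F((z))((z\<^sub>0)) \<rightarrow> F((u))((z\<^sub>0))\<close> with \<open>z = u\<^sup>d\<close>.\<close>

definition emb :: "nat \<Rightarrow> qfield fls fls \<Rightarrow> qfield fls fls" where
  "emb d = fls_map (\<lambda>f. fls_compose_power f d)"

lemma emb_nth: "emb d f $$ k = fls_compose_power (f $$ k) d"
  by (simp add: emb_def fls_map_nth)

lemma fls_compose_power_Sum_any: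
  assumes "finite {x. f x \<noteq> 0}"
  shows "fls_compose_power (Sum_any f) d = Sum_any (\<lambda>x. fls_compose_power (f x :: qfield fls) d)"
proof -
  have "fls_compose_power (sum f A) d = (\<Sum>x\<in>A. fls_compose_power (f x) d)" for A
    by (induction A rule: infinite_finite_induct) auto
  then show ?thesis
    by (subst (1 2) Sum_any.expand_superset[OF assms]) auto
qed

lemma finite_fls_product_support:
  fixes f g :: "'a::semiring_0 fls"
  shows "finite {i. f $$ i * g $$ (n - i) \<noteq> 0}"
proof (rule finite_subset)
  show "{i. f $$ i * g $$ (n - i) \<noteq> 0} \<subseteq> {fls_subdegree f..n - fls_subdegree g}"
  proof
    fix i assume "i \<in> {i. f $$ i * g $$ (n - i) \<noteq> 0}"
    then have "f $$ i \<noteq> 0" "g $$ (n - i) \<noteq> 0" by auto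
    then have "i \<ge> fls_subdegree f" "n - i \<ge> fls_subdegree g"
      by (meson fls_subdegree_leI)+
    then show "i \<in> {fls_subdegree f..n - fls_subdegree g}" by simp
  qed
qed simp

lemma emb_mult: "emb d (f * g) = emb d f * emb d g"
proof (rule fls_eqI)
  fix n
  have "emb d (f * g) $$ n = Sum_any (\<lambda>i. fls_compose_power (f $$ i * g $$ (n - i)) d)"
    by (simp only: emb_nth fls_mult_nth_Sum_any fls_compose_power_Sum_any[OF finite_fls_product_support])
  then show "emb d (f * g) $$ n = (emb d f * emb d g) $$ n"
    by (simp add: fls_mult_nth_Sum_any emb_nth)
qed

lemma emb_add: "emb d (f + g) = emb d f + emb d g"
  by (intro fls_eqI) (simp add: emb_nth)

lemma emb_zero: "emb d 0 = 0"
  by (intro fls_eqI) (simp add: emb_nth)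

lemma emb_const: "emb d (fls_const a) = fls_const (fls_compose_power a d)"
  by (intro fls_eqI) (simp add: emb_nth)

lemma emb_one: "d > 0 \<Longrightarrow> emb d 1 = 1"
  by (simp add: emb_const fls_const_1[symmetric] del: fls_const_1)

lemma emb_X: "d > 0 \<Longrightarrow> emb d fls_X = fls_X"
  by (intro fls_eqI) (simp add: emb_nth)

text \<open>A ring homomorphism between fields respects inverses, so the expansion of 1 / p(z_0 + z,
  z) may be computed after the embedding.\<close>

lemma emb_inverse:
  assumes "d > 0" "f \<noteq> 0"
  shows "emb d (inverse f) = inverse (emb d f)"
proof -
  have "emb d f * emb d (inverse f) = 1"
    using assms by (simp add: emb_mult[symmetric] emb_one)
  then show ?thesis by (metis inverse_unique)
qed

lemma emb_nonzero: "d > 0 \<Longrightarrow> f \<noteq> 0 \<Longrightarrow> emb d f \<noteq> 0"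
  by (metis emb_inverse emb_mult emb_one field_class.field_inverse mult_zero_right zero_neq_one)

section \<open>Scalar actions and the substitution z_1 = z + z_0 on coefficients\<close>

context
  fixes N :: nat
  assumes N_def: "N = CARD('n::finite) + 1"
begin

lemma N_pos: "N > 0" and N_int: "int CARD('n) + 1 = int N"
  by (simp_all add: N_def)

lemma series_act_finite:
  fixes g :: "'n vspace fls"
  shows "finite {k. v_scale (f $$ k) (g $$ (l - int N * k)) \<noteq> 0}"
proof (rule finite_subset)
  show "{k. v_scale (f $$ k) (g $$ (l - int N * k)) \<noteq> 0} \<subseteq> {fls_subdegree f..\<bar>l - fls_subdegree g\<bar>}"
  proof
    fix k assume "k \<in> {k. v_scale (f $$ k) (g $$ (l - int N * k)) \<noteq> 0}"
    then have "f $$ k \<noteq> 0" "g $$ (l - int N * k) \<noteq> 0"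
      by (auto simp: v_scale_simps v_scale_zero)
    then have 1: "k \<ge> fls_subdegree f" "l - int N * k \<ge> fls_subdegree g"
      by (meson fls_subdegree_leI)+
    have "k \<le> \<bar>int N * k\<bar>" if "k \<ge> 0" using that N_pos by (simp add: mult_le_cancel_right1)
    then have "k \<le> \<bar>l - fls_subdegree g\<bar>" using 1(2) N_pos
      by (cases "k \<ge> 0") auto
    with 1 show "k \<in> {fls_subdegree f..\<bar>l - fls_subdegree g\<bar>}" by simp
  qed
qed simp

lemma series_act_nth:
  fixes g :: "'n vspace fls"
  shows "series_act f g $$ l = Sum_any (\<lambda>k. v_scale (f $$ k) (g $$ (l - int N * k)))"
  unfolding series_act_def N_int
proof (rule nth_Abs_fls_lower_bound, intro allI impI)
  fix l assume l: "l < int N * fls_subdegree f + fls_subdegree g"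
  have "v_scale (f $$ k) (g $$ (l - int N * k)) = 0" for k
  proof (cases "k < fls_subdegree f")
    case False
    then have "int N * fls_subdegree f \<le> int N * k" using N_pos by simp
    then show ?thesis using l by (simp add: v_scale_zero)
  qed (simp add: v_scale_simps)
  then show "Sum_any (\<lambda>k. v_scale (f $$ k) (g $$ (l - int N * k))) = 0" by simp
qed

text \<open>After z = u^N a scalar series is supported on the multiples of N, and the convolution in
  u collapses to one over powers of z.\<close>

lemma Sum_any_multiples:
  fixes h :: "int \<Rightarrow> 'a::comm_monoid_add"
  assumes "finite {k. h (int N * k) \<noteq> 0}" "\<And>i. \<not> int N dvd i \<Longrightarrow> h i = 0"
  shows "Sum_any h = Sum_any (\<lambda>k. h (int N * k))"
proof -
  let ?K = "{k. h (int N * k) \<noteq> 0}"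
  have "Sum_any h = sum h ((*) (int N) ` ?K)"
  proof (rule Sum_any.expand_superset)
    show "{a. h a \<noteq> 0} \<subseteq> (*) (int N) ` ?K"
    proof
      fix i assume "i \<in> {a. h a \<noteq> 0}"
      then obtain k where "i = int N * k" "h i \<noteq> 0" using assms(2) by blast
      then show "i \<in> (*) (int N) ` ?K" by auto
    qed
  qed (use assms in auto)
  also have "\<dots> = sum (\<lambda>k. h (int N * k)) ?K"
    using N_pos by (subst sum.reindex) (auto simp: inj_on_def)
  also have "\<dots> = Sum_any (\<lambda>k. h (int N * k))"
    by (rule Sum_any.expand_superset[symmetric]) (use assms in auto)
  finally show ?thesis .
qed

lemma coef_series_act:
  fixes g :: "'n vspace fls"
  shows "fls_map (coef \<beta> m) (series_act f g) = fls_compose_power f N * fls_map (coef \<beta> m) g"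
proof (rule fls_eqI)
  fix l
  have fin: "finite {i. fls_compose_power f N $$ i * fls_map (coef \<beta> m) g $$ (l - i) \<noteq> 0}"
    by (rule finite_fls_product_support)
  have "(fls_compose_power f N * fls_map (coef \<beta> m) g) $$ l =
    Sum_any (\<lambda>k. fls_compose_power f N $$ (int N * k) * fls_map (coef \<beta> m) g $$ (l - int N * k))"
    unfolding fls_mult_nth_Sum_any
  proof (rule Sum_any_multiples)
    show "finite {k. fls_compose_power f N $$ (int N * k) * fls_map (coef \<beta> m) g $$ (l - int N * k) \<noteq> 0}"
      using finite_vimageI[OF fin, of "(*) (int N)"] N_pos by (simp add: vimage_def inj_def)
  qed (use N_pos in \<open>simp add: fls_nth_compose_power\<close>)
  also have "\<dots> = Sum_any (\<lambda>k. f $$ k * coef \<beta> m (g $$ (l - int N * k)))"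
    using N_pos by (simp add: fls_nth_compose_power fls_map_nth)
  also have "\<dots> = fls_map (coef \<beta> m) (series_act f g) $$ l"
    by (simp add: fls_map_nth series_act_nth coef_Sum_any[OF series_act_finite] coef_scale)
  finally show "fls_map (coef \<beta> m) (series_act f g) $$ l = (fls_compose_power f N * fls_map (coef \<beta> m) g) $$ l" ..
qed

lemma series_act_zero: "series_act 0 g = (0 :: 'n vspace fls)" "series_act f 0 = (0 :: 'n vspace fls)"
  by (intro fls_eqI, simp add: series_act_nth v_scale_simps v_scale_zero)+

lemma series_act2_finite:
  fixes X :: "'n vspace fls fls"
  shows "finite {k. series_act (f $$ k) (X $$ (n - k)) \<noteq> 0}"
proof (rule finite_subset)
  show "{k. series_act (f $$ k) (X $$ (n - k)) \<noteq> 0} \<subseteq> {fls_subdegree f..n - fls_subdegree X}"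
  proof
    fix k assume "k \<in> {k. series_act (f $$ k) (X $$ (n - k)) \<noteq> 0}"
    then have "f $$ k \<noteq> 0" "X $$ (n - k) \<noteq> 0" by (auto simp: series_act_zero)
    then have "k \<ge> fls_subdegree f" "n - k \<ge> fls_subdegree X"
      by (meson fls_subdegree_leI)+
    then show "k \<in> {fls_subdegree f..n - fls_subdegree X}" by simp
  qed
qed simp

lemma series_act2_nth:
  fixes X :: "'n vspace fls fls"
  shows "series_act2 f X $$ n = Sum_any (\<lambda>k. series_act (f $$ k) (X $$ (n - k)))"
  unfolding series_act2_def
proof (rule nth_Abs_fls_lower_bound, intro allI impI)
  fix n assume n: "n < fls_subdegree f + fls_subdegree X"
  have "series_act (f $$ k) (X $$ (n - k)) = 0" for k
    using n by (cases "k < fls_subdegree f") (simp_all add: series_act_zero)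
  then show "Sum_any (\<lambda>k. series_act (f $$ k) (X $$ (n - k))) = 0" by simp
qed

lemma coef_series_act2:
  fixes X :: "'n vspace fls fls"
  shows "coef_series \<beta> m (series_act2 f X) = emb N f * coef_series \<beta> m X"
proof (rule fls_eqI)
  fix n
  have z: "fls_map (coef \<beta> m) 0 = 0" by (intro fls_eqI) (simp add: fls_map_nth)
  have *: "fls_map (coef \<beta> m) (Sum_any h) = Sum_any (\<lambda>k. fls_map (coef \<beta> m) (h k))"
    if "finite {k. h k \<noteq> 0}" for h :: "int \<Rightarrow> 'n vspace fls"
  proof -
    have "fls_map (coef \<beta> m) (f + g) = fls_map (coef \<beta> m) f + fls_map (coef \<beta> m) g" for f g :: "'n vspace fls"
      by (intro fls_eqI) (simp add: fls_map_nth coef_add)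
    then have "fls_map (coef \<beta> m) (sum h A) = (\<Sum>x\<in>A. fls_map (coef \<beta> m) (h x))" for A
      by (induction A rule: infinite_finite_induct) (auto simp: z)
    then show ?thesis using that
      by (subst (1 2) Sum_any.expand_superset[OF that]) (auto simp: z)
  qed
  show "coef_series \<beta> m (series_act2 f X) $$ n = (emb N f * coef_series \<beta> m X) $$ n"
    by (simp add: coef_series_def fls_map_nth z series_act2_nth *[OF series_act2_finite] coef_series_act
        fls_mult_nth_Sum_any emb_nth)
qed

text \<open>Along the indices contributing to a fixed power of z, the second index drops by N
  whenever k grows by 1; the lower bounds in both variables thus leave finitely many k.\<close>

lemma in_laurent2_subst_support:
  assumes "\<forall>k l. k < L \<or> l < L \<longrightarrow> c k l = (0 :: 'n vspace)"
  shows "{k. c k (l - int N * (k - m)) \<noteq> 0} \<subseteq> {L..m + \<bar>l - L\<bar>}"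
proof
  fix k assume "k \<in> {k. c k (l - int N * (k - m)) \<noteq> 0}"
  then have 1: "k \<ge> L" "l - int N * (k - m) \<ge> L" using assms by (meson mem_Collect_eq not_less)+
  have "k - m \<le> \<bar>l - L\<bar>"
  proof (cases "k - m \<ge> 0")
    case True
    then have "k - m \<le> int N * (k - m)" using N_pos by (simp add: mult_le_cancel_right1)
    then show ?thesis using 1 by linarith
  qed simp
  with 1 show "k \<in> {L..m + \<bar>l - L\<bar>}" by simp
qed

lemma in_laurent2_subst_finite:
  assumes "in_laurent2 (c :: int \<Rightarrow> int \<Rightarrow> 'n vspace)"
  shows "finite {k. c k (l - int N * (k - m)) \<noteq> 0}"
  using assms in_laurent2_subst_support[of _ c] finite_subset unfolding in_laurent2_def
  by (metis (no_types, lifting) finite_atLeastAtMost_int)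

lemma subst_shift_nth:
  assumes "in_laurent2 (c :: int \<Rightarrow> int \<Rightarrow> 'n vspace)"
  shows "subst_shift c $$ m $$ l = (if m < 0 then 0 else
    Sum_any (\<lambda>k. v_scale (of_int k gchoose nat m) (c k (l - int N * (k - m)))))"
proof -
  obtain L where L: "\<forall>k l. k < L \<or> l < L \<longrightarrow> c k l = (0 :: 'n vspace)"
    using assms in_laurent2_def by blast
  define h where "h m = (\<lambda>l. Sum_any (\<lambda>k. v_scale (of_int k gchoose nat m) (c k (l - int N * (k - m)))))" for m
  have "subst_shift c $$ m = (if m < 0 then 0 else Abs_fls (h m))"
    unfolding subst_shift_def N_int h_def[symmetric] by (subst nth_Abs_fls_lower_bound[of 0]) auto
  moreover have "Abs_fls (h m) $$ l = h m l"
  proof (rule nth_Abs_fls_lower_bound, intro allI impI)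
    fix l assume l: "l < L + int N * (L - m)"
    have "c k (l - int N * (k - m)) = 0" for k
    proof (cases "k < L")
      case False
      then have "int N * (L - m) \<le> int N * (k - m)" using N_pos by simp
      then show ?thesis using l L by auto
    qed (use L in auto)
    then show "h m l = 0" by (simp add: h_def v_scale_zero)
  qed
  ultimately show ?thesis by (simp add: h_def)
qed

lemma coef_subst_shift_nth:
  assumes "in_laurent2 (c :: int \<Rightarrow> int \<Rightarrow> 'n vspace)"
  shows "coef_series \<beta> j (subst_shift c) $$ m $$ l = (if m < 0 then 0 else
    Sum_any (\<lambda>k. (of_int k gchoose nat m) * coef \<beta> j (c k (l - int N * (k - m)))))"
proof -
  have "finite {k. v_scale (of_int k gchoose nat m) (c k (l - int N * (k - m))) \<noteq> 0}"
    by (rule finite_subset[OF _ in_laurent2_subst_finite[OF assms, of l m]]) (auto simp: v_scale_zero)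
  then show ?thesis by (simp add: coef_series_nth subst_shift_nth[OF assms] coef_Sum_any coef_scale)
qed

lemma coef_subst_finite:
  assumes "in_laurent2 (c :: int \<Rightarrow> int \<Rightarrow> 'n vspace)"
  shows "finite {k. x k * coef \<beta> j (c k (l - int N * (k - m))) \<noteq> 0}"
  by (rule finite_subset[OF _ in_laurent2_subst_finite[OF assms, of l m]]) auto

lemma in_laurent2_zero: "in_laurent2 (\<lambda>k l. 0 :: 'n vspace)"
  by (simp add: in_laurent2_def)

lemma in_laurent2_add:
  assumes "in_laurent2 (c :: int \<Rightarrow> int \<Rightarrow> 'n vspace)" "in_laurent2 c'"
  shows "in_laurent2 (\<lambda>k l. c k l + c' k l)"
proof -
  obtain L L' where "\<forall>k l. k < L \<or> l < L \<longrightarrow> c k l = 0" "\<forall>k l. k < L' \<or> l < L' \<longrightarrow> c' k l = 0"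
    using assms unfolding in_laurent2_def by blast
  then show ?thesis unfolding in_laurent2_def by (intro exI[of _ "min L L'"]) auto
qed

lemma in_laurent2_scale:
  "in_laurent2 (c :: int \<Rightarrow> int \<Rightarrow> 'n vspace) \<Longrightarrow> in_laurent2 (\<lambda>k l. v_scale (x k l) (c k l))"
  unfolding in_laurent2_def by (metis v_scale_zero)

lemma in_laurent2_shift:
  assumes "in_laurent2 (c :: int \<Rightarrow> int \<Rightarrow> 'n vspace)"
  shows "in_laurent2 (\<lambda>k l. c (k - a) (l - b))"
proof -
  obtain L where "\<forall>k l. k < L \<or> l < L \<longrightarrow> c k l = 0"
    using assms unfolding in_laurent2_def by blast
  then show ?thesis unfolding in_laurent2_def by (intro exI[of _ "min (L + a) (L + b)"]) auto
qed

lemma coef_subst_add: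
  assumes "in_laurent2 (c :: int \<Rightarrow> int \<Rightarrow> 'n vspace)" "in_laurent2 c'"
  shows "coef_series \<beta> j (subst_shift (\<lambda>k l. c k l + c' k l)) =
    coef_series \<beta> j (subst_shift c) + coef_series \<beta> j (subst_shift c')"
proof (intro fls_eqI)
  fix m l
  show "coef_series \<beta> j (subst_shift (\<lambda>k l. c k l + c' k l)) $$ m $$ l =
    (coef_series \<beta> j (subst_shift c) + coef_series \<beta> j (subst_shift c')) $$ m $$ l"
    using Sum_any.distrib[OF coef_subst_finite[OF assms(1)] coef_subst_finite[OF assms(2)]]
    by (simp add: coef_subst_shift_nth assms in_laurent2_add coef_add distrib_left)
qed

lemma coef_subst_scale:
  assumes "in_laurent2 (c :: int \<Rightarrow> int \<Rightarrow> 'n vspace)"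
  shows "coef_series \<beta> j (subst_shift (\<lambda>k l. v_scale x (c k l))) =
    fls_const (fls_const x) * coef_series \<beta> j (subst_shift c)"
proof (intro fls_eqI)
  fix m l
  show "coef_series \<beta> j (subst_shift (\<lambda>k l. v_scale x (c k l))) $$ m $$ l =
    (fls_const (fls_const x) * coef_series \<beta> j (subst_shift c)) $$ m $$ l"
    using Sum_any_right_distrib[OF coef_subst_finite[OF assms], of x]
    by (simp add: coef_subst_shift_nth assms in_laurent2_scale coef_scale mult.left_commute)
qed

lemma X_intpow_times_nth: "(fls_X_intpow a * f) $$ l = (f :: 'a::comm_ring_1 fls) $$ (l - a)"
  by (simp add: fls_X_intpow_times_conv_shift)

lemma coef_subst_shift_z2:
  assumes "in_laurent2 (c :: int \<Rightarrow> int \<Rightarrow> 'n vspace)"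
  shows "coef_series \<beta> j (subst_shift (\<lambda>k l. c k (l - int N))) =
    fls_const (fls_X_intpow (int N)) * coef_series \<beta> j (subst_shift c)"
  using in_laurent2_shift[OF assms, of 0 "int N"]
  by (intro fls_eqI) (simp add: coef_subst_shift_nth assms X_intpow_times_nth algebra_simps)

text \<open>Multiplication by z_1 becomes multiplication by z_0 + u^N. On coefficients this is
  Pascal's rule for the binomials in (z + z_0)^k, valid for negative k as well.\<close>

lemma coef_subst_shift_z1:
  assumes "in_laurent2 (c :: int \<Rightarrow> int \<Rightarrow> 'n vspace)"
  shows "coef_series \<beta> j (subst_shift (\<lambda>k l. c (k - 1) l)) =
    (fls_X + fls_const (fls_X_intpow (int N))) * coef_series \<beta> j (subst_shift c)"
proof (intro fls_eqI)
  fix m l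
  have L: "in_laurent2 (\<lambda>k l. c (k - 1) l)" using in_laurent2_shift[OF assms, of 1 0] by simp
  let ?S = "coef_series \<beta> j (subst_shift c)"
  have R: "((fls_X + fls_const (fls_X_intpow (int N))) * ?S) $$ m $$ l = ?S $$ (m - 1) $$ l + ?S $$ m $$ (l - int N)"
    by (simp add: distrib_right fls_X_times_conv_shift X_intpow_times_nth)
  have "coef_series \<beta> j (subst_shift (\<lambda>k l. c (k - 1) l)) $$ m $$ l = ?S $$ (m - 1) $$ l + ?S $$ m $$ (l - int N)"
  proof (cases "m < 0")
    case False
    have bij: "bij (\<lambda>k::int. k + 1)" by (rule o_bij[of "\<lambda>k. k - 1"]) auto
    have 1: "coef_series \<beta> j (subst_shift (\<lambda>k l. c (k - 1) l)) $$ m $$ l =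
      Sum_any (\<lambda>k. (of_int (k + 1) gchoose nat m) * coef \<beta> j (c k (l - int N * (k + 1 - m))))"
      using Sum_any.reindex_cong[OF bij refl, of "\<lambda>k. (of_int k gchoose nat m) * coef \<beta> j (c (k - 1) (l - int N * (k - m)))"] False
      unfolding coef_subst_shift_nth[OF L] comp_def by (simp only: if_False add_diff_cancel_right')
    show ?thesis
    \<comment> \<open>At m = 0 both binomials are 1, and the term shifted in z_0 sits at index -1,
      where the substituted series vanishes; Pascal's rule starts at m = 1.\<close>
    proof (cases "m = 0")
      case True
      show ?thesis unfolding 1 using True by (simp add: coef_subst_shift_nth assms) (simp add: algebra_simps)
    next
      case m: False
      obtain p where p: "nat m = Suc p" "m = int p + 1" using False m
        by (metis Suc_pred' linorder_neqE_linordered_idom nat_0_le of_nat_Suc of_nat_0_less_iff zero_less_nat_eq add.commute not_less)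
      have "(of_int (k + 1) gchoose nat m) * coef \<beta> j (c k (l - int N * (k + 1 - m))) =
         (of_int k gchoose nat (m - 1)) * coef \<beta> j (c k (l - int N * (k - (m - 1)))) +
         (of_int k gchoose nat m) * coef \<beta> j (c k (l - int N - int N * (k - m)))" for k
      proof -
        have "((of_int (k + 1) :: qfield) gchoose nat m) = (of_int k gchoose nat (m - 1)) + (of_int k gchoose nat m)"
          using p by (simp add: gbinomial_Suc_Suc nat_add_distrib)
        moreover have "l - int N * (k + 1 - m) = l - int N * (k - (m - 1))" "l - int N * (k + 1 - m) = l - int N - int N * (k - m)"
          by (simp_all add: algebra_simps)
        ultimately show ?thesis by (metis distrib_right)
      qed
      then show ?thesis unfolding 1
        using Sum_any.distrib[OF coef_subst_finite[OF assms] coef_subst_finite[OF assms]] False m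
        by (simp add: coef_subst_shift_nth assms)
    qed
  qed (simp add: coef_subst_shift_nth assms L)
  then show "coef_series \<beta> j (subst_shift (\<lambda>k l. c (k - 1) l)) $$ m $$ l =
    ((fls_X + fls_const (fls_X_intpow (int N))) * ?S) $$ m $$ l" using R by simp
qed


section \<open>Polynomials in two variables acting on families of coefficients\<close>

definition poly1_mult :: "qfield poly \<Rightarrow> (int \<Rightarrow> int \<Rightarrow> 'n vspace) \<Rightarrow> int \<Rightarrow> int \<Rightarrow> 'n vspace" where
  "poly1_mult a c k l = (\<Sum>s\<le>degree a. v_scale (coeff a s) (c k (l - int N * int s)))"

lemma poly1_mult_bound:
  assumes "degree a \<le> S"
  shows "poly1_mult a c k l = (\<Sum>s\<le>S. v_scale (coeff a s) (c k (l - int N * int s)))"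
  unfolding poly1_mult_def
  by (rule sum.mono_neutral_left) (use assms in \<open>auto simp: coeff_eq_0 v_scale_simps\<close>)

lemma poly1_mult_zero: "poly1_mult 0 c k l = 0"
  by (simp add: poly1_mult_def v_scale_simps)

lemma poly1_mult_add: "poly1_mult (a + b) c k l = poly1_mult a c k l + poly1_mult b c k l"
  using degree_add_le_max[of a b]
  by (simp add: poly1_mult_bound[where S = "max (degree a) (degree b)"] v_scale_simps sum.distrib)

lemma poly1_mult_smult: "poly1_mult (smult x a) c k l = v_scale x (poly1_mult a c k l)"
  by (simp add: poly1_mult_bound[where S = "degree a"] v_scale_simps v_scale_sum)

lemma poly1_mult_pCons:
  "poly1_mult (pCons x a) c k l = v_scale x (c k l) + poly1_mult a c k (l - int N)"
proof -
  have "poly1_mult (pCons x a) c k l =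
    (\<Sum>s\<le>Suc (degree a). v_scale (coeff (pCons x a) s) (c k (l - int N * int s)))"
    by (rule poly1_mult_bound) (simp add: degree_pCons_le)
  then show ?thesis
    unfolding sum.atMost_Suc_shift poly1_mult_def by (simp add: algebra_simps)
qed

lemma poly1_mult_sum:
  "poly1_mult a (\<lambda>k l. \<Sum>r\<in>R. c r k l) k l = (\<Sum>r\<in>R. poly1_mult a (c r) k l)"
  unfolding poly1_mult_def v_scale_sum by (rule sum.swap)

lemma poly1_mult_mult: "poly1_mult (a * b) c k l = poly1_mult a (poly1_mult b c) k l"
proof (induction a arbitrary: l rule: pCons_induct)
  case (pCons x a)
  then show ?case
    by (simp add: poly1_mult_add poly1_mult_smult poly1_mult_pCons v_scale_simps)
qed (simp add: poly1_mult_zero)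

lemma poly2_mult_bound:
  assumes "degree p \<le> R"
  shows "poly2_mult p c k l = (\<Sum>r\<le>R. poly1_mult (coeff p r) c (k - int r) l)"
  unfolding poly2_mult_def N_int poly1_mult_def[symmetric]
  by (rule sum.mono_neutral_left) (use assms in \<open>auto simp: coeff_eq_0 poly1_mult_zero\<close>)

lemma poly2_mult_zero: "poly2_mult 0 c k l = (0 :: 'n vspace)"
  by (simp add: poly2_mult_bound[where R = 0] poly1_mult_zero)

lemma poly2_mult_add: "poly2_mult (p + q) c k l = (poly2_mult p c k l + poly2_mult q c k l :: 'n vspace)"
  using degree_add_le_max[of p q]
  by (simp add: poly2_mult_bound[where R = "max (degree p) (degree q)"] poly1_mult_add sum.distrib)

lemma poly2_mult_smult: "poly2_mult (smult a p) c k l = (poly1_mult a (poly2_mult p c) k l :: 'n vspace)"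
proof -
  have "poly2_mult (smult a p) c k l =
    (\<Sum>r\<le>degree p. poly1_mult a (poly1_mult (coeff p r) c) (k - int r) l)"
    by (simp add: poly2_mult_bound[where R = "degree p"] degree_smult_le poly1_mult_mult)
  also have "\<dots> = poly1_mult a (\<lambda>k l. \<Sum>r\<le>degree p. poly1_mult (coeff p r) c (k - int r) l) k l"
    unfolding poly1_mult_sum by (simp add: poly1_mult_def)
  finally show ?thesis by (simp add: poly2_mult_bound[OF order_refl, of p, symmetric])
qed

lemma poly2_mult_pCons:
  "poly2_mult (pCons a p) c k l = (poly1_mult a c k l + poly2_mult p c (k - 1) l :: 'n vspace)"
proof -
  have "poly2_mult (pCons a p) c k l =
    (\<Sum>r\<le>Suc (degree p). poly1_mult (coeff (pCons a p) r) c (k - int r) l)"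
    by (rule poly2_mult_bound) (simp add: degree_pCons_le)
  then show ?thesis
    unfolding sum.atMost_Suc_shift poly2_mult_bound[OF order_refl, of p] by (simp add: algebra_simps)
qed

lemma poly2_mult_mult: "poly2_mult (p * q) c k l = (poly2_mult p (poly2_mult q c) k l :: 'n vspace)"
proof (induction p arbitrary: k rule: pCons_induct)
  case (pCons a p)
  then show ?case
    by (simp add: poly2_mult_add poly2_mult_smult poly2_mult_pCons poly1_mult_zero)
qed (simp add: poly2_mult_zero)

lemma poly2_mult_commute: "poly2_mult p (poly2_mult q c) = poly2_mult q (poly2_mult p (c :: int \<Rightarrow> int \<Rightarrow> 'n vspace))"
  by (intro ext) (metis poly2_mult_mult mult.commute)

lemma in_laurent2_poly1_mult:
  assumes "in_laurent2 (c :: int \<Rightarrow> int \<Rightarrow> 'n vspace)"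
  shows "in_laurent2 (poly1_mult a c)"
proof (induction a rule: pCons_induct)
  case 0
  have "poly1_mult 0 c = (\<lambda>k l. 0)" by (intro ext) (rule poly1_mult_zero)
  then show ?case by (simp add: in_laurent2_zero)
next
  case (pCons x a)
  have "poly1_mult (pCons x a) c = (\<lambda>k l. v_scale x (c k l) + poly1_mult a c (k - 0) (l - int N))"
    by (intro ext) (simp add: poly1_mult_pCons)
  then show ?case using in_laurent2_add[OF in_laurent2_scale[OF assms, of "\<lambda>_ _. x"] in_laurent2_shift[OF pCons(2), of 0 "int N"]]
    by simp
qed

lemma in_laurent2_poly2_mult:
  assumes "in_laurent2 (c :: int \<Rightarrow> int \<Rightarrow> 'n vspace)"
  shows "in_laurent2 (poly2_mult p c)"
proof (induction p rule: pCons_induct)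
  case 0
  have "poly2_mult 0 c = (\<lambda>k l. 0)" by (intro ext) (rule poly2_mult_zero)
  then show ?case by (simp add: in_laurent2_zero)
next
  case (pCons a p)
  have "poly2_mult (pCons a p) c = (\<lambda>k l. poly1_mult a c k l + poly2_mult p c (k - 1) (l - 0))"
    by (intro ext) (simp add: poly2_mult_pCons)
  then show ?case using in_laurent2_add[OF in_laurent2_poly1_mult[OF assms] in_laurent2_shift[OF pCons(2), of 1 0]]
    by simp
qed

lemma coef_subst_poly1_mult:
  assumes "in_laurent2 (c :: int \<Rightarrow> int \<Rightarrow> 'n vspace)"
  shows "coef_series \<beta> j (subst_shift (poly1_mult a c)) =
    emb N (fls_const (fps_to_fls (fps_of_poly a))) * coef_series \<beta> j (subst_shift c)"
proof (induction a rule: pCons_induct)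
  case 0
  have "poly1_mult 0 c = (\<lambda>k l. 0)" by (intro ext) (rule poly1_mult_zero)
  then show ?case by (intro fls_eqI) (simp add: coef_subst_shift_nth in_laurent2_zero emb_const emb_zero)
next
  case (pCons x a)
  have L: "in_laurent2 (\<lambda>k l. poly1_mult a c k (l - int N))"
    using in_laurent2_shift[where a = 0 and b = "int N", OF in_laurent2_poly1_mult[OF assms]] by simp
  have "coef_series \<beta> j (subst_shift (poly1_mult (pCons x a) c)) =
    coef_series \<beta> j (subst_shift (\<lambda>k l. v_scale x (c k l) + poly1_mult a c k (l - int N)))"
    by (simp add: poly1_mult_pCons[abs_def])
  also have "\<dots> = fls_const (fls_const x) * coef_series \<beta> j (subst_shift c) +
    fls_const (fls_X_intpow (int N)) * (emb N (fls_const (fps_to_fls (fps_of_poly a))) * coef_series \<beta> j (subst_shift c))"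
    by (simp add: coef_subst_add[OF in_laurent2_scale[OF assms] L] coef_subst_scale[OF assms]
        coef_subst_shift_z2[OF in_laurent2_poly1_mult[OF assms]] pCons)
  finally show ?case
    using N_pos by (simp add: emb_const emb_add emb_mult fps_of_poly_pCons fls_times_fps_to_fls  algebra_simps
        flip: fls_const_mult_const fls_plus_const)
qed

lemma poly2_shift_pCons:
  "poly2_shift (pCons a p) = fls_const (fps_to_fls (fps_of_poly a)) + (fls_X + fls_const fls_X) * poly2_shift p"
  by (simp add: poly2_shift_def map_poly_pCons)

text \<open>Horner's scheme: each \<open>pCons\<close> adds a polynomial in z_2 and a factor z_1.
  The family \<open>c\<close> itself must be bounded below in both variables; for a bare two-point
  function the substitution would in general involve infinite sums.\<close>

lemma coef_subst_poly2_mult: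
  assumes "in_laurent2 (c :: int \<Rightarrow> int \<Rightarrow> 'n vspace)"
  shows "coef_series \<beta> j (subst_shift (poly2_mult p c)) = emb N (poly2_shift p) * coef_series \<beta> j (subst_shift c)"
proof (induction p rule: pCons_induct)
  case 0
  have "poly2_mult 0 c = (\<lambda>k l. 0)" by (intro ext) (rule poly2_mult_zero)
  then show ?case by (intro fls_eqI) (simp add: coef_subst_shift_nth in_laurent2_zero poly2_shift_def emb_zero)
next
  case (pCons a p)
  have L: "in_laurent2 (\<lambda>k l. poly2_mult p c (k - 1) l)"
    using in_laurent2_shift[where a = 1 and b = 0, OF in_laurent2_poly2_mult[OF assms]] by simp
  have "coef_series \<beta> j (subst_shift (poly2_mult (pCons a p) c)) =
    coef_series \<beta> j (subst_shift (\<lambda>k l. poly1_mult a c k l + poly2_mult p c (k - 1) l))"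
    by (simp add: poly2_mult_pCons[abs_def])
  also have "\<dots> = emb N (fls_const (fps_to_fls (fps_of_poly a))) * coef_series \<beta> j (subst_shift c) +
    (fls_X + fls_const (fls_X_intpow (int N))) * (emb N (poly2_shift p) * coef_series \<beta> j (subst_shift c))"
    by (simp add: coef_subst_add[OF in_laurent2_poly1_mult[OF assms] L] coef_subst_poly1_mult[OF assms]
        coef_subst_shift_z1[OF in_laurent2_poly2_mult[OF assms]] pCons)
  also have "fls_X + fls_const (fls_X_intpow (int N)) = emb N (fls_X + fls_const fls_X)"
    using N_pos by (simp add: emb_add emb_const emb_X)
  finally show ?case by (simp add: poly2_shift_pCons emb_add emb_mult distrib_right mult.assoc)
qed

text \<open>As a polynomial in z_0 over F((z)), p(z_0 + z, z) is p composed with z_0 + z, and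
  composition with a polynomial of degree one preserves nonvanishing.\<close>

lemma poly2_shift_nonzero:
  assumes "p \<noteq> 0"
  shows "poly2_shift p \<noteq> 0"
proof -
  define P where "P = map_poly (\<lambda>a. fps_to_fls (fps_of_poly a)) p"
  have "fps_to_fls (fps_of_poly a) = 0 \<longleftrightarrow> a = (0 :: qfield poly)" for a
    by (simp add: fps_to_fls_eq_0_iff)
  then have P: "P \<noteq> 0" using assms by (simp add: P_def map_poly_eq_0_iff)
  have *: "poly (map_poly (\<lambda>a. fls_const (fps_to_fls (fps_of_poly a))) p) (fls_X + fls_const a) =
     fps_to_fls (fps_of_poly (pcompose (map_poly (\<lambda>a. fps_to_fls (fps_of_poly a)) p) [:a, 1:]))" for a :: "qfield fls" and p :: "qfield poly poly"
    by (induction p rule: pCons_induct)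
      (simp_all add: map_poly_pCons pcompose_pCons fps_of_poly_add fps_of_poly_mult fps_of_poly_pCons fls_times_fps_to_fls fps_of_poly_smult fps_const_to_fls distrib_right mult.commute)
  have "pcompose P [:fls_X, 1:] \<noteq> 0" using P by (simp add: pcompose_eq_0_iff)
  then show ?thesis unfolding poly2_shift_def * P_def[symmetric] by simp
qed

end

section \<open>The bullet product at a simple pole\<close>

lemma qh_power: "qh ^ k = Fract (monom 1 k) 1"
proof (induction k)
  case (Suc k)
  then show ?case by (simp add: qh_def monom_Suc)
qed (simp add: One_fract_def)

lemma qh_nonzero [simp]: "qh \<noteq> 0"
  by (simp add: qh_def Zero_fract_def eq_fract)

lemma qh_power_eq_1: "qh ^ k = 1 \<longleftrightarrow> k = 0"
proof
  assume "qh ^ k = 1"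
  then have "monom (1 :: complex) k = 1" by (simp add: qh_power One_fract_def eq_fract)
  then have "degree (monom (1 :: complex) k) = 0" by simp
  then show "k = 0" by (simp add: degree_monom_eq)
qed simp

lemma qh_powi_eq_1: "qh powi s = 1 \<longleftrightarrow> s = 0"
  by (cases s rule: int_cases2) (simp_all add: power_int_minus qh_power_eq_1)

text \<open>\<open>qh\<close> is an indeterminate, hence not a root of unity. Therefore at most one
  dilation moves a given simple pole to z_1 = z_2.\<close>

lemma qh_powi_inject: "qh powi s = qh powi t \<longleftrightarrow> s = t"
proof
  assume "qh powi s = qh powi t"
  then have "qh powi (s - t) = 1" by (simp add: power_int_diff)
  then show "s = t" by (simp add: qh_powi_eq_1)
qed simp

lemma q_dilate_nth: "q_dilate s a v $$ k = v_scale (qh powi (s * k)) (a v $$ k)"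
proof -
  obtain L where "\<And>k. k < L \<Longrightarrow> a v $$ k = 0" using fls_nth_vanishes_belowE[of "a v"] by metis
  then show ?thesis unfolding q_dilate_def by (subst nth_Abs_fls_lower_bound[of L]) (auto simp: v_scale_zero)
qed

lemma op_component_add: "op_component \<gamma> (b + b') = op_component \<gamma> b + op_component \<gamma> b'"
  by (intro ext fls_eqI) (simp add: op_component_nth lookup_add tensor_e_def single_add sum.distrib)

lemma v_scale_minus: "v_scale (- c) v = - v_scale c v" "v_scale c (- v) = - v_scale c v"
  "v_scale c (v - w) = v_scale c v - v_scale c w"
proof -
  have 1: "v_scale (- c) v = - v_scale c v" for c and v :: "'a::finite vspace"
    by (rule minus_unique[symmetric]) (simp add: v_scale_simps flip: v_scale_simps(2))
  have 2: "v_scale c (- v) = - v_scale c v" for c and v :: "'a::finite vspace"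
    by (rule minus_unique[symmetric]) (simp add: v_scale_zero flip: v_scale_simps(1))
  show "v_scale (- c) v = - v_scale c v" "v_scale c (- v) = - v_scale c v"
    "v_scale c (v - w) = v_scale c v - v_scale c w"
    using v_scale_simps(1)[of c v "- w"] by (simp_all add: 1 2)
qed

context
  fixes N :: nat
  assumes N_def: "N = CARD('n::{finite,linorder}) + 1"
begin

text \<open>Any witness may replace the one selected in \<open>rprod\<close>: applying both
  polynomials to the two-point function in either order gives the same family, and their nonzero
  images in the field F((u))((z_0)) can be cancelled.\<close>

lemma rprod_coef:
  fixes a b :: "'n vop"
  assumes "qc_witness p a b"
  shows "coef \<beta> m (rprod r a b v $$ l) =
    (inverse (emb N (poly2_shift p)) * coef_series \<beta> m (subst_shift (poly2_mult p (two_point a b v)))) $$ (- r - 1) $$ l"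
proof -
  define P where "P = (SOME p. qc_witness p a b)"
  have P: "qc_witness P a b" unfolding P_def using assms by (rule someI)
  let ?S = "\<lambda>p. coef_series \<beta> m (subst_shift (poly2_mult p (two_point a b v)))"
  have nz: "emb N (poly2_shift P) \<noteq> 0" "emb N (poly2_shift p) \<noteq> 0"
    using emb_nonzero[OF N_pos[OF N_def] poly2_shift_nonzero[OF N_def]] P assms by (auto simp: qc_witness_def)
  have "emb N (poly2_shift P) * ?S p = coef_series \<beta> m (subst_shift (poly2_mult P (poly2_mult p (two_point a b v))))"
    using assms by (simp add: coef_subst_poly2_mult[OF N_def] qc_witness_def)
  also have "\<dots> = coef_series \<beta> m (subst_shift (poly2_mult p (poly2_mult P (two_point a b v))))"
    by (simp add: poly2_mult_commute[OF N_def, of P])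
  also have "\<dots> = emb N (poly2_shift p) * ?S P"
    using P by (simp add: coef_subst_poly2_mult[OF N_def] qc_witness_def)
  finally have "inverse (emb N (poly2_shift P)) * ?S P = inverse (emb N (poly2_shift p)) * ?S p"
    using nz by (simp add: field_simps)
  moreover have "emb N (inverse (poly2_shift P)) = inverse (emb N (poly2_shift P))"
    using P by (intro emb_inverse N_pos[OF N_def] poly2_shift_nonzero[OF N_def]) (simp add: qc_witness_def)
  ultimately show ?thesis
    unfolding rprod_def P_def[symmetric] Let_def coef_series_nth[symmetric] coef_series_act2[OF N_def] by simp
qed

lemma poly2_mult_add_right:
  fixes c c' :: "int \<Rightarrow> int \<Rightarrow> 'n vspace"
  shows "poly2_mult p (\<lambda>k l. c k l + c' k l) = (\<lambda>k l. poly2_mult p c k l + poly2_mult p c' k l)"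
  by (simp add: poly2_mult_def v_scale_simps sum.distrib fun_eq_iff)

lemma qc_witness_mult:
  fixes a b :: "'n vop"
  assumes "qc_witness p a b" "p' \<noteq> 0"
  shows "qc_witness (p' * p) a b"
proof -
  have "poly2_mult (p' * p) (two_point a b v) = poly2_mult p' (poly2_mult p (two_point a b v))" for v
    by (intro ext) (simp add: poly2_mult_mult[OF N_def])
  then show ?thesis using assms by (simp add: qc_witness_def in_laurent2_poly2_mult[OF N_def])
qed

text \<open>The product of the two witnesses is a common witness, and for a fixed polynomial the
  defining formula is additive in the right factor.\<close>

lemma
  fixes a b b' :: "'n vop"
  assumes a: "\<And>v w. a (v + w) = a v + a w" and p: "qc_witness p a b" and p': "qc_witness p' a b'"
  shows rprod_add: "rprod r a (b + b') = rprod r a b + rprod r a b'"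
    and qc_witness_add: "qc_witness (p' * p) a (b + b')"
proof -
  have w: "qc_witness (p' * p) a b" "qc_witness (p' * p) a b'"
    using qc_witness_mult[OF p, of p'] qc_witness_mult[OF p', of p] p p'
    by (auto simp: qc_witness_def mult.commute)
  have tp: "two_point a (b + b') v = (\<lambda>k l. two_point a b v k l + two_point a b' v k l)" for v
    by (simp add: two_point_def a fun_eq_iff)
  show *: "qc_witness (p' * p) a (b + b')"
    using w by (simp add: qc_witness_def tp poly2_mult_add_right in_laurent2_add)
  have "coef \<beta> m (rprod r a (b + b') v $$ l) = coef \<beta> m ((rprod r a b + rprod r a b') v $$ l)" for v \<beta> m l
    using w unfolding rprod_coef[OF *] tp poly2_mult_add_right
    by (simp add: qc_witness_def coef_subst_add[OF N_def] coef_add rprod_coef[OF w(1)] rprod_coef[OF w(2)] distrib_left)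
  then show "rprod r a (b + b') = rprod r a b + rprod r a b'"
    by (intro ext fls_eqI vspace_eqI)
qed

text \<open>The polynomial \<open>z\<^sub>1 - u z\<^sub>2\<close>.\<close>

definition pole_poly :: "qfield \<Rightarrow> qfield poly poly" where
  "pole_poly u = [:[:0, - u:], [:1:]:]"

lemma poly2_mult_pole_poly:
  "poly2_mult (pole_poly u) c k l = (c (k - 1) l - v_scale u (c k (l - int N)) :: 'n vspace)"
  by (simp add: pole_poly_def poly2_mult_pCons[OF N_def] poly1_mult_pCons[OF N_def] poly1_mult_zero[OF N_def]
      poly2_mult_zero[OF N_def] v_scale_simps v_scale_minus)

lemma qc_witness_pole_poly:
  fixes a b :: "'n vop"
  assumes "\<And>v. in_laurent2 (c v)"
    and "\<And>v k l. two_point a b v (k - 1) l - v_scale u (two_point a b v k (l - int N)) = c v k l"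
  shows "qc_witness (pole_poly u) a b"
proof -
  have "poly2_mult (pole_poly u) (two_point a b v) = c v" for v
    by (intro ext) (simp add: poly2_mult_pole_poly assms)
  then show ?thesis using assms by (simp add: qc_witness_def pole_poly_def)
qed

text \<open>Here \<open>c\<close> is (z_1 - u z_2) a(z_1) b(z_2). Under z_1 = z + z_0 the polynomial
  becomes z_0 + (1 - u) z. For u = 1 the coefficient at 1/z_0 is the value of \<open>c\<close> at
  z_1 = z; otherwise the inverse has only nonnegative powers of z_0 and the zeroth product
  vanishes.\<close>

lemma rprod_simple_pole:
  fixes a b :: "'n vop"
  assumes L: "\<And>v. in_laurent2 (c v)"
    and c: "\<And>v k l. two_point a b v (k - 1) l - v_scale u (two_point a b v k (l - int N)) = c v k l"
  shows "rprod 0 a b v $$ l = (if u = 1 then Sum_any (\<lambda>k. c v k (l - int N * k)) else 0)"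
proof (rule vspace_eqI)
  fix \<beta> m
  let ?f = "fls_X + fls_const ((1 - fls_const u) * fls_X_intpow (int N)) :: qfield fls fls"
  let ?S = "coef_series \<beta> m (subst_shift (c v))"
  have tp: "poly2_mult (pole_poly u) (two_point a b v) = c v"
    by (intro ext) (simp add: poly2_mult_pole_poly c)
  have "poly2_shift (pole_poly u) = fls_X + fls_const ((1 - fls_const u) * fls_X)"
    by (intro fls_eqI) (simp add: pole_poly_def poly2_shift_def map_poly_pCons fps_of_poly_pCons algebra_simps)
  then have "emb N (poly2_shift (pole_poly u)) = ?f"
    using N_pos[OF N_def] by (simp add: emb_add emb_X emb_const)
  then have *: "coef \<beta> m (rprod 0 a b v $$ l) = (inverse ?f * ?S) $$ (- 1) $$ l"
    using rprod_coef[OF qc_witness_pole_poly[where c = c, OF L c], where r = 0 and v = v] by (simp add: tp)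
  have S0: "?S $$ k = 0" if "k < 0" for k
    using that by (intro fls_eqI) (simp add: coef_subst_shift_nth[OF N_def L])
  show "coef \<beta> m (rprod 0 a b v $$ l) = coef \<beta> m (if u = 1 then Sum_any (\<lambda>k. c v k (l - int N * k)) else 0)"
  proof (cases "u = 1")
    case True
    have fin: "finite {k. c v k (l - int N * k) \<noteq> 0}"
      using in_laurent2_subst_finite[OF N_def L, of v l 0] by simp
    have "?f = fls_X" using True by simp
    then have "(inverse ?f * ?S) $$ (- 1) = ?S $$ 0"
      by (simp add: fls_inverse_X fls_X_inv_times_conv_shift)
    then show ?thesis using True
      by (simp add: * coef_subst_shift_nth[OF N_def L] coef_Sum_any[OF fin])
  next
    case False
    have "1 - fls_const u \<noteq> 0"
    proof
      assume "1 - fls_const u = 0"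
      then have "(1 - fls_const u) $$ 0 = 0" by simp
      then show False using False by simp
    qed
    then have "(1 - fls_const u) * fls_X_intpow (int N) \<noteq> (0 :: qfield fls)" by simp
    then have sd: "fls_subdegree ?f = 0" by (intro fls_subdegree_eqI) auto
    have "(inverse ?f * ?S) $$ (- 1) = 0"
    proof (cases "?S = 0")
      case False
      have "fls_subdegree ?S \<ge> 0" using S0 False by (intro fls_subdegree_geI) auto
      moreover have "fls_subdegree (inverse ?f) = 0" using sd by (simp add: fls_inverse_subdegree)
      ultimately show ?thesis by (intro fls_times_nth_eq0) simp
    qed simp
    then show ?thesis using False by (simp add: *)
  qed
qed

text \<open>Dilating the left factor by q^(s/2) moves the pole from u to u / q^(s/2), so a zeroth
  product can survive only if u = q^(s/2).\<close>

lemma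
  fixes a b :: "'n vop"
  assumes L: "\<And>v. in_laurent2 (c v)"
    and c: "\<And>v k l. two_point a b v (k - 1) l - v_scale u (two_point a b v k (l - int N)) = c v k l"
  shows rprod_q_dilate: "rprod 0 (q_dilate s a) b v $$ l =
      (if u = qh powi s then Sum_any (\<lambda>k. v_scale (u powi (k - 1)) (c v k (l - int N * k))) else 0)"
    and qc_witness_q_dilate: "\<exists>p. qc_witness p (q_dilate s a) b"
proof -
  let ?Q = "qh powi s"
  \<comment> \<open>The exponent is k - 1 because one of the k powers of z_1 comes from the
    polynomial, which is not dilated.\<close>
  define c' where "c' v k l = v_scale (?Q powi (k - 1)) (c v k l)" for v k l
  have L': "in_laurent2 (c' v)" for v
    unfolding c'_def by (rule in_laurent2_scale[OF N_def L])
  have Q: "?Q powi k = ?Q * ?Q powi (k - 1)" for k by (simp add: power_int_diff)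
  have tp: "two_point (q_dilate s a) b v k l = v_scale (?Q powi k) (two_point a b v k l)" for v k l
    by (simp add: two_point_def q_dilate_nth power_int_mult)
  have c': "two_point (q_dilate s a) b v (k - 1) l - v_scale (u / ?Q) (two_point (q_dilate s a) b v k (l - int N)) = c' v k l" for v k l
    by (simp add: c'_def c[symmetric] tp v_scale_simps v_scale_minus Q[of k] mult.commute)
  show "\<exists>p. qc_witness p (q_dilate s a) b"
    using qc_witness_pole_poly[where c = c', OF L' c'] by blast
  have "(u / ?Q = 1) = (u = ?Q)" by simp
  then show "rprod 0 (q_dilate s a) b v $$ l =
      (if u = qh powi s then Sum_any (\<lambda>k. v_scale (u powi (k - 1)) (c v k (l - int N * k))) else 0)"
    unfolding rprod_simple_pole[where c = c', OF L' c'] by (simp add: c'_def)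
qed

lemma z_pow_mult_nth: "z_pow_mult e (b :: 'n vop) v $$ l = b v $$ (l - int N * e)"
  unfolding z_pow_mult_def N_def by (simp add: algebra_simps)

lemma z_pow_mult_zero: "z_pow_mult e (0 :: 'n vop) = 0"
  by (intro ext fls_eqI) (simp add: z_pow_mult_nth)

text \<open>A single summand survives. Its prefactor u^(1 - e) and the power u^(k - 1) from the
  dilation combine to u^(k - e), while z^(-e) shifts the index by N * e. The value u = 0 is no power
  of \<open>qh\<close> and belongs to the zero case.\<close>

lemma bullet_wt_simple_pole:
  fixes a b :: "'n vop"
  assumes L: "\<And>v. in_laurent2 (c v)"
    and c: "\<And>v k l. two_point a b v (k - 1) l - v_scale u (two_point a b v k (l - int N)) = c v k l"
    and e: "e = iform (wt a) \<gamma> + 1"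
  shows "bullet_wt \<gamma> a b v $$ l = (if u \<in> range ((powi) qh) then
      Sum_any (\<lambda>k. v_scale (u powi (k - e)) (c v k (l + int N * e - int N * k))) else 0)"
proof -
  have r0: "rprod 0 (q_dilate s a) b = 0" if "u \<noteq> qh powi s" for s
    by (intro ext fls_eqI) (simp add: rprod_q_dilate[where c = c, OF L c] that)
  show ?thesis
  proof (cases "u \<in> range ((powi) qh)")
    case True
    then obtain s where s: "u = qh powi s" by auto
    have fin: "finite {k. v_scale (u powi (k - 1)) (c v k (l + int N * e - int N * k)) \<noteq> 0}"
      by (rule finite_subset[OF _ in_laurent2_subst_finite[OF N_def L, of v "l + int N * e" 0]])
        (auto simp: v_scale_zero)
    have "bullet_wt \<gamma> a b = op_scale ((1 / qh powi s) powi e * qh powi s) (z_pow_mult (- e) (rprod 0 (q_dilate s a) b))"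
      unfolding bullet_wt_def e[symmetric] Let_def
      by (subst Sum_any.expand_superset[of "{s}"]) (auto simp: s qh_powi_inject r0 z_pow_mult_zero)
    then have "bullet_wt \<gamma> a b v $$ l = v_scale ((1 / u) powi e * u)
       (Sum_any (\<lambda>k. v_scale (u powi (k - 1)) (c v k (l + int N * e - int N * k))))"
      by (simp add: op_scale_def series_scale_nth z_pow_mult_nth rprod_q_dilate[where c = c, OF L c] s)
    also have "\<dots> = Sum_any (\<lambda>k. v_scale ((1 / u) powi e * u) (v_scale (u powi (k - 1)) (c v k (l + int N * e - int N * k))))"
      by (subst (1 2) Sum_any.expand_superset[OF fin]) (auto simp: v_scale_sum v_scale_zero)
    also have "\<dots> = Sum_any (\<lambda>k. v_scale (u powi (k - e)) (c v k (l + int N * e - int N * k)))"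
      by (simp add: v_scale_simps s power_int_diff power_int_divide_distrib)
    finally show ?thesis using True by simp
  next
    case False
    then have "u \<noteq> qh powi s" for s by auto
    then have "bullet_wt \<gamma> a b = 0"
      by (simp add: bullet_wt_def Let_def e[symmetric] r0 z_pow_mult_zero)
    then show ?thesis using False by simp
  qed
qed

text \<open>For such pairs neither the polynomial chosen in \<open>rprod\<close> nor one of the sums \<open>Sum_any\<close> in \<open>bullet\<close>
  is a junk value, so that the product is additive in \<open>b\<close>.\<close>

definition compat :: "'n vop \<Rightarrow> 'n vop \<Rightarrow> bool" where
  "compat a b \<longleftrightarrow> finite {\<gamma>. op_component \<gamma> b \<noteq> 0} \<and>
    (\<forall>\<gamma> s. \<exists>p. qc_witness p (q_dilate s a) (op_component \<gamma> b)) \<and>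
    (\<forall>\<gamma>. finite {s. rprod 0 (q_dilate s a) (op_component \<gamma> b) \<noteq> 0})"

lemma op_component_zero: "op_component \<gamma> 0 = (0 :: 'n vop)"
  by (intro ext fls_eqI) (simp add: op_component_nth tensor_e_def)

lemma z_pow_mult_add: "z_pow_mult e (b + b') = z_pow_mult e b + z_pow_mult e (b' :: 'n vop)"
  by (intro ext) (simp add: z_pow_mult_def)

lemma q_dilate_add:
  fixes a :: "'n vop"
  assumes "\<And>v w. a (v + w) = a v + a w"
  shows "q_dilate s a (v + w) = q_dilate s a v + q_dilate s a w"
  by (intro fls_eqI) (simp add: q_dilate_nth assms v_scale_simps)

lemma
  fixes a b b' :: "'n vop"
  assumes a: "\<And>v w. a (v + w) = a v + a w" and b: "compat a b" and b': "compat a b'"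
  shows bullet_add: "a \<bullet>\<^sub>q (b + b') = a \<bullet>\<^sub>q b + a \<bullet>\<^sub>q b'"
    and compat_add: "compat a (b + b')"
proof -
  let ?T = "\<lambda>b \<gamma> s. rprod 0 (q_dilate s a) (op_component \<gamma> b)"
  have T: "?T (b + b') \<gamma> s = ?T b \<gamma> s + ?T b' \<gamma> s" for \<gamma> s
  proof -
    obtain p p' where "qc_witness p (q_dilate s a) (op_component \<gamma> b)" "qc_witness p' (q_dilate s a) (op_component \<gamma> b')"
      using b b' unfolding compat_def by meson
    from rprod_add[OF q_dilate_add[OF a] this] show ?thesis by (simp add: op_component_add)
  qed
  have fin: "finite {s. op_scale (x s) (z_pow_mult e (?T c \<gamma> s)) \<noteq> 0}" if "compat a c" for x e c \<gamma>
  proof -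
    have "finite {s. ?T c \<gamma> s \<noteq> 0}" using that unfolding compat_def by blast
    then show ?thesis by (rule rev_finite_subset) (auto simp: z_pow_mult_zero)
  qed
  have wt: "bullet_wt \<gamma> a (op_component \<gamma> (b + b')) = bullet_wt \<gamma> a (op_component \<gamma> b) + bullet_wt \<gamma> a (op_component \<gamma> b')" for \<gamma>
    unfolding bullet_wt_def Let_def T z_pow_mult_add op_space.scale_right_distrib
    by (rule Sum_any.distrib[OF fin[OF b] fin[OF b']])
  have a0: "a 0 = 0" using a[of 0 0] by simp
  have "q_dilate s a 0 = 0" for s by (intro fls_eqI) (simp add: q_dilate_nth a0 v_scale_zero)
  then have "bullet_wt \<gamma> a 0 = 0" for \<gamma>
    by (simp add: bullet_wt_def Let_def rprod_zero z_pow_mult_zero)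
  then have fin2: "finite {\<gamma>. bullet_wt \<gamma> a (op_component \<gamma> c) \<noteq> 0}" if "compat a c" for c
    using that unfolding compat_def by (metis (mono_tags, lifting) rev_finite_subset mem_Collect_eq subsetI)
  show "a \<bullet>\<^sub>q (b + b') = a \<bullet>\<^sub>q b + a \<bullet>\<^sub>q b'"
    unfolding bullet_def wt by (rule Sum_any.distrib[OF fin2[OF b] fin2[OF b']])
  show "compat a (b + b')"
    unfolding compat_def
  proof (intro conjI allI)
    have "finite ({\<gamma>. op_component \<gamma> b \<noteq> 0} \<union> {\<gamma>. op_component \<gamma> b' \<noteq> 0})"
      using b b' by (auto simp: compat_def)
    then show "finite {\<gamma>. op_component \<gamma> (b + b') \<noteq> 0}"
      by (rule rev_finite_subset) (auto simp: op_component_add)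
    fix \<gamma> s
    obtain p p' where "qc_witness p (q_dilate s a) (op_component \<gamma> b)" "qc_witness p' (q_dilate s a) (op_component \<gamma> b')"
      using b b' unfolding compat_def by meson
    from qc_witness_add[OF q_dilate_add[OF a] this]
    show "\<exists>p. qc_witness p (q_dilate s a) (op_component \<gamma> (b + b'))" by (auto simp: op_component_add)
    have "finite ({s. ?T b \<gamma> s \<noteq> 0} \<union> {s. ?T b' \<gamma> s \<noteq> 0})"
      using b b' by (auto simp: compat_def)
    then show "finite {s. ?T (b + b') \<gamma> s \<noteq> 0}"
      by (rule rev_finite_subset) (auto simp: T)
  qed
qed

lemma compat_zero: "a 0 = 0 \<Longrightarrow> compat a (0 :: 'n vop)"
proof -
  assume a: "a 0 = 0"
  have q0: "q_dilate s a 0 = 0" for s by (intro fls_eqI) (simp add: q_dilate_nth a v_scale_zero)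
  have "qc_witness 1 (q_dilate s a) 0" for s
    by (simp add: qc_witness_def in_laurent2_def poly2_mult_def two_point_def q0 v_scale_zero)
  then show ?thesis unfolding compat_def by (auto simp: op_component_zero rprod_zero q0)
qed

text \<open>A homogeneous operator has at most one nonzero component, and a simple pole leaves at
  most one dilation; both finiteness conditions of \<open>compat\<close> follow.\<close>

lemma
  fixes a b :: "'n vop"
  assumes a0: "a 0 = 0" and hom: "op_component \<gamma> b = b"
    and L: "\<And>v. in_laurent2 (c v)"
    and c: "\<And>v k l. two_point a b v (k - 1) l - v_scale u (two_point a b v k (l - int N)) = c v k l"
  shows bullet_simple_pole: "e = iform (wt a) \<gamma> + 1 \<Longrightarrow> (a \<bullet>\<^sub>q b) v $$ l = (if u \<in> range ((powi) qh) then
      Sum_any (\<lambda>k. v_scale (u powi (k - e)) (c v k (l + int N * e - int N * k))) else 0)"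
    and compat_simple_pole: "compat a b"
proof -
  show "e = iform (wt a) \<gamma> + 1 \<Longrightarrow> (a \<bullet>\<^sub>q b) v $$ l = (if u \<in> range ((powi) qh) then
      Sum_any (\<lambda>k. v_scale (u powi (k - e)) (c v k (l + int N * e - int N * k))) else 0)"
    unfolding bullet_homogeneous[of a \<gamma> b, OF a0 hom] by (rule bullet_wt_simple_pole[where c = c, OF L c])
  have comp0: "op_component \<gamma>' b = 0" if "\<gamma>' \<noteq> \<gamma>" for \<gamma>'
  proof (intro ext fls_eqI)
    fix v k
    have "Poly_Mapping.lookup (b (tensor_e p \<beta>) $$ k) (\<gamma>' + \<beta>) = 0" for p \<beta>
      by (subst hom[symmetric]) (use that in \<open>simp add: op_component_nth, simp add: tensor_e_def lookup_single\<close>)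
    then show "op_component \<gamma>' b v $$ k = 0 v $$ k"
      by (simp add: op_component_nth) (simp add: tensor_e_def)
  qed
  have z: "compat a 0" using a0 by (rule compat_zero)
  have fin: "finite {s. rprod 0 (q_dilate s a) b \<noteq> 0}"
  proof (cases "u \<in> range ((powi) qh)")
    case True
    then obtain s where s: "u = qh powi s" by auto
    have "rprod 0 (q_dilate t a) b = 0" if "t \<noteq> s" for t
      by (intro ext fls_eqI) (use that in \<open>simp add: rprod_q_dilate[where c = c, OF L c] s qh_powi_inject\<close>)
    then have "{s. rprod 0 (q_dilate s a) b \<noteq> 0} \<subseteq> {s}" by auto
    then show ?thesis by (rule finite_subset) simp
  next
    case False
    then have "rprod 0 (q_dilate t a) b = 0" for t
      by (intro ext fls_eqI) (auto simp: rprod_q_dilate[where c = c, OF L c])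
    then show ?thesis by simp
  qed
  have "finite {\<gamma>'. op_component \<gamma>' b \<noteq> 0}"
    by (rule finite_subset[of _ "{\<gamma>}"]) (use comp0 in auto)
  then show "compat a b"
    unfolding compat_def
  proof (intro conjI allI)
    fix \<gamma>' s
    show "\<exists>p. qc_witness p (q_dilate s a) (op_component \<gamma>' b)"
      using z qc_witness_q_dilate[where c = c, OF L c]
      by (cases "\<gamma>' = \<gamma>") (auto simp: comp0 hom compat_def op_component_zero)
    show "finite {s. rprod 0 (q_dilate s a) (op_component \<gamma>' b) \<noteq> 0}"
      using z fin
      by (cases "\<gamma>' = \<gamma>") (auto simp: comp0 hom compat_def op_component_zero)
  qed
qed

end

section \<open>Linear operators on the Fock space and sums over triangles\<close>

interpretation fock: vector_space "fock_scale :: qfield \<Rightarrow> 'a fock \<Rightarrow> 'a fock"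
  by standard (auto simp: fock_scale_simps)

lemma fock_scale_mult: "fock_scale c p * q = fock_scale c (p * q)" "p * fock_scale c q = fock_scale c (p * q)"
  by (simp_all add: fock_scale_def mult_ac)

definition fock_linear :: "('a fock \<Rightarrow> 'a fock) \<Rightarrow> bool" where
  "fock_linear A \<longleftrightarrow> (\<forall>p q. A (p + q) = A p + A q) \<and> (\<forall>c p. A (fock_scale c p) = fock_scale c (A p))"

lemma fock_linearD:
  assumes "fock_linear A"
  shows "A (p + q) = A p + A q" "A (fock_scale c p) = fock_scale c (A p)" "A 0 = 0"
    "A (sum f I) = (\<Sum>i\<in>I. A (f i))"
proof -
  show 1: "A (p + q) = A p + A q" "A (fock_scale c p) = fock_scale c (A p)" for p q c
    using assms by (simp_all add: fock_linear_def)
  show 0: "A 0 = 0" using 1(2)[of 0 0] by simp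
  show "A (sum f I) = (\<Sum>i\<in>I. A (f i))"
    by (induction I rule: infinite_finite_induct) (auto simp: 0 1)
qed

lemma fock_linear_mult: "fock_linear ((*) q)"
  by (simp add: fock_linear_def fock_scale_mult distrib_left)

lemma fock_linear_deriv: "fock_linear (fock_deriv c)"
proof -
  have "fock_deriv c (fock_scale x p) = fock_scale x (fock_deriv c p)" for x p
    by (simp add: fock_scale_def fock_deriv_mult fock_deriv_scalar)
  then show ?thesis by (simp add: fock_linear_def fock_deriv_add)
qed

text \<open>Differentiating a product of exponentials yields sums over r >= 1 and i >= 0 with r + i
  <= k; here they are collected by r + i.\<close>

lemma triangle_sum_diag:
  fixes f :: "nat \<Rightarrow> nat \<Rightarrow> 'a::comm_monoid_add"
  shows "(\<Sum>r=1..k. \<Sum>i\<le>k - r. f r i) = (\<Sum>j\<le>k. \<Sum>r=1..j. f r (j - r))"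
  unfolding sum.Sigma[OF finite_atLeastAtMost ballI[OF finite_atMost]] sum.Sigma[OF finite_atMost ballI[OF finite_atLeastAtMost]]
  by (rule sum.reindex_bij_witness[of _ "\<lambda>(j, r). (r, j - r)" "\<lambda>(r, i). (r + i, r)"]) auto

lemma triangle_sum_swap:
  fixes f :: "nat \<Rightarrow> nat \<Rightarrow> 'a::comm_monoid_add"
  shows "(\<Sum>r=1..k. \<Sum>i\<le>k - r. f r i) = (\<Sum>i\<le>k. \<Sum>r=1..k - i. f r i)"
  unfolding sum.Sigma[OF finite_atLeastAtMost ballI[OF finite_atMost]] sum.Sigma[OF finite_atMost ballI[OF finite_atLeastAtMost]]
  by (rule sum.reindex_bij_witness[of _ "\<lambda>(i, r). (r, i)" "\<lambda>(r, i). (i, r)"]) auto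

lemma triangle_sum_swap1:
  fixes f :: "nat \<Rightarrow> nat \<Rightarrow> 'a::comm_monoid_add"
  shows "(\<Sum>r=1..k. \<Sum>s=1..k - r. f r s) = (\<Sum>s=1..k. \<Sum>r=1..k - s. f r s)"
  unfolding sum.Sigma[OF finite_atLeastAtMost ballI[OF finite_atLeastAtMost]]
  by (rule sum.reindex_bij_witness[of _ "\<lambda>(i, r). (r, i)" "\<lambda>(r, i). (i, r)"]) auto

section \<open>Exponentials of commuting operators\<close>

definition commuting :: "(nat \<Rightarrow> 'a fock \<Rightarrow> 'a fock) \<Rightarrow> bool" where
  "commuting A \<longleftrightarrow> (\<forall>r. fock_linear (A r)) \<and> (\<forall>r s p. A r (A s p) = A s (A r p))"

lemma op_pow_coeff_commute:
  assumes "\<And>r p. C (A r p) = A r (C p)" "fock_linear C"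
  shows "C (op_pow_coeff A m k p) = op_pow_coeff A m k (C p)"
  by (induction m arbitrary: k) (auto simp: fock_linearD[OF assms(2)] assms(1))

lemma op_exp_coeff_commute:
  assumes "\<And>r p. C (A r p) = A r (C p)" "fock_linear C"
  shows "C (op_exp_coeff A k p) = op_exp_coeff A k (C p)"
  by (simp add: op_exp_coeff_def fock_linearD[OF assms(2)] op_pow_coeff_commute[of C A, OF assms])

lemma op_exp_coeff_0 [simp]: "op_exp_coeff A 0 p = p"
  by (simp add: op_exp_coeff_def)

text \<open>Each factor raises the degree by at least one, so truncating the exponential series at m
  = k loses nothing.\<close>

lemma op_pow_coeff_vanish: "m > k \<Longrightarrow> (\<And>r. fock_linear (A r)) \<Longrightarrow> op_pow_coeff A m k p = 0"
proof (induction m arbitrary: k)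
  case (Suc m)
  have "A r (op_pow_coeff A m (k - r) p) = 0" if "r \<in> {1..k}" for r
  proof -
    have "k - r < m" using that Suc.prems by auto
    then show ?thesis using Suc.IH Suc.prems by (simp add: fock_linearD(3))
  qed
  then show ?case by simp
qed simp

lemma op_pow_coeff_linear:
  assumes "\<And>r. fock_linear (A r)"
  shows "fock_linear (op_pow_coeff A m k)"
proof (induction m arbitrary: k)
  case (Suc m)
  then show ?case using assms
    by (simp add: fock_linear_def sum.distrib fock.scale_sum_right)
qed (simp add: fock_linear_def)

lemma op_exp_coeff_linear:
  assumes "\<And>r. fock_linear (A r)"
  shows "fock_linear (op_exp_coeff A k)"
  by (simp add: fock_linear_def op_exp_coeff_def fock_linearD[OF op_pow_coeff_linear[OF assms]]
      fock.scale_right_distrib sum.distrib fock.scale_sum_right fock.scale_left_commute)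

lemma op_exp_coeff_cong:
  assumes "\<And>r p. r \<ge> 1 \<Longrightarrow> A r p = A' r p"
  shows "op_exp_coeff A k p = op_exp_coeff A' k p"
proof -
  have "op_pow_coeff A m k p = op_pow_coeff A' m k p" for m k
    by (induction m arbitrary: k) (auto intro!: sum.cong simp: assms)
  then show ?thesis by (simp add: op_exp_coeff_def)
qed

lemma op_exp_coeff_scale:
  assumes "\<And>r. fock_linear (A r)"
  shows "op_exp_coeff (\<lambda>r p. fock_scale (x ^ r) (A r p)) k p = fock_scale (x ^ k) (op_exp_coeff A k p)"
proof -
  have "op_pow_coeff (\<lambda>r p. fock_scale (x ^ r) (A r p)) m k p = fock_scale (x ^ k) (op_pow_coeff A m k p)" for m k
  proof (induction m arbitrary: k)
    case (Suc m)
    then show ?case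
      by (auto simp: fock_linearD[OF assms] fock.scale_sum_right power_add[symmetric] intro!: sum.cong)
  qed simp
  then show ?thesis by (simp add: op_exp_coeff_def fock.scale_sum_right mult.commute)
qed

text \<open>Coefficient form of (A^(m+1))' = (m+1) A' A^m, where the prime is the Euler derivation,
  which multiplies the coefficient of degree k by k. Commutativity makes the m + 1 terms of the
  product rule equal.\<close>

lemma op_pow_coeff_rec:
  assumes "commuting A"
  shows "fock_scale (of_nat k) (op_pow_coeff A (Suc m) k p) =
    fock_scale (of_nat (Suc m)) (\<Sum>r=1..k. fock_scale (of_nat r) (A r (op_pow_coeff A m (k - r) p)))"
proof (induction m arbitrary: k)
  note lin = assms[unfolded commuting_def, THEN conjunct1, rule_format]
  case 0
  have *: "fock_scale (of_nat k) (A r (op_pow_coeff A 0 (k - r) p)) = fock_scale (of_nat r) (A r (op_pow_coeff A 0 (k - r) p))"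
    if "r \<in> {1..k}" for r
    using that by (cases "k - r = 0") (auto simp: fock_linearD[OF lin])
  have "fock_scale (of_nat k) (op_pow_coeff A (Suc 0) k p) =
      (\<Sum>r=1..k. fock_scale (of_nat k) (A r (op_pow_coeff A 0 (k - r) p)))"
    by (simp only: op_pow_coeff.simps(2) fock.scale_sum_right)
  also have "\<dots> = (\<Sum>r=1..k. fock_scale (of_nat r) (A r (op_pow_coeff A 0 (k - r) p)))"
    by (rule sum.cong[OF refl *])
  finally show ?case by simp
next
  note lin = assms[unfolded commuting_def, THEN conjunct1, rule_format]
  note com = assms[unfolded commuting_def, THEN conjunct2, rule_format]
  case (Suc m)
  let ?P = "\<lambda>m k. op_pow_coeff A m k p"
  have "fock_scale (of_nat k) (?P (Suc (Suc m)) k) = (\<Sum>r=1..k. fock_scale (of_nat k) (A r (?P (Suc m) (k - r))))"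
    by (simp only: op_pow_coeff.simps(2)[of A "Suc m"] fock.scale_sum_right)
  also have "\<dots> = (\<Sum>r=1..k. fock_scale (of_nat r) (A r (?P (Suc m) (k - r)))) +
    (\<Sum>r=1..k. A r (fock_scale (of_nat (k - r)) (?P (Suc m) (k - r))))"
  proof (unfold sum.distrib[symmetric], rule sum.cong)
    fix r assume "r \<in> {1..k}"
    \<comment> \<open>Product rule for the Euler derivation: the degree splits into that of the
      first factor and that of the rest.\<close>
    then have "(of_nat k :: qfield) = of_nat r + of_nat (k - r)" by (simp flip: of_nat_add)
    then show "fock_scale (of_nat k) (A r (?P (Suc m) (k - r))) = fock_scale (of_nat r) (A r (?P (Suc m) (k - r))) +
      A r (fock_scale (of_nat (k - r)) (?P (Suc m) (k - r)))"
      by (simp only: fock.scale_left_distrib fock_linearD(2)[OF lin])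
  qed simp
  also have "(\<Sum>r=1..k. A r (fock_scale (of_nat (k - r)) (?P (Suc m) (k - r)))) =
    (\<Sum>r=1..k. \<Sum>s=1..k - r. fock_scale (of_nat (Suc m) * of_nat s) (A r (A s (?P m (k - r - s)))))"
    by (simp only: Suc fock_linearD[OF lin] fock.scale_sum_right fock.scale_scale)
  also have "\<dots> = (\<Sum>s=1..k. \<Sum>r=1..k - s. fock_scale (of_nat (Suc m) * of_nat s) (A s (A r (?P m (k - s - r)))))"
    by (subst triangle_sum_swap1) (simp add: com[of _ _ "op_pow_coeff _ _ _ _"] add.commute)
  also have "\<dots> = fock_scale (of_nat (Suc m)) (\<Sum>s=1..k. fock_scale (of_nat s) (A s (?P (Suc m) (k - s))))"
    by (simp only: op_pow_coeff.simps(2)[of A m] fock_linearD[OF lin] fock.scale_sum_right fock.scale_scale)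
  finally show ?case
    by (simp only: of_nat_Suc[of "Suc m"] fock.scale_left_distrib fock.scale_one)
qed

text \<open>The coefficients of \<open>(exp A)' = A' exp A\<close>.\<close>

lemma op_exp_coeff_rec:
  assumes "commuting A"
  shows "fock_scale (of_nat k) (op_exp_coeff A k p) =
    (\<Sum>r=1..k. fock_scale (of_nat r) (A r (op_exp_coeff A (k - r) p)))"
proof (cases k)
  note lin = assms[unfolded commuting_def, THEN conjunct1, rule_format]
  case (Suc K)
  have ext: "op_exp_coeff A i p = (\<Sum>m\<le>M. fock_scale (1 / fact m) (op_pow_coeff A m i p))" if "M \<ge> i" for i M
    unfolding op_exp_coeff_def
    by (rule sum.mono_neutral_left) (use that in \<open>auto simp: op_pow_coeff_vanish[OF _ lin]\<close>)
  have "fock_scale (of_nat k) (op_exp_coeff A k p) =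
    (\<Sum>m\<le>K. fock_scale (1 / fact (Suc m)) (fock_scale (of_nat k) (op_pow_coeff A (Suc m) k p)))"
    unfolding op_exp_coeff_def Suc sum.atMost_Suc_shift fock.scale_sum_right
    by (simp add: fock.scale_right_distrib fock.scale_sum_right mult.commute del: op_pow_coeff.simps(2) of_nat_Suc fact_Suc)
  also have "\<dots> = (\<Sum>m\<le>K. \<Sum>r=1..k. fock_scale (of_nat r) (A r (fock_scale (1 / fact m) (op_pow_coeff A m (k - r) p))))"
  proof (rule sum.cong)
    fix m
    have "1 / fact (Suc m) * of_nat (Suc m) = (1 / fact m :: qfield)"
      unfolding fact_Suc by (simp del: of_nat_Suc)
    then have f: "1 / fact (Suc m) * (of_nat (Suc m) * x) = (x / fact m :: qfield)" for x
      by (metis mult.assoc mult.commute times_divide_eq_left mult_1)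
    show "fock_scale (1 / fact (Suc m)) (fock_scale (of_nat k) (op_pow_coeff A (Suc m) k p)) =
      (\<Sum>r=1..k. fock_scale (of_nat r) (A r (fock_scale (1 / fact m) (op_pow_coeff A m (k - r) p))))"
      by (simp only: op_pow_coeff_rec[OF assms] fock.scale_sum_right fock.scale_scale f fock_linearD[OF lin]) simp
  qed simp
  also have "\<dots> = (\<Sum>r=1..k. fock_scale (of_nat r) (A r (\<Sum>m\<le>K. fock_scale (1 / fact m) (op_pow_coeff A m (k - r) p))))"
    by (subst sum.swap) (simp only: fock_linearD[OF lin] fock.scale_sum_right)
  also have "\<dots> = (\<Sum>r=1..k. fock_scale (of_nat r) (A r (op_exp_coeff A (k - r) p)))"
    by (intro sum.cong) (auto simp: ext[of _ K] Suc)
  finally show ?thesis .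
qed simp

text \<open>In characteristic 0 the differential equation and the constant term determine a series.
  The identities of exponentials below are proved by checking this recursion.\<close>

lemma op_exp_coeff_unique:
  assumes "commuting A" "F 0 = p"
    and F: "\<And>k. fock_scale (of_nat k) (F k) = (\<Sum>r=1..k. fock_scale (of_nat r) (A r (F (k - r))))"
  shows "F k = op_exp_coeff A k p"
proof (induction k rule: less_induct)
  case (less k)
  show ?case
  proof (cases "k = 0")
    case False
    have "fock_scale (of_nat k) (F k) = fock_scale (of_nat k) (op_exp_coeff A k p)"
      unfolding F op_exp_coeff_rec[OF assms(1)] by (intro sum.cong) (auto simp: less)
    then show ?thesis using False by simp
  qed (simp add: assms)
qed

text \<open>The Cauchy product solves the differential equation of exp(A + C): the derivative of the
  left factor gives A', that of the right factor gives C', which commutes past exp(A).\<close>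

lemma op_exp_coeff_add:
  assumes A: "commuting A" and C: "commuting C" and AC: "\<And>r s p. A r (C s p) = C s (A r p)"
  shows "op_exp_coeff (\<lambda>r p. A r p + C r p) k p = (\<Sum>i\<le>k. op_exp_coeff A i (op_exp_coeff C (k - i) p))"
proof (rule op_exp_coeff_unique[symmetric])
  note linA = A[unfolded commuting_def, THEN conjunct1, rule_format]
  note linC = C[unfolded commuting_def, THEN conjunct1, rule_format]
  show "commuting (\<lambda>r p. A r p + C r p)"
    using A C AC by (auto simp: commuting_def fock_linear_def fock.scale_right_distrib algebra_simps)
  let ?A = "op_exp_coeff A" and ?C = "\<lambda>i. op_exp_coeff C i p"
  note lA = op_exp_coeff_linear[where A = A, OF linA]
  fix k
  have "fock_scale (of_nat k) (\<Sum>i\<le>k. ?A i (?C (k - i))) =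
    (\<Sum>i\<le>k. fock_scale (of_nat i) (?A i (?C (k - i)))) + (\<Sum>i\<le>k. ?A i (fock_scale (of_nat (k - i)) (?C (k - i))))"
  proof (unfold fock.scale_sum_right sum.distrib[symmetric], rule sum.cong)
    fix i assume "i \<in> {..k}"
    then have "(of_nat k :: qfield) = of_nat i + of_nat (k - i)" by (simp flip: of_nat_add)
    then show "fock_scale (of_nat k) (?A i (?C (k - i))) =
      fock_scale (of_nat i) (?A i (?C (k - i))) + ?A i (fock_scale (of_nat (k - i)) (?C (k - i)))"
      by (simp only: fock.scale_left_distrib fock_linearD(2)[OF lA])
  qed simp
  also have "(\<Sum>i\<le>k. fock_scale (of_nat i) (?A i (?C (k - i)))) =
    (\<Sum>i\<le>k. \<Sum>r=1..i. fock_scale (of_nat r) (A r (?A (i - r) (?C (k - i)))))"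
    by (simp only: op_exp_coeff_rec[OF A])
  also have "\<dots> = (\<Sum>r=1..k. \<Sum>i\<le>k - r. fock_scale (of_nat r) (A r (?A i (?C (k - r - i)))))"
    unfolding triangle_sum_diag by (intro sum.cong) auto
  also have "(\<Sum>i\<le>k. ?A i (fock_scale (of_nat (k - i)) (?C (k - i)))) =
    (\<Sum>i\<le>k. \<Sum>r=1..k - i. fock_scale (of_nat r) (C r (?A i (?C (k - i - r)))))"
    by (simp only: op_exp_coeff_rec[OF C] fock_linearD[OF lA] op_exp_coeff_commute[of "C _" A, OF AC[symmetric] linC])
  also have "\<dots> = (\<Sum>r=1..k. \<Sum>i\<le>k - r. fock_scale (of_nat r) (C r (?A i (?C (k - r - i)))))"
    unfolding triangle_sum_swap by (simp add: add.commute)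
  finally show "fock_scale (of_nat k) (\<Sum>i\<le>k. ?A i (?C (k - i))) =
    (\<Sum>r=1..k. fock_scale (of_nat r) (A r (\<Sum>i\<le>k - r. ?A i (?C (k - r - i))) + C r (\<Sum>i\<le>k - r. ?A i (?C (k - r - i)))))"
    by (simp only: fock_linearD[OF linA] fock_linearD[OF linC] fock.scale_right_distrib fock.scale_sum_right sum.distrib)
qed simp

section \<open>Creation and annihilation parts\<close>

definition cre :: "('n::finite \<Rightarrow> nat \<Rightarrow> qfield) \<Rightarrow> nat \<Rightarrow> 'n fock" where
  "cre g r = (\<Sum>k\<in>UNIV. fock_scale (g k r) (fock_var (k, r - 1)))"

definition ann :: "('n::finite \<Rightarrow> nat \<Rightarrow> qfield) \<Rightarrow> nat \<Rightarrow> 'n fock \<Rightarrow> 'n fock" where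
  "ann h r = fock_deriv (\<lambda>(k, s). if r = s + 1 then h k r else 0)"

text \<open>Building polynomials by multiplication with variables is the form of induction that fits
  the Leibniz rule. Monomials are reached by induction on the total degree.\<close>

lemma fock_induct [case_names scalar add var]:
  assumes "\<And>c. P (Poly_Mapping.single 0 c)" "\<And>p q. P p \<Longrightarrow> P q \<Longrightarrow> P (p + q)"
    "\<And>x p. P p \<Longrightarrow> P (fock_var x * p)"
  shows "P (p :: 'a fock)"
proof -
  have s: "P (Poly_Mapping.single m a)" for m :: "('a \<times> nat) \<Rightarrow>\<^sub>0 nat" and a
  proof (induction "\<Sum>x\<in>Poly_Mapping.keys m. Poly_Mapping.lookup m x" arbitrary: m rule: less_induct)
    case less
    show ?case
    proof (cases "m = 0")
      case False
      then obtain x where x: "x \<in> Poly_Mapping.keys m" by (metis keys_eq_empty ex_in_conv)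
      define m' where "m' = m - Poly_Mapping.single x 1"
      have m: "m = Poly_Mapping.single x 1 + m'"
        using x by (intro poly_mapping_eqI) (auto simp: m'_def lookup_add lookup_minus lookup_single when_def in_keys_iff)
      have l: "Poly_Mapping.lookup m' y = Poly_Mapping.lookup m y - (if y = x then 1 else 0)" for y
        by (auto simp: m'_def lookup_minus lookup_single when_def)
      have "(\<Sum>y\<in>Poly_Mapping.keys m'. Poly_Mapping.lookup m' y) = (\<Sum>y\<in>Poly_Mapping.keys m. Poly_Mapping.lookup m' y)"
        by (rule sum.mono_neutral_left) (auto simp: in_keys_iff l)
      also have "\<dots> < (\<Sum>y\<in>Poly_Mapping.keys m. Poly_Mapping.lookup m y)"
        by (rule sum_strict_mono_ex1) (use x in \<open>auto simp: l in_keys_iff intro!: bexI[of _ x]\<close>)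
      finally have "P (Poly_Mapping.single m' a)" by (rule less)
      moreover have "Poly_Mapping.single m a = fock_var x * Poly_Mapping.single m' a"
        by (simp add: fock_var_def mult_single m)
      ultimately show ?thesis by (simp add: assms(3))
    qed (simp add: assms(1))
  qed
  have "P (\<Sum>m\<in>K. Poly_Mapping.single m (Poly_Mapping.lookup p m))" for K
  proof (induction K rule: infinite_finite_induct)
    case (infinite K)
    then show ?case using assms(1)[of 0] by simp
  next
    case empty
    then show ?case using assms(1)[of 0] by simp
  qed (simp add: s assms(2))
  then show ?thesis by (metis fock_sum_singles)
qed

lemma fock_deriv_commute: "fock_deriv c (fock_deriv c' p) = fock_deriv c' (fock_deriv c p)"
  by (induction p rule: fock_induct)
    (simp_all add: fock_deriv_scalar fock_deriv_zero fock_deriv_add fock_deriv_mult fock_deriv_var algebra_simps)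

lemma commuting_cre: "commuting (\<lambda>r p. cre g r * p)"
  by (simp add: commuting_def fock_linear_mult mult.left_commute)

lemma commuting_ann: "commuting (ann h)"
  by (simp add: commuting_def fock_linear_deriv ann_def fock_deriv_commute)

lemma fock_linear_ann: "fock_linear (ann h r)"
  by (simp add: fock_linear_deriv ann_def)

lemma ann_mult: "ann h r (p * q) = ann h r p * q + p * ann h r q"
  by (simp add: ann_def fock_deriv_mult)

lemma ann_scalar: "ann h r (Poly_Mapping.single 0 c) = 0"
  by (simp add: ann_def fock_deriv_scalar)

text \<open>The Heisenberg relation: annihilation and creation operators commute up to a scalar, and
  only modes of equal degree pair.\<close>

lemma ann_cre:
  assumes "s \<ge> 1"
  shows "ann h r (cre g s) = Poly_Mapping.single 0 (if r = s then \<Sum>k\<in>UNIV. g k s * h k s else 0)"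
proof -
  have "ann h r (cre g s) = (\<Sum>k\<in>UNIV. Poly_Mapping.single 0 (if r = s then g k s * h k s else 0))"
    using assms unfolding cre_def fock_linearD(4)[OF fock_linear_ann] fock_linearD(2)[OF fock_linear_ann]
    by (intro sum.cong) (auto simp: ann_def fock_deriv_var fock_scale_def mult_single)
  also have "\<dots> = Poly_Mapping.single 0 (\<Sum>k\<in>UNIV. if r = s then g k s * h k s else 0)"
  proof -
    have "(\<Sum>k\<in>A. Poly_Mapping.single 0 (f k)) = Poly_Mapping.single 0 (\<Sum>k\<in>A. f k)" for f :: "'a \<Rightarrow> qfield" and A
      by (induction A rule: infinite_finite_induct) (auto simp: single_add)
    then show ?thesis .
  qed
  finally show ?thesis by simp
qed

definition ann_exp :: "('n::finite \<Rightarrow> nat \<Rightarrow> qfield) \<Rightarrow> nat \<Rightarrow> 'n fock \<Rightarrow> 'n fock" where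
  "ann_exp h = op_exp_coeff (ann h)"

text \<open>An integer index with value 0 below zero allows shifts such as k - r without case
  distinctions.\<close>

definition cre_exp :: "('n::finite \<Rightarrow> nat \<Rightarrow> qfield) \<Rightarrow> int \<Rightarrow> 'n fock" where
  "cre_exp g k = (if k < 0 then 0 else op_exp_coeff (\<lambda>r p. cre g r * p) (nat k) 1)"

lemma op_exp_coeff_cre: "op_exp_coeff (\<lambda>r p. cre g r * p) k p = cre_exp g (int k) * p"
proof -
  have "fock_linear (\<lambda>q. q * p)"
    by (simp add: fock_linear_def fock_scale_mult distrib_right)
  from op_exp_coeff_commute[of "\<lambda>q. q * p" "\<lambda>r p. cre g r * p", OF _ this, of k 1] show ?thesis
    by (simp add: cre_exp_def mult.assoc)
qed

lemma fock_linear_ann_exp: "fock_linear (ann_exp h l)"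
  unfolding ann_exp_def by (intro op_exp_coeff_linear fock_linear_ann)

lemma ann_exp_rec: "fock_scale (of_nat k) (ann_exp h k p) = (\<Sum>r=1..k. fock_scale (of_nat r) (ann h r (ann_exp h (k - r) p)))"
  unfolding ann_exp_def by (rule op_exp_coeff_rec[OF commuting_ann])

lemma ann_exp_0 [simp]: "ann_exp h 0 p = p"
  by (simp add: ann_exp_def)

lemma ann_exp_scalar: "ann_exp h k (Poly_Mapping.single 0 c) = (if k = 0 then Poly_Mapping.single 0 c else 0)"
  unfolding ann_exp_def
proof (rule op_exp_coeff_unique[OF commuting_ann, symmetric])
  fix k
  have "ann h r (if k - r = 0 then Poly_Mapping.single 0 c else 0) = 0" for r
    by (simp add: ann_scalar fock_linearD(3)[OF fock_linear_ann])
  then show "fock_scale (of_nat k) (if k = 0 then Poly_Mapping.single 0 c else 0) =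
    (\<Sum>r=1..k. fock_scale (of_nat r) (ann h r (if k - r = 0 then Poly_Mapping.single 0 c else 0)))"
    by simp
qed simp

text \<open>The exponential of a derivation is multiplicative. It translates the variable of degree
  \<open>Suc s\<close> by the scalar \<open>h j (Suc s)\<close> times that power of the formal
  variable.\<close>

lemma ann_exp_var:
  fixes h :: "'n::finite \<Rightarrow> nat \<Rightarrow> qfield"
  shows "ann_exp h l (fock_var (j, s) * p) =
    fock_var (j, s) * ann_exp h l p + (if Suc s \<le> l then fock_scale (h j (Suc s)) (ann_exp h (l - Suc s) p) else 0)"
  unfolding ann_exp_def
proof (rule op_exp_coeff_unique[OF commuting_ann, symmetric], fold ann_exp_def)
  fix k
  let ?v = "fock_var (j, s)" and ?B = "\<lambda>k. ann_exp h k p" and ?x = "h j (Suc s)"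
  let ?F = "\<lambda>k. ?v * ?B k + (if Suc s \<le> k then fock_scale ?x (?B (k - Suc s)) else 0)"
  have v: "ann h r ?v = (if r = Suc s then Poly_Mapping.single 0 ?x else 0)" for r
    by (simp add: ann_def fock_deriv_var)
  note lin = fock_linearD[OF fock_linear_ann]
  \<comment> \<open>The derivation hits the remaining polynomial, the variable itself, or the
    translated term.\<close>
  have "(\<Sum>r=1..k. fock_scale (of_nat r) (ann h r (?F (k - r)))) =
     (\<Sum>r=1..k. ?v * fock_scale (of_nat r) (ann h r (?B (k - r)))) +
     (\<Sum>r=1..k. if r = Suc s then fock_scale (of_nat (Suc s) * ?x) (?B (k - Suc s)) else 0) +
     (\<Sum>r=1..k. if Suc s \<le> k - r then fock_scale (of_nat r) (fock_scale ?x (ann h r (?B (k - Suc s - r)))) else 0)"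
    unfolding sum.distrib[symmetric]
  proof (rule sum.cong)
    fix r
    have S: "Poly_Mapping.single 0 ?x * q = fock_scale ?x q" for q by (simp add: fock_scale_def)
    have d: "k - r - Suc s = k - Suc s - r" by simp
    show "fock_scale (of_nat r) (ann h r (?F (k - r))) = ?v * fock_scale (of_nat r) (ann h r (?B (k - r))) +
       (if r = Suc s then fock_scale (of_nat (Suc s) * ?x) (?B (k - Suc s)) else 0) +
       (if Suc s \<le> k - r then fock_scale (of_nat r) (fock_scale ?x (ann h r (?B (k - Suc s - r)))) else 0)"
      by (cases "r = Suc s") (simp_all add: lin ann_mult v S d fock_scale_mult fock.scale_right_distrib add_ac del: of_nat_Suc)
  qed simp
  also have "(\<Sum>r=1..k. ?v * fock_scale (of_nat r) (ann h r (?B (k - r)))) = ?v * fock_scale (of_nat k) (?B k)"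
    by (simp only: ann_exp_rec sum_distrib_left)
  also have "(\<Sum>r=1..k. if r = Suc s then fock_scale (of_nat (Suc s) * ?x) (?B (k - Suc s)) else 0) =
     (if Suc s \<le> k then fock_scale (of_nat (Suc s) * ?x) (?B (k - Suc s)) else 0)"
    by (simp del: of_nat_Suc)
  also have "(\<Sum>r=1..k. if Suc s \<le> k - r then fock_scale (of_nat r) (fock_scale ?x (ann h r (?B (k - Suc s - r)))) else 0) =
    (\<Sum>r=1..k - Suc s. fock_scale ?x (fock_scale (of_nat r) (ann h r (?B (k - Suc s - r)))))"
    by (rule sum.mono_neutral_cong_right) (auto simp: mult.commute)
  also have "\<dots> = fock_scale ?x (fock_scale (of_nat (k - Suc s)) (?B (k - Suc s)))"
    by (simp only: ann_exp_rec[of "k - Suc s"] fock.scale_sum_right)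
  finally have *: "(\<Sum>r=1..k. fock_scale (of_nat r) (ann h r (?F (k - r)))) =
    ?v * fock_scale (of_nat k) (?B k) + (if Suc s \<le> k then fock_scale (of_nat (Suc s) * ?x) (?B (k - Suc s)) else 0) +
    fock_scale ?x (fock_scale (of_nat (k - Suc s)) (?B (k - Suc s)))" .
  show "fock_scale (of_nat k) (?F k) = (\<Sum>r=1..k. fock_scale (of_nat r) (ann h r (?F (k - r))))"
  proof (cases "Suc s \<le> k")
    case True
    have "of_nat k * ?x = of_nat (Suc s) * ?x + ?x * of_nat (k - Suc s)"
    proof -
      have "(of_nat k :: qfield) = of_nat (Suc s) + of_nat (k - Suc s)" using True by (simp flip: of_nat_add)
      then show ?thesis by (simp only: distrib_right mult.commute[of ?x])
    qed
    then have "fock_scale (of_nat k * ?x) q = fock_scale (of_nat (Suc s) * ?x) q + fock_scale (?x * of_nat (k - Suc s)) q"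
      for q :: "'n fock" by (simp only: fock.scale_left_distrib)
    then show ?thesis unfolding * using True
      by (simp add: fock_scale_mult fock.scale_right_distrib add.assoc del: of_nat_Suc of_nat_diff)
  next
    case False
    then show ?thesis unfolding * by (simp add: fock_scale_mult)
  qed
qed simp

text \<open>Only finitely many variables occur in a polynomial, and translating each of them
  contributes a bounded degree. This makes every mode of a vertex operator a finite sum.\<close>

lemma ann_exp_nilpotent: "\<exists>D. \<forall>l>D. ann_exp h l p = 0"
proof (induction p rule: fock_induct)
  case (scalar c)
  then show ?case by (auto simp: ann_exp_scalar)
next
  case (add p q)
  then obtain D D' where "\<forall>l>D. ann_exp h l p = 0" "\<forall>l>D'. ann_exp h l q = 0" by blast
  then show ?case by (intro exI[of _ "max D D'"]) (simp add: fock_linearD[OF fock_linear_ann_exp])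
next
  case (var x p)
  obtain D where D: "\<forall>l>D. ann_exp h l p = 0" using var by blast
  obtain j s where "x = (j, s)" by fastforce
  then show ?case using D by (intro exI[of _ "D + Suc s"]) (simp add: ann_exp_var)
qed

lemma cre_exp_neg: "k < 0 \<Longrightarrow> cre_exp g k = 0"
  by (simp add: cre_exp_def)

lemma cre_exp_0 [simp]: "cre_exp g 0 = 1"
  by (simp add: cre_exp_def)

text \<open>The upper limit is left open so that the recursions for k and k - r can be written over
  the same range.\<close>

lemma cre_exp_rec:
  assumes "nat k \<le> S"
  shows "fock_scale (of_int k) (cre_exp g k) = (\<Sum>s=1..S. fock_scale (of_nat s) (cre g s * cre_exp g (k - int s)))"
proof (cases "k < 0")
  case False
  define n where "n = nat k"
  have k: "k = int n" using False by (simp add: n_def)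
  have "fock_scale (of_int k) (cre_exp g k) = fock_scale (of_nat n) (op_exp_coeff (\<lambda>r p. cre g r * p) n 1)"
    by (simp add: k op_exp_coeff_cre)
  also have "\<dots> = (\<Sum>s=1..n. fock_scale (of_nat s) (cre g s * cre_exp g (int n - int s)))"
    unfolding op_exp_coeff_rec[OF commuting_cre] by (intro sum.cong) (auto simp: op_exp_coeff_cre of_nat_diff)
  also have "\<dots> = (\<Sum>s=1..S. fock_scale (of_nat s) (cre g s * cre_exp g (int n - int s)))"
    by (rule sum.mono_neutral_left) (use assms k in \<open>auto simp: cre_exp_neg\<close>)
  finally show ?thesis by (simp add: k)
qed (simp add: cre_exp_neg)

text \<open>The derivation sends the exponent to the scalar \<kappa> r in degree r, hence multiplies
  the exponential by it. On coefficients this is an induction along the recursion of the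
  exponential, with a division by k in characteristic 0.\<close>

lemma ann_cre_exp:
  assumes \<kappa>: "\<And>s. s \<ge> 1 \<Longrightarrow> (\<Sum>k\<in>UNIV. g k s * h k s) = \<kappa> s" and r: "r \<ge> 1"
  shows "ann h r (cre_exp g k) = fock_scale (\<kappa> r) (cre_exp g (k - int r))"
proof (induction "nat k" arbitrary: k rule: less_induct)
  case less
  note lin = fock_linearD[OF fock_linear_ann]
  consider "k < 0" | "k = 0" | "k > 0" by linarith
  then show ?case
  proof cases
    case 1
    then show ?thesis by (simp add: cre_exp_neg lin)
  next
    case 2
    then show ?thesis using r ann_scalar[of h r 1] by (simp add: cre_exp_neg)
  next
    case 3
    define n where "n = nat k"
    have k: "k = int n" using 3 by (simp add: n_def)
    have "fock_scale (of_int k) (ann h r (cre_exp g k)) =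
      (\<Sum>s=1..n. fock_scale (of_nat s) (ann h r (cre g s * cre_exp g (k - int s))))"
      unfolding lin(2)[symmetric] by (subst cre_exp_rec[of k n]) (simp_all add: n_def lin)
    also have "\<dots> = (\<Sum>s=1..n. (if s = r then fock_scale (of_nat r * \<kappa> r) (cre_exp g (k - int r)) else 0) +
       fock_scale (\<kappa> r) (fock_scale (of_nat s) (cre g s * cre_exp g (k - int r - int s))))"
    proof (rule sum.cong)
      fix s assume s: "s \<in> {1..n}"
      then have *: "ann h r (cre_exp g (k - int s)) = fock_scale (\<kappa> r) (cre_exp g (k - int s - int r))"
        by (intro less) (auto simp: k)
      have e: "ann h r (cre g s * cre_exp g (k - int s)) = ann h r (cre g s) * cre_exp g (k - int s) +
          cre g s * fock_scale (\<kappa> r) (cre_exp g (k - int s - int r))"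
        by (simp only: ann_mult *)
      have "ann h r (cre g s) * q = (if s = r then fock_scale (\<kappa> r) q else 0)" for q
        using s by (simp add: ann_cre \<kappa> fock_scale_def)
      then show "fock_scale (of_nat s) (ann h r (cre g s * cre_exp g (k - int s))) =
         (if s = r then fock_scale (of_nat r * \<kappa> r) (cre_exp g (k - int r)) else 0) +
         fock_scale (\<kappa> r) (fock_scale (of_nat s) (cre g s * cre_exp g (k - int r - int s)))"
        unfolding e by (auto simp: fock_scale_mult fock.scale_right_distrib mult.commute[of "\<kappa> r"] diff_diff_eq add.commute)
    qed simp
    also have "\<dots> = fock_scale (of_nat r * \<kappa> r) (cre_exp g (k - int r)) +
       fock_scale (\<kappa> r) (\<Sum>s=1..n. fock_scale (of_nat s) (cre g s * cre_exp g (k - int r - int s)))"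
      unfolding sum.distrib fock.scale_sum_right using r by (auto simp: k cre_exp_neg)
    also have "\<dots> = fock_scale (of_nat r * \<kappa> r) (cre_exp g (k - int r)) +
       fock_scale (\<kappa> r) (fock_scale (of_int (k - int r)) (cre_exp g (k - int r)))"
      by (subst cre_exp_rec[of "k - int r" n]) (simp_all add: k)
    also have "\<dots> = fock_scale (of_int k) (fock_scale (\<kappa> r) (cre_exp g (k - int r)))"
    proof -
      have "of_nat r * \<kappa> r + \<kappa> r * of_int (k - int r) = of_int k * \<kappa> r" by (simp add: algebra_simps)
      then show ?thesis by (simp only: fock.scale_scale fock.scale_left_distrib[symmetric])
    qed
    finally have "fock_scale (of_int k) (ann h r (cre_exp g k)) = fock_scale (of_int k) (fock_scale (\<kappa> r) (cre_exp g (k - int r)))" .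
    moreover have "(of_int k :: qfield) \<noteq> 0" using 3 by simp
    ultimately show ?thesis by (metis fock.scale_left_imp_eq)
  qed
qed

section \<open>Contraction of an annihilation with a creation exponential\<close>

definition contr :: "qfield \<Rightarrow> qfield \<Rightarrow> nat \<Rightarrow> qfield" where
  "contr u u' j = (if j = 0 then 1 else u ^ (j - 1) * (u - u'))"

lemma contr_Suc: "contr u u' (Suc j) = u * contr u u' j - (if j = 0 then u' else 0)"
  by (cases j) (simp_all add: contr_def algebra_simps)

text \<open>The coefficients of \<open>(1 - u' \<zeta>) / (1 - u \<zeta>)\<close>, whose logarithmic derivative is
  \<open>\<Sum>\<^sub>r (u\<^sup>r - u'\<^sup>r) \<zeta>\<^sup>r\<^sup>-\<^sup>1\<close>.\<close>

lemma contr_rec: "of_nat j * contr u u' j = (\<Sum>r=1..j. (u ^ r - u' ^ r) * contr u u' (j - r))"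
proof (induction j)
  case (Suc j)
  have "(\<Sum>r=1..Suc j. (u ^ r - u' ^ r) * contr u u' (Suc j - r)) =
    (\<Sum>r=1..j. (u ^ r - u' ^ r) * (u * contr u u' (j - r) - (if r = j then u' else 0))) + (u ^ Suc j - u' ^ Suc j)"
    by (simp add: contr_def[of _ _ 0]) (intro sum.cong, auto simp: Suc_diff_le contr_Suc)
  also have "(\<Sum>r=1..j. (u ^ r - u' ^ r) * (u * contr u u' (j - r) - (if r = j then u' else 0))) =
     u * (\<Sum>r=1..j. (u ^ r - u' ^ r) * contr u u' (j - r)) - (\<Sum>r=1..j. if r = j then (u ^ j - u' ^ j) * u' else 0)"
    unfolding sum_distrib_left sum_subtractf[symmetric] by (intro sum.cong) (auto simp: algebra_simps)
  also have "\<dots> = u * (of_nat j * contr u u' j) - (u ^ j - u' ^ j) * u'"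
    unfolding Suc[symmetric] by (cases j) auto
  finally show ?case by (cases j) (simp_all add: contr_def algebra_simps)
qed simp

text \<open>Exchanging the exponentials produces the scalar series exp(sum over r of (u^r - u'^r)
  t^r / r) = (1 - u' t) / (1 - u t), whose coefficients are \<open>contr u u'\<close>.\<close>

lemma ann_exp_cre_exp:
  fixes g h :: "'n::finite \<Rightarrow> nat \<Rightarrow> qfield"
  assumes \<kappa>: "\<forall>r\<ge>1. (\<Sum>k\<in>UNIV. g k r * h k r) = (u ^ r - u' ^ r) / of_nat r"
  shows "ann_exp h l (cre_exp g k * p) = (\<Sum>i\<le>l. fock_scale (contr u u' i) (cre_exp g (k - int i) * ann_exp h (l - i) p))"
  unfolding ann_exp_def
proof (rule op_exp_coeff_unique[OF commuting_ann, symmetric], fold ann_exp_def)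
  note lin = fock_linearD[OF fock_linear_ann]
  let ?a = "\<lambda>i. cre_exp g (k - int i)" and ?B = "\<lambda>l. ann_exp h l p" and ?c = "contr u u'"
  fix l
  have ann: "of_nat r * (\<Sum>k\<in>UNIV. g k r * h k r) = u ^ r - u' ^ r" if "r \<ge> 1" for r
    using that by (simp add: \<kappa>)
  have A: "fock_scale (of_nat r) (ann h r (?a i * q)) =
      fock_scale (u ^ r - u' ^ r) (?a (i + r) * q) + ?a i * fock_scale (of_nat r) (ann h r q)" if "r \<ge> 1" for r i q
    using ann_cre_exp[of g h "\<lambda>s. \<Sum>k\<in>UNIV. g k s * h k s" r "k - int i"] that ann[OF that]
    by (simp add: ann_mult fock_scale_mult fock.scale_right_distrib diff_diff_eq)
  have "(\<Sum>r=1..l. fock_scale (of_nat r) (ann h r (\<Sum>i\<le>l - r. fock_scale (?c i) (?a i * ?B (l - r - i))))) =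
    (\<Sum>r=1..l. \<Sum>i\<le>l - r. fock_scale ((u ^ r - u' ^ r) * ?c i) (?a (i + r) * ?B (l - r - i))) +
    (\<Sum>r=1..l. \<Sum>i\<le>l - r. fock_scale (?c i) (?a i * fock_scale (of_nat r) (ann h r (?B (l - r - i)))))"
    unfolding sum.distrib[symmetric]
  proof (rule sum.cong)
    fix r assume "r \<in> {1..l}"
    then have r: "r \<ge> 1" by simp
    show "fock_scale (of_nat r) (ann h r (\<Sum>i\<le>l - r. fock_scale (?c i) (?a i * ?B (l - r - i)))) =
      (\<Sum>i\<le>l - r. fock_scale ((u ^ r - u' ^ r) * ?c i) (?a (i + r) * ?B (l - r - i)) +
        fock_scale (?c i) (?a i * fock_scale (of_nat r) (ann h r (?B (l - r - i)))))"
      unfolding lin fock.scale_sum_right fock.scale_left_commute[of "of_nat r"] A[OF r]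
      by (simp only: fock.scale_right_distrib fock.scale_scale mult.commute)
  qed simp
  also have "(\<Sum>r=1..l. \<Sum>i\<le>l - r. fock_scale ((u ^ r - u' ^ r) * ?c i) (?a (i + r) * ?B (l - r - i))) =
     (\<Sum>j\<le>l. fock_scale (of_nat j * ?c j) (?a j * ?B (l - j)))"
    unfolding triangle_sum_diag contr_rec fock.scale_sum_left by (intro sum.cong) auto
  also have "(\<Sum>r=1..l. \<Sum>i\<le>l - r. fock_scale (?c i) (?a i * fock_scale (of_nat r) (ann h r (?B (l - r - i))))) =
     (\<Sum>i\<le>l. fock_scale (?c i) (?a i * fock_scale (of_nat (l - i)) (?B (l - i))))"
    unfolding triangle_sum_swap ann_exp_rec fock.scale_sum_right sum_distrib_left
    by (intro sum.cong) (auto simp: add.commute)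
  also have "(\<Sum>j\<le>l. fock_scale (of_nat j * ?c j) (?a j * ?B (l - j))) +
     (\<Sum>i\<le>l. fock_scale (?c i) (?a i * fock_scale (of_nat (l - i)) (?B (l - i)))) =
     fock_scale (of_nat l) (\<Sum>i\<le>l. fock_scale (?c i) (?a i * ?B (l - i)))"
    unfolding fock.scale_sum_right sum.distrib[symmetric]
  proof (rule sum.cong)
    fix i assume "i \<in> {..l}"
    then have "(of_nat l :: qfield) = of_nat i + of_nat (l - i)" by (simp flip: of_nat_add)
    then have "of_nat i * ?c i + ?c i * of_nat (l - i) = of_nat l * ?c i" by (simp only: distrib_right mult.commute[of "?c i"])
    then show "fock_scale (of_nat i * ?c i) (?a i * ?B (l - i)) + fock_scale (?c i) (?a i * fock_scale (of_nat (l - i)) (?B (l - i))) =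
      fock_scale (of_nat l) (fock_scale (?c i) (?a i * ?B (l - i)))"
      by (simp only: fock_scale_mult fock.scale_scale fock.scale_left_distrib[symmetric])
  qed simp
  finally show "fock_scale (of_nat l) (\<Sum>i\<le>l. fock_scale (?c i) (?a i * ?B (l - i))) =
    (\<Sum>r=1..l. fock_scale (of_nat r) (ann h r (\<Sum>i\<le>l - r. fock_scale (?c i) (?a i * ?B (l - r - i)))))" ..
qed (simp add: contr_def)

text \<open>The value at l = 0 must be 0; truncated subtraction would give the identity
  there.\<close>

definition ann_exp_prev :: "('n::finite \<Rightarrow> nat \<Rightarrow> qfield) \<Rightarrow> nat \<Rightarrow> 'n fock \<Rightarrow> 'n fock" where
  "ann_exp_prev h l p = (if l = 0 then 0 else ann_exp h (l - 1) p)"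

text \<open>Multiplying the contraction by its denominator 1 - u t leaves the polynomial 1 - u' t;
  this clears the pole of a product of vertex operators.\<close>

lemma ann_exp_cre_exp_pole:
  fixes g h :: "'n::finite \<Rightarrow> nat \<Rightarrow> qfield"
  assumes \<kappa>: "\<forall>r\<ge>1. (\<Sum>k\<in>UNIV. g k r * h k r) = (u ^ r - u' ^ r) / of_nat r"
  shows "ann_exp h l (cre_exp g k * p) - fock_scale u (ann_exp_prev h l (cre_exp g (k - 1) * p)) =
    cre_exp g k * ann_exp h l p - fock_scale u' (cre_exp g (k - 1) * ann_exp_prev h l p)"
proof (cases l)
  case (Suc l')
  have "ann_exp h l (cre_exp g k * p) = cre_exp g k * ann_exp h l p +
    (\<Sum>i\<le>l'. fock_scale (contr u u' (Suc i)) (cre_exp g (k - 1 - int i) * ann_exp h (l' - i) p))"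
  proof -
    have "k - int (Suc i) = k - 1 - int i" for i by simp
    moreover have "contr u u' 0 = 1" by (simp add: contr_def)
    ultimately show ?thesis
      unfolding Suc ann_exp_cre_exp[OF \<kappa>, of "Suc l'" k p] sum.atMost_Suc_shift
      by (simp only: diff_Suc_Suc diff_zero of_nat_0 fock.scale_one)
  qed
  also have "(\<Sum>i\<le>l'. fock_scale (contr u u' (Suc i)) (cre_exp g (k - 1 - int i) * ann_exp h (l' - i) p)) =
    fock_scale u (\<Sum>i\<le>l'. fock_scale (contr u u' i) (cre_exp g (k - 1 - int i) * ann_exp h (l' - i) p)) -
    (\<Sum>i\<le>l'. if i = 0 then fock_scale u' (cre_exp g (k - 1) * ann_exp h l' p) else 0)"
    unfolding fock.scale_sum_right sum_subtractf[symmetric]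
    by (intro sum.cong) (auto simp: contr_Suc fock.scale_left_diff_distrib)
  finally show ?thesis by (simp add: Suc ann_exp_prev_def ann_exp_cre_exp[OF \<kappa>, of _ "k - 1"])
qed (simp add: ann_exp_prev_def)

section \<open>Modes of vertex operators\<close>

text \<open>Coefficient at z^x of a vertex operator on the Fock space: annihilation of degree l
  lowers the power of z by l, so creation enters in degree x + l.\<close>

definition mode :: "('n::finite \<Rightarrow> nat \<Rightarrow> qfield) \<Rightarrow> ('n \<Rightarrow> nat \<Rightarrow> qfield) \<Rightarrow> int \<Rightarrow> 'n fock \<Rightarrow> 'n fock" where
  "mode g h x p = Sum_any (\<lambda>l. cre_exp g (x + int l) * ann_exp h l p)"

lemma mode_eq:
  assumes "\<forall>l>D. ann_exp h l p = 0"
  shows "mode g h x p = (\<Sum>l\<le>D. cre_exp g (x + int l) * ann_exp h l p)"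
  unfolding mode_def by (rule Sum_any.expand_superset) (use assms in \<open>auto simp: not_less[symmetric]\<close>)

text \<open>Writing the mode at x + 1 over the same index as the one at x lets the pole identity be
  applied term by term.\<close>

lemma mode_shift_eq:
  assumes "\<forall>l>D. ann_exp h l p = 0"
  shows "mode g h (x + 1) p = (\<Sum>l\<le>Suc D. cre_exp g (x + int l) * ann_exp_prev h l p)"
  unfolding mode_eq[OF assms] sum.atMost_Suc_shift by (simp add: ann_exp_prev_def add_ac)

lemma ann_exp_bound_finite:
  assumes "finite P"
  shows "\<exists>D. \<forall>p\<in>P. \<forall>l>D. ann_exp h l p = 0"
  using assms
proof induction
  case (insert p P)
  obtain D D' where "\<forall>p\<in>P. \<forall>l>D. ann_exp h l p = 0" "\<forall>l>D'. ann_exp h l p = 0"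
    using insert ann_exp_nilpotent[of h p] by blast
  then show ?case by (intro exI[of _ "max D D'"]) auto
qed simp

lemma fock_linear_mode: "fock_linear (mode g h x)"
  unfolding fock_linear_def
proof (intro conjI allI)
  fix p q :: "'a fock" and c
  note lin = fock_linearD[OF fock_linear_ann_exp]
  obtain D where D: "\<forall>p\<in>{p, q, p + q, fock_scale c p}. \<forall>l>D. ann_exp h l p = 0"
    using ann_exp_bound_finite[of "{p, q, p + q, fock_scale c p}" h] by auto
  then show "mode g h x (p + q) = mode g h x p + mode g h x q"
    by (simp add: mode_eq[of D] lin distrib_left sum.distrib)
  show "mode g h x (fock_scale c p) = fock_scale c (mode g h x p)"
    using D by (simp add: mode_eq[of D] lin fock_scale_mult fock.scale_sum_right)
qed

lemma mode_vanish:
  assumes "\<forall>l>D. ann_exp h l p = 0" "x < - int D"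
  shows "mode g h x p = 0"
  unfolding mode_eq[OF assms(1)] by (intro sum.neutral) (use assms in \<open>auto simp: cre_exp_neg\<close>)

lemma mode_cre_exp_pole:
  fixes g1 h1 g2 :: "'n::finite \<Rightarrow> nat \<Rightarrow> qfield"
  assumes \<kappa>: "\<forall>r\<ge>1. (\<Sum>k\<in>UNIV. g2 k r * h1 k r) = (u ^ r - u' ^ r) / of_nat r"
  shows "mode g1 h1 x (cre_exp g2 k * p) - fock_scale u (mode g1 h1 (x + 1) (cre_exp g2 (k - 1) * p)) =
    cre_exp g2 k * mode g1 h1 x p - fock_scale u' (cre_exp g2 (k - 1) * mode g1 h1 (x + 1) p)"
proof -
  obtain D where D: "\<forall>p\<in>{cre_exp g2 k * p, cre_exp g2 (k - 1) * p, p}. \<forall>l>D. ann_exp h1 l p = 0"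
    using ann_exp_bound_finite[of "{cre_exp g2 k * p, cre_exp g2 (k - 1) * p, p}" h1] by auto
  then have D1: "\<forall>l>D. ann_exp h1 l (cre_exp g2 (k - 1) * p) = 0" "\<forall>l>D. ann_exp h1 l p = 0"
    and D2: "\<forall>l>Suc D. ann_exp h1 l (cre_exp g2 k * p) = 0" "\<forall>l>Suc D. ann_exp h1 l p = 0" by simp_all
  have "mode g1 h1 x (cre_exp g2 k * p) - fock_scale u (mode g1 h1 (x + 1) (cre_exp g2 (k - 1) * p)) =
    (\<Sum>l\<le>Suc D. cre_exp g1 (x + int l) * (ann_exp h1 l (cre_exp g2 k * p) - fock_scale u (ann_exp_prev h1 l (cre_exp g2 (k - 1) * p))))"
    by (simp only: mode_eq[OF D2(1)] mode_shift_eq[OF D1(1)] right_diff_distrib sum_subtractf fock.scale_sum_right fock_scale_mult)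
  also have "\<dots> = (\<Sum>l\<le>Suc D. cre_exp g2 k * (cre_exp g1 (x + int l) * ann_exp h1 l p) -
      fock_scale u' (cre_exp g2 (k - 1) * (cre_exp g1 (x + int l) * ann_exp_prev h1 l p)))"
    by (simp only: ann_exp_cre_exp_pole[OF \<kappa>] right_diff_distrib fock_scale_mult mult.left_commute)
  also have "\<dots> = cre_exp g2 k * mode g1 h1 x p - fock_scale u' (cre_exp g2 (k - 1) * mode g1 h1 (x + 1) p)"
    by (simp only: mode_eq[OF D2(2), of g1 x] mode_shift_eq[OF D1(2)] sum_subtractf fock.scale_sum_right sum_distrib_left)
  finally show ?thesis .
qed

text \<open>The coefficient at \<open>z\<^sub>1\<^sup>x z\<^sub>2\<^sup>y\<close> of a normally ordered product.\<close>

definition normal_mode ::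
  "('n::finite \<Rightarrow> nat \<Rightarrow> qfield) \<Rightarrow> ('n \<Rightarrow> nat \<Rightarrow> qfield) \<Rightarrow> ('n \<Rightarrow> nat \<Rightarrow> qfield) \<Rightarrow> ('n \<Rightarrow> nat \<Rightarrow> qfield) \<Rightarrow>
   int \<Rightarrow> int \<Rightarrow> 'n fock \<Rightarrow> 'n fock" where
  "normal_mode g1 h1 g2 h2 x y p = Sum_any (\<lambda>l. cre_exp g2 (y + int l) * mode g1 h1 x (ann_exp h2 l p))"

lemma normal_mode_eq:
  assumes "\<forall>l>D. ann_exp h2 l p = 0"
  shows "normal_mode g1 h1 g2 h2 x y p = (\<Sum>l\<le>D. cre_exp g2 (y + int l) * mode g1 h1 x (ann_exp h2 l p))"
  unfolding normal_mode_def
  by (rule Sum_any.expand_superset)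
    (use assms in \<open>auto simp: not_less[symmetric] fock_linearD(3)[OF fock_linear_mode]\<close>)

text \<open>In generating functions, (1 - u z_2/z_1) times the product of the two operators equals
  (1 - u' z_2/z_1) times their normally ordered product.\<close>

lemma mode_mode_pole:
  fixes g1 h1 g2 h2 :: "'n::finite \<Rightarrow> nat \<Rightarrow> qfield"
  assumes \<kappa>: "\<forall>r\<ge>1. (\<Sum>k\<in>UNIV. g2 k r * h1 k r) = (u ^ r - u' ^ r) / of_nat r"
  shows "mode g1 h1 x (mode g2 h2 y p) - fock_scale u (mode g1 h1 (x + 1) (mode g2 h2 (y - 1) p)) =
    normal_mode g1 h1 g2 h2 x y p - fock_scale u' (normal_mode g1 h1 g2 h2 (x + 1) (y - 1) p)"
proof -
  obtain D where D: "\<forall>l>D. ann_exp h2 l p = 0" using ann_exp_nilpotent by blast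
  note lin = fock_linearD[OF fock_linear_mode]
  have i: "y - 1 + int l = y + int l - 1" for l by simp
  show ?thesis
    unfolding mode_eq[OF D] normal_mode_eq[OF D] lin fock.scale_sum_right sum_subtractf[symmetric] i
    by (intro sum.cong refl mode_cre_exp_pole[OF \<kappa>])
qed

text \<open>The inner exponential has only finitely many nonzero coefficients on p, so one bound
  serves all outer applications at once.\<close>

lemma normal_mode_bound:
  "\<exists>D. (\<forall>l>D. ann_exp h2 l p = 0) \<and> (\<forall>l l'. l > D \<longrightarrow> ann_exp h1 l (ann_exp h2 l' p) = 0)"
proof -
  obtain D where D: "\<forall>l>D. ann_exp h2 l p = 0" using ann_exp_nilpotent by blast
  obtain D' where D': "\<forall>q\<in>(\<lambda>l. ann_exp h2 l p) ` {..D}. \<forall>l>D'. ann_exp h1 l q = 0"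
    using ann_exp_bound_finite[of "(\<lambda>l. ann_exp h2 l p) ` {..D}" h1] by auto
  have "ann_exp h1 l (ann_exp h2 l' p) = 0" if "l > D'" for l l'
    using D D' that by (cases "l' \<le> D") (auto simp: fock_linearD(3)[OF fock_linear_ann_exp])
  then show ?thesis using D by (intro exI[of _ "max D D'"]) auto
qed

lemma normal_mode_vanish:
  assumes D: "\<forall>l>D. ann_exp h2 l p = 0" "\<forall>l l'. l > D \<longrightarrow> ann_exp h1 l (ann_exp h2 l' p) = 0"
    and "x < - int D \<or> y < - int D"
  shows "normal_mode g1 h1 g2 h2 x y p = 0"
  unfolding normal_mode_eq[OF D(1)]
proof (intro sum.neutral ballI)
  fix l assume "l \<in> {..D}"
  moreover have "mode g1 h1 x (ann_exp h2 l p) = 0" if "x < - int D"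
    by (rule mode_vanish[OF _ that]) (use D in auto)
  ultimately have "cre_exp g2 (y + int l) = 0 \<or> mode g1 h1 x (ann_exp h2 l p) = 0"
    using assms(3) by (auto simp: cre_exp_neg)
  then show "cre_exp g2 (y + int l) * mode g1 h1 x (ann_exp h2 l p) = 0" by auto
qed

lemma cre_exp_add:
  assumes "finite X" "{0..k} \<subseteq> X" "Q \<noteq> 0"
  shows "cre_exp (\<lambda>j r. Q ^ r * g1 j r + g2 j r) k = (\<Sum>x\<in>X. fock_scale (Q powi x) (cre_exp g1 x * cre_exp g2 (k - x)))"
proof (cases "k < 0")
  case True
  have "fock_scale (Q powi x) (cre_exp g1 x * cre_exp g2 (k - x)) = 0" for x
    using True by (cases "x < 0") (auto simp: cre_exp_neg)
  then show ?thesis by (simp only: sum.neutral_const cre_exp_neg[OF True])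
next
  case False
  define n where "n = nat k"
  have k: "k = int n" using False by (simp add: n_def)
  have lin: "fock_linear ((*) (cre g1 r))" for r by (rule fock_linear_mult)
  have c: "cre (\<lambda>j r. Q ^ r * g1 j r + g2 j r) r = fock_scale (Q ^ r) (cre g1 r) + cre g2 r" for r
    by (simp add: cre_def fock.scale_left_distrib sum.distrib fock.scale_sum_right)
  have cm: "commuting (\<lambda>r p. fock_scale (Q ^ r) (cre g1 r * p))"
    unfolding commuting_def
  proof (intro conjI allI)
    show "fock_linear (\<lambda>p. fock_scale (Q ^ r) (cre g1 r * p))" for r
      by (auto simp: fock_linear_def fock_scale_mult distrib_left distrib_right fock.scale_right_distrib mult_ac)
    show "fock_scale (Q ^ r) (cre g1 r * fock_scale (Q ^ s) (cre g1 s * p)) =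
      fock_scale (Q ^ s) (cre g1 s * fock_scale (Q ^ r) (cre g1 r * p))" for r s p
      by (simp add: fock_scale_mult mult_ac)
  qed
  have "cre_exp (\<lambda>j r. Q ^ r * g1 j r + g2 j r) k =
    op_exp_coeff (\<lambda>r p. fock_scale (Q ^ r) (cre g1 r * p) + cre g2 r * p) n 1"
    by (simp add: cre_exp_def k c) (rule op_exp_coeff_cong, simp add: distrib_right fock_scale_mult)
  also have "\<dots> = (\<Sum>i\<le>n. fock_scale (Q ^ i) (cre_exp g1 (int i) * cre_exp g2 (int (n - i))))"
    by (subst op_exp_coeff_add[OF cm commuting_cre])
      (simp_all add: fock_scale_mult mult.left_commute op_exp_coeff_scale[OF lin] op_exp_coeff_cre)
  also have "\<dots> = (\<Sum>x=0..k. fock_scale (Q powi x) (cre_exp g1 x * cre_exp g2 (k - x)))"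
    by (rule sum.reindex_bij_witness[of _ nat int]) (auto simp: k of_nat_diff)
  also have "\<dots> = (\<Sum>x\<in>X. fock_scale (Q powi x) (cre_exp g1 x * cre_exp g2 (k - x)))"
  proof (rule sum.mono_neutral_left)
    show "\<forall>i\<in>X - {0..k}. fock_scale (Q powi i) (cre_exp g1 i * cre_exp g2 (k - i)) = 0"
    proof
      fix i assume "i \<in> X - {0..k}"
      then have "cre_exp g1 i = 0 \<or> cre_exp g2 (k - i) = 0" by (auto simp: cre_exp_neg)
      then show "fock_scale (Q powi i) (cre_exp g1 i * cre_exp g2 (k - i)) = 0" by auto
    qed
  qed (use assms in auto)
  finally show ?thesis .
qed

lemma ann_exp_add:
  "ann_exp (\<lambda>j r. x ^ r * h1 j r + h2 j r) k p = (\<Sum>i\<le>k. fock_scale (x ^ i) (ann_exp h1 i (ann_exp h2 (k - i) p)))"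
proof -
  have c: "ann (\<lambda>j r. x ^ r * h1 j r + h2 j r) r p = fock_scale (x ^ r) (ann h1 r p) + ann h2 r p" for r and p :: "'a fock"
  proof (induction p rule: fock_induct)
    case (scalar c)
    then show ?case by (simp add: ann_scalar)
  next
    case (add p q)
    then show ?case by (simp add: fock_linearD[OF fock_linear_ann] fock.scale_right_distrib)
  next
    case (var y p)
    obtain j s where y: "y = (j, s)" by fastforce
    have v: "ann h r (fock_var y) = Poly_Mapping.single 0 (if r = Suc s then h j r else 0)" for h :: "'a \<Rightarrow> nat \<Rightarrow> qfield"
      by (simp add: ann_def fock_deriv_var y)
    have "fock_scale (x ^ r) (Poly_Mapping.single 0 c) = (Poly_Mapping.single 0 (x ^ r * c) :: 'a fock)" for c
      by (simp add: fock_scale_def mult_single)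
    then show ?case
      by (simp add: ann_mult var v fock.scale_right_distrib fock_scale_mult distrib_left distrib_right single_add
          flip: fock_scale_mult(1))
  qed
  have cm: "commuting (\<lambda>r p. fock_scale (x ^ r) (ann h1 r p))"
    using commuting_ann[of h1] by (auto simp: commuting_def fock_linear_def fock.scale_right_distrib mult.commute)
  have "ann_exp (\<lambda>j r. x ^ r * h1 j r + h2 j r) k p =
    op_exp_coeff (\<lambda>r p. fock_scale (x ^ r) (ann h1 r p) + ann h2 r p) k p"
    unfolding ann_exp_def by (rule op_exp_coeff_cong) (rule c)
  also have "\<dots> = (\<Sum>i\<le>k. fock_scale (x ^ i) (ann_exp h1 i (ann_exp h2 (k - i) p)))"
  proof -
    have "ann h1 r (ann h2 s q) = ann h2 s (ann h1 r q)" for r s q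
      by (simp add: ann_def fock_deriv_commute)
    then show ?thesis
      by (subst op_exp_coeff_add[OF cm commuting_ann])
        (simp_all add: op_exp_coeff_scale[OF fock_linear_ann] fock_linearD[OF fock_linear_ann] ann_exp_def)
  qed
  finally show ?thesis .
qed

text \<open>Setting z_1 = Q z_2 in a normally ordered product merges the exponentials. The
  annihilation part carries Q^(-r) since it involves z_1^(-r).\<close>

lemma
  assumes Q: "Q \<noteq> 0"
  shows normal_mode_diagonal: "Sum_any (\<lambda>x. fock_scale (Q powi x) (normal_mode g1 h1 g2 h2 x (m - x) p)) =
      mode (\<lambda>j r. Q ^ r * g1 j r + g2 j r) (\<lambda>j r. inverse Q ^ r * h1 j r + h2 j r) m p"
    and normal_mode_diagonal_finite: "finite {x. fock_scale (Q powi x) (normal_mode g1 h1 g2 h2 x (m - x) p) \<noteq> 0}"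
proof -
  obtain D where D: "\<forall>l>D. ann_exp h2 l p = 0" "\<forall>l l'. l > D \<longrightarrow> ann_exp h1 l (ann_exp h2 l' p) = 0"
    using normal_mode_bound by blast
  let ?X = "{- int D..m + int D}"
  let ?a12 = "cre_exp (\<lambda>j r. Q ^ r * g1 j r + g2 j r)"
  let ?B = "\<lambda>l1 l2. ann_exp h1 l1 (ann_exp h2 l2 p)"
  have sub: "{x. fock_scale (Q powi x) (normal_mode g1 h1 g2 h2 x (m - x) p) \<noteq> 0} \<subseteq> ?X"
  proof
    fix x assume "x \<in> {x. fock_scale (Q powi x) (normal_mode g1 h1 g2 h2 x (m - x) p) \<noteq> 0}"
    then have "\<not> (x < - int D \<or> m - x < - int D)"
      using normal_mode_vanish[OF D, of x "m - x" g1 g2] by auto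
    then show "x \<in> ?X" by auto
  qed
  then show "finite {x. fock_scale (Q powi x) (normal_mode g1 h1 g2 h2 x (m - x) p) \<noteq> 0}"
    by (rule finite_subset) simp
  \<comment> \<open>For fixed annihilation degrees the sum over x assembles one coefficient of the
    merged creation part; aligning the index by l1 costs the factor Q^(-l1).\<close>
  have inner: "(\<Sum>x\<in>?X. fock_scale (Q powi x) (cre_exp g1 (x + int l1) * cre_exp g2 (m - x + int l2))) =
      fock_scale (inverse Q ^ l1) (?a12 (m + int (l1 + l2)))" if "l1 \<le> D" "l2 \<le> D" for l1 l2
  proof -
    have "?a12 (m + int (l1 + l2)) = (\<Sum>x\<in>{int l1 - int D..m + int D + int l1}.
        fock_scale (Q powi x) (cre_exp g1 x * cre_exp g2 (m + int (l1 + l2) - x)))"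
      by (rule cre_exp_add) (use that Q in auto)
    also have "\<dots> = (\<Sum>x\<in>?X. fock_scale (Q powi (x + int l1)) (cre_exp g1 (x + int l1) * cre_exp g2 (m - x + int l2)))"
      by (rule sum.reindex_bij_witness[of _ "\<lambda>x. x + int l1" "\<lambda>x. x - int l1"]) (auto simp: algebra_simps)
    finally have "fock_scale (inverse Q ^ l1) (?a12 (m + int (l1 + l2))) =
      (\<Sum>x\<in>?X. fock_scale (inverse Q ^ l1 * Q powi (x + int l1)) (cre_exp g1 (x + int l1) * cre_exp g2 (m - x + int l2)))"
      by (simp only: fock.scale_sum_right fock.scale_scale)
    moreover have "inverse Q ^ l1 * Q powi (x + int l1) = Q powi x" for x
      using Q by (simp add: power_int_add power_inverse)
    ultimately show ?thesis by simp
  qed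
  have "Sum_any (\<lambda>x. fock_scale (Q powi x) (normal_mode g1 h1 g2 h2 x (m - x) p)) =
    (\<Sum>x\<in>?X. fock_scale (Q powi x) (normal_mode g1 h1 g2 h2 x (m - x) p))"
    by (rule Sum_any.expand_superset[OF _ sub]) simp
  also have "\<dots> = (\<Sum>x\<in>?X. \<Sum>l2\<le>D. \<Sum>l1\<le>D.
      fock_scale (Q powi x) (cre_exp g1 (x + int l1) * cre_exp g2 (m - x + int l2)) * ?B l1 l2)"
  proof (rule sum.cong)
    fix x
    have "mode g1 h1 x (ann_exp h2 l2 p) = (\<Sum>l1\<le>D. cre_exp g1 (x + int l1) * ?B l1 l2)" for l2
      by (rule mode_eq) (use D in auto)
    then show "fock_scale (Q powi x) (normal_mode g1 h1 g2 h2 x (m - x) p) =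
      (\<Sum>l2\<le>D. \<Sum>l1\<le>D. fock_scale (Q powi x) (cre_exp g1 (x + int l1) * cre_exp g2 (m - x + int l2)) * ?B l1 l2)"
      unfolding normal_mode_eq[OF D(1)]
      by (simp add: fock.scale_sum_right sum_distrib_left fock_scale_mult mult_ac)
  qed simp
  also have "\<dots> = (\<Sum>l2\<le>D. \<Sum>l1\<le>D. (\<Sum>x\<in>?X.
      fock_scale (Q powi x) (cre_exp g1 (x + int l1) * cre_exp g2 (m - x + int l2))) * ?B l1 l2)"
    by (subst sum.swap, intro sum.cong refl, subst sum.swap) (simp add: sum_distrib_right)
  also have "\<dots> = (\<Sum>l2\<le>D. \<Sum>l1\<le>D. ?a12 (m + int (l1 + l2)) * fock_scale (inverse Q ^ l1) (?B l1 l2))"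
    by (intro sum.cong refl) (simp add: inner fock_scale_mult)
  also have "\<dots> = (\<Sum>(l1, l2)\<in>{..D} \<times> {..D}. ?a12 (m + int (l1 + l2)) * fock_scale (inverse Q ^ l1) (?B l1 l2))"
    by (subst sum.swap) (simp add: sum.cartesian_product)
  \<comment> \<open>The square is enlarged to a triangle, whose terms can be collected by L = l1 +
    l2; the added terms vanish by the choice of D.\<close>
  also have "\<dots> = (\<Sum>(l1, l2)\<in>{(i, j). i + j \<le> 2 * D}. ?a12 (m + int (l1 + l2)) * fock_scale (inverse Q ^ l1) (?B l1 l2))"
  proof (rule sum.mono_neutral_left)
    show "finite {(i, j). i + j \<le> 2 * D}"
      by (rule finite_subset[of _ "{..2 * D} \<times> {..2 * D}"]) auto
    have *: "?B l1 l2 = 0" if "\<not> (l1 \<le> D \<and> l2 \<le> D)" for l1 l2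
      using that D by (cases "l1 \<le> D") (auto simp: fock_linearD(3)[OF fock_linear_ann_exp])
    show "\<forall>i\<in>{(i, j). i + j \<le> 2 * D} - {..D} \<times> {..D}.
        (case i of (l1, l2) \<Rightarrow> ?a12 (m + int (l1 + l2)) * fock_scale (inverse Q ^ l1) (?B l1 l2)) = 0"
    proof
      fix i assume i: "i \<in> {(i, j). i + j \<le> 2 * D} - {..D} \<times> {..D}"
      obtain l1 l2 where l: "i = (l1, l2)" by fastforce
      with i have "\<not> (l1 \<le> D \<and> l2 \<le> D)" by auto
      then show "(case i of (l1, l2) \<Rightarrow> ?a12 (m + int (l1 + l2)) * fock_scale (inverse Q ^ l1) (?B l1 l2)) = 0"
        by (simp add: l *)
    qed
  qed auto
  also have "\<dots> = (\<Sum>L\<le>2 * D. \<Sum>i\<le>L. ?a12 (m + int (i + (L - i))) * fock_scale (inverse Q ^ i) (?B i (L - i)))"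
    by (rule sum.triangle_reindex_eq)
  also have "\<dots> = (\<Sum>L\<le>2 * D. ?a12 (m + int L) * ann_exp (\<lambda>j r. inverse Q ^ r * h1 j r + h2 j r) L p)"
    unfolding ann_exp_add sum_distrib_left by (intro sum.cong) auto
  also have "\<dots> = mode (\<lambda>j r. Q ^ r * g1 j r + g2 j r) (\<lambda>j r. inverse Q ^ r * h1 j r + h2 j r) m p"
  proof (rule mode_eq[symmetric], intro allI impI)
    fix L assume L: "L > 2 * D"
    have "?B i (L - i) = 0" for i
      using L D by (cases "i \<le> D") (auto simp: fock_linearD(3)[OF fock_linear_ann_exp])
    then show "ann_exp (\<lambda>j r. inverse Q ^ r * h1 j r + h2 j r) L p = 0"
      unfolding ann_exp_add by simp
  qed
  finally show "Sum_any (\<lambda>x. fock_scale (Q powi x) (normal_mode g1 h1 g2 h2 x (m - x) p)) =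
      mode (\<lambda>j r. Q ^ r * g1 j r + g2 j r) (\<lambda>j r. inverse Q ^ r * h1 j r + h2 j r) m p" .
qed

section \<open>Operators in normal form\<close>

text \<open>The creation part is the exponential of \<open>\<Sum>\<^sub>k \<Sum>\<^sub>r g k r a\<^sub>k(-r) z\<^sup>r\<close>, and the annihilation part is that of
  \<open>\<Sum>\<^sub>r D\<^sub>r z\<^bsup>-r\<^esup>\<close>, where the derivation \<open>D\<^sub>r\<close> maps \<open>a\<^sub>k(-r)\<close> to the scalar \<open>h k r\<close>. Hence the contraction of two
  such operators only depends on the sums \<open>\<Sum>\<^sub>k g k r * h k r\<close>.\<close>

definition nf_op :: "int \<Rightarrow> ('n::finite \<Rightarrow> nat \<Rightarrow> qfield) \<Rightarrow> ('n \<Rightarrow> nat \<Rightarrow> qfield) \<Rightarrow> 'n weight \<Rightarrow>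
    ('n weight \<Rightarrow> qfield) \<Rightarrow> ('n weight \<Rightarrow> int) \<Rightarrow> 'n vop" where
  "nf_op N g h \<alpha> \<sigma> d = vertex_op N (\<lambda>r p. cre g r * p) (ann h) \<alpha> \<sigma> d"

text \<open>With z = u^N and initial exponent d \<beta>, only powers of u congruent to d \<beta>
  modulo N occur.\<close>

definition nf_coeff :: "int \<Rightarrow> ('n::finite \<Rightarrow> nat \<Rightarrow> qfield) \<Rightarrow> ('n \<Rightarrow> nat \<Rightarrow> qfield) \<Rightarrow>
    ('n weight \<Rightarrow> qfield) \<Rightarrow> ('n weight \<Rightarrow> int) \<Rightarrow> 'n weight \<Rightarrow> int \<Rightarrow> 'n fock \<Rightarrow> 'n fock" where
  "nf_coeff N g h \<sigma> d \<beta> m p =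
     (if N dvd m - d \<beta> then fock_scale (\<sigma> \<beta>) (mode g h ((m - d \<beta>) div N) p) else 0)"

lemma fock_linear_nf_coeff: "fock_linear (nf_coeff N g h \<sigma> d \<beta> m)"
  by (simp add: fock_linear_def nf_coeff_def fock_linearD[OF fock_linear_mode] fock.scale_right_distrib
      fock.scale_left_commute mult.commute)

lemma tensor_e_zero [simp]: "tensor_e 0 \<beta> = 0"
  by (simp add: tensor_e_def)

lemma tensor_e_sum: "tensor_e (sum f A) \<beta> = (\<Sum>x\<in>A. tensor_e (f x) \<beta>)"
  by (induction A rule: infinite_finite_induct) (auto simp: tensor_e_def single_add)

lemma lookup_tensor_sum:
  assumes "\<And>\<beta>. F \<beta> 0 = 0"
  shows "Poly_Mapping.lookup (\<Sum>\<beta>\<in>Poly_Mapping.keys v. tensor_e (F \<beta> (Poly_Mapping.lookup v \<beta>)) (\<beta> + \<alpha>)) (\<beta> + \<alpha>) =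
    F \<beta> (Poly_Mapping.lookup v \<beta>)"
  using assms by (auto simp: lookup_sum tensor_e_def lookup_single when_def in_keys_iff)

lemma nf_op_nth:
  assumes N: "N > 0"
  shows "nf_op N g h \<alpha> \<sigma> d v $$ m =
    (\<Sum>\<beta>\<in>Poly_Mapping.keys v. tensor_e (nf_coeff N g h \<sigma> d \<beta> m (Poly_Mapping.lookup v \<beta>)) (\<beta> + \<alpha>))"
proof -
  have *: "Sum_any (\<lambda>l. Sum_any (\<lambda>k. if N * (int k - int l) + d \<beta> = m
       then tensor_e (fock_scale (\<sigma> \<beta>) (op_exp_coeff (\<lambda>r p. cre g r * p) k (op_exp_coeff (ann h) l p))) (\<beta> + \<alpha>) else 0)) =
     tensor_e (nf_coeff N g h \<sigma> d \<beta> m p) (\<beta> + \<alpha>)" for \<beta> m p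
  proof -
    define x where "x = (m - d \<beta>) div N"
    have inner: "Sum_any (\<lambda>k. if N * (int k - int l) + d \<beta> = m
       then tensor_e (fock_scale (\<sigma> \<beta>) (op_exp_coeff (\<lambda>r p. cre g r * p) k (op_exp_coeff (ann h) l p))) (\<beta> + \<alpha>) else 0) =
       (if N dvd m - d \<beta> then tensor_e (fock_scale (\<sigma> \<beta>) (cre_exp g (x + int l) * ann_exp h l p)) (\<beta> + \<alpha>) else 0)" for l
    proof (cases "N dvd m - d \<beta>")
      case False
      have "N * (int k - int l) + d \<beta> \<noteq> m" for k
        using False by (metis add_diff_cancel_right' dvd_triv_left)
      with False show ?thesis by simp
    next
      case True
      then have "m = N * x + d \<beta>" by (simp add: x_def)
      then have eq: "N * (int k - int l) + d \<beta> = m \<longleftrightarrow> int k = x + int l" for k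
        using N by auto
      show ?thesis
      proof (cases "x + int l < 0")
        case neg: True
        then have "int k \<noteq> x + int l" for k by simp
        then show ?thesis using True neg by (simp add: eq cre_exp_neg)
      next
        case False
        then have eq2: "int k = x + int l \<longleftrightarrow> k = nat (x + int l)" for k by auto
        have "Sum_any (\<lambda>k. if k = nat (x + int l) then
            tensor_e (fock_scale (\<sigma> \<beta>) (op_exp_coeff (\<lambda>r p. cre g r * p) k (op_exp_coeff (ann h) l p))) (\<beta> + \<alpha>) else 0) =
          (\<Sum>k\<in>{nat (x + int l)}. if k = nat (x + int l) then
            tensor_e (fock_scale (\<sigma> \<beta>) (op_exp_coeff (\<lambda>r p. cre g r * p) k (op_exp_coeff (ann h) l p))) (\<beta> + \<alpha>) else 0)"
          by (rule Sum_any.expand_superset) auto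
        then show ?thesis using True False unfolding eq eq2 by (simp add: op_exp_coeff_cre ann_exp_def)
      qed
    qed
    obtain D where D: "\<forall>l>D. ann_exp h l p = 0" using ann_exp_nilpotent by blast
    show ?thesis
    proof (cases "N dvd m - d \<beta>")
      case True
      have "Sum_any (\<lambda>l. tensor_e (fock_scale (\<sigma> \<beta>) (cre_exp g (x + int l) * ann_exp h l p)) (\<beta> + \<alpha>)) =
        (\<Sum>l\<le>D. tensor_e (fock_scale (\<sigma> \<beta>) (cre_exp g (x + int l) * ann_exp h l p)) (\<beta> + \<alpha>))"
        by (rule Sum_any.expand_superset) (use D in \<open>auto intro: leI\<close>)
      then show ?thesis unfolding inner using True
        by (simp add: nf_coeff_def x_def[symmetric] mode_eq[OF D] fock.scale_sum_right tensor_e_sum)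
    qed (simp add: inner nf_coeff_def)
  qed
  have "\<forall>\<beta>. \<exists>L. \<forall>m<L. nf_coeff N g h \<sigma> d \<beta> m (Poly_Mapping.lookup v \<beta>) = 0"
  proof
    fix \<beta>
    obtain D where D: "\<forall>l>D. ann_exp h l (Poly_Mapping.lookup v \<beta>) = 0" using ann_exp_nilpotent by blast
    have "nf_coeff N g h \<sigma> d \<beta> m (Poly_Mapping.lookup v \<beta>) = 0" if m: "m < d \<beta> - N * int D" for m
    proof (cases "N dvd m - d \<beta>")
      case True
      then obtain x where x: "m - d \<beta> = N * x" by blast
      then have "N * x < N * (- int D)" using m by simp
      then have "x < - int D" using N by (simp only: mult_less_cancel_left_pos)
      then show ?thesis using N x by (simp add: nf_coeff_def mode_vanish[OF D])
    qed (simp add: nf_coeff_def)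
    then show "\<exists>L. \<forall>m<L. nf_coeff N g h \<sigma> d \<beta> m (Poly_Mapping.lookup v \<beta>) = 0" by blast
  qed
  then obtain L where L: "\<And>\<beta> m. m < L \<beta> \<Longrightarrow> nf_coeff N g h \<sigma> d \<beta> m (Poly_Mapping.lookup v \<beta>) = 0" by metis
  \<comment> \<open>The lower bound depends on the weight, but only the finitely many weights of v
    contribute.\<close>
  define L' where "L' = Min (insert 0 (L ` Poly_Mapping.keys v))"
  show ?thesis unfolding nf_op_def vertex_op_def *
  proof (rule nth_Abs_fls_lower_bound[of L'], intro allI impI sum.neutral ballI)
    fix m \<beta> assume "m < L'" "\<beta> \<in> Poly_Mapping.keys v"
    then have "m < L \<beta>" by (auto simp: L'_def)
    then show "tensor_e (nf_coeff N g h \<sigma> d \<beta> m (Poly_Mapping.lookup v \<beta>)) (\<beta> + \<alpha>) = 0" by (simp add: L)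
  qed
qed

lemma nf_op_lookup:
  "N > 0 \<Longrightarrow> Poly_Mapping.lookup (nf_op N g h \<alpha> \<sigma> d v $$ m) (\<beta> + \<alpha>) = nf_coeff N g h \<sigma> d \<beta> m (Poly_Mapping.lookup v \<beta>)"
  unfolding nf_op_nth by (rule lookup_tensor_sum) (rule fock_linearD(3)[OF fock_linear_nf_coeff])

lemma vspace_shift_eqI:
  fixes v w :: "'n::finite vspace"
  assumes "\<And>\<beta>. Poly_Mapping.lookup v (\<beta> + \<alpha>) = Poly_Mapping.lookup w (\<beta> + \<alpha>)"
  shows "v = w"
  by (rule poly_mapping_eqI) (metis assms diff_add_cancel)

lemma vertex_op_cong:
  assumes "\<And>r p. r \<ge> 1 \<Longrightarrow> A r p = A' r p" "\<And>r p. r \<ge> 1 \<Longrightarrow> B r p = B' r p"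
  shows "vertex_op N A B \<alpha> \<sigma> d = vertex_op N A' B' \<alpha> \<sigma> d"
proof -
  have "op_exp_coeff A = op_exp_coeff A'" "op_exp_coeff B = op_exp_coeff B'"
    using assms by (auto intro!: ext op_exp_coeff_cong)
  then show ?thesis by (simp only: vertex_op_def[abs_def])
qed

lemma nf_op_cong:
  assumes "\<And>k r. r \<ge> 1 \<Longrightarrow> g k r = g' k r" "\<And>k r. r \<ge> 1 \<Longrightarrow> h k r = h' k r"
    and "\<And>\<beta>. \<sigma> \<beta> = \<sigma>' \<beta>" "\<And>\<beta>. d \<beta> = d' \<beta>" "\<alpha> = \<alpha>'"
  shows "nf_op N g h \<alpha> \<sigma> d = nf_op N g' h' \<alpha>' \<sigma>' d'"
proof -
  have "\<sigma> = \<sigma>'" "d = d'" using assms by auto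
  moreover have "ann h r p = ann h' r p" if "r \<ge> 1" for r p
  proof -
    have "(\<lambda>(k, s). if r = s + 1 then h k r else 0) = (\<lambda>(k, s). if r = s + 1 then h' k r else 0)"
      using assms(2) that by auto
    then show ?thesis by (simp only: ann_def)
  qed
  moreover have "cre g r = cre g' r" if "r \<ge> 1" for r
    using that by (simp add: cre_def assms(1))
  ultimately show ?thesis unfolding nf_op_def assms(5) by (auto intro: vertex_op_cong)
qed

lemma nf_op_zero: "N > 0 \<Longrightarrow> nf_op N g h \<alpha> (\<lambda>\<beta>. 0) d = 0"
  by (intro ext fls_eqI) (simp add: nf_op_nth nf_coeff_def cong: if_cong)

lemma nf_op_scale: "N > 0 \<Longrightarrow> op_scale c (nf_op N g h \<alpha> \<sigma> d) = nf_op N g h \<alpha> (\<lambda>\<beta>. c * \<sigma> \<beta>) d"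
  by (intro ext fls_eqI vspace_shift_eqI[of _ \<alpha>])
    (simp add: op_scale_def series_scale_nth v_scale_lookup nf_op_lookup nf_coeff_def)

lemma nf_op_add: "N > 0 \<Longrightarrow> nf_op N g h \<alpha> \<sigma> d (v + w) = nf_op N g h \<alpha> \<sigma> d v + nf_op N g h \<alpha> \<sigma> d w"
  by (intro fls_eqI vspace_shift_eqI[of _ \<alpha>])
    (simp add: nf_op_lookup lookup_add fock_linearD[OF fock_linear_nf_coeff])

lemma op_component_nf_op:
  assumes "N > 0"
  shows "op_component \<alpha> (nf_op N g h \<alpha> \<sigma> d) = nf_op N g h \<alpha> \<sigma> d"
proof (intro ext fls_eqI)
  fix v m
  have "Poly_Mapping.lookup (nf_op N g h \<alpha> \<sigma> d (tensor_e p \<beta>) $$ m) (\<alpha> + \<beta>) = nf_coeff N g h \<sigma> d \<beta> m p" for p \<beta>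
    unfolding add.commute[of \<alpha>] nf_op_lookup[OF assms] by (simp add: tensor_e_def)
  then show "op_component \<alpha> (nf_op N g h \<alpha> \<sigma> d) v $$ m = nf_op N g h \<alpha> \<sigma> d v $$ m"
    by (simp add: op_component_nth nf_op_nth[OF assms] add.commute)
qed

text \<open>The annihilation exponential fixes the vacuum, so the coefficient at u^(d 0) is \<sigma>
  0 times the vacuum moved to weight \<alpha>. As it is nonzero, no other weight is possible and the
  definite description in \<open>wt\<close> is justified.\<close>

lemma wt_nf_op:
  assumes N: "N > 0" and \<sigma>: "\<sigma> 0 \<noteq> 0"
  shows "wt (nf_op N g h \<alpha> \<sigma> d) = \<alpha>"
proof -
  let ?c = "nf_op N g h \<alpha> \<sigma> d"
  have "has_wt ?c \<alpha>" using has_wt_op_component[of \<alpha> ?c] by (simp add: op_component_nf_op[OF N])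
  moreover have "\<gamma> = \<alpha>" if \<gamma>: "has_wt ?c \<gamma>" for \<gamma>
  proof (rule ccontr)
    assume neq: "\<gamma> \<noteq> \<alpha>"
    have D: "\<forall>l>0. ann_exp h l 1 = 0" using ann_exp_scalar[of h _ 1] by simp
    have "mode g h 0 1 = 1" by (simp add: mode_eq[OF D])
    moreover have "Poly_Mapping.lookup (vac :: 'a vspace) 0 = 1" by (simp add: vac_def tensor_e_def)
    ultimately have "Poly_Mapping.lookup (?c vac $$ d 0) \<alpha> = fock_scale (\<sigma> 0) 1"
      using nf_op_lookup[OF N, of g h \<alpha> \<sigma> d vac "d 0" 0] by (simp add: nf_coeff_def)
    moreover have "Poly_Mapping.lookup (?c vac $$ d 0) \<alpha> = 0"
      using \<gamma> neq unfolding has_wt_def by (auto simp: tensor_e_def lookup_single when_def)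
    ultimately show False using \<sigma> by simp
  qed
  ultimately show ?thesis unfolding wt_def by (rule the_equality)
qed

lemma lookup_Sum_any:
  assumes "finite {x. f x \<noteq> 0}"
  shows "Poly_Mapping.lookup (Sum_any f) \<delta> = Sum_any (\<lambda>x. Poly_Mapping.lookup (f x) \<delta>)"
  using assms by (subst (1 2) Sum_any.expand_superset[OF assms]) (auto simp: lookup_sum)

lemma Sum_any_fock_scale:
  assumes "finite {x. f x \<noteq> 0}"
  shows "Sum_any (\<lambda>x. fock_scale c (f x)) = fock_scale c (Sum_any f)"
  using assms by (subst (1 2) Sum_any.expand_superset[OF assms]) (auto simp: fock.scale_sum_right)

lemma normal_mode_zero: "normal_mode g1 h1 g2 h2 x y 0 = 0"
  by (simp add: normal_mode_def fock_linearD(3)[OF fock_linear_ann_exp] fock_linearD(3)[OF fock_linear_mode])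

section \<open>Bullet product of two operators in normal form\<close>

context
  fixes N :: nat
  assumes N_def: "N = CARD('n::{finite,linorder}) + 1"
begin

context
  fixes g1 h1 g2 h2 :: "'n \<Rightarrow> nat \<Rightarrow> qfield" and \<alpha>1 \<alpha>2 :: "'n weight"
    and \<sigma>1 \<sigma>2 :: "'n weight \<Rightarrow> qfield" and d1 d2 :: "'n weight \<Rightarrow> int" and u u' :: qfield
  assumes \<kappa>: "\<forall>r\<ge>1. (\<Sum>k\<in>UNIV. g2 k r * h1 k r) = (u ^ r - u' ^ r) / of_nat r"
    and d1: "\<And>\<beta>. d1 (\<beta> + \<alpha>2) = d1 \<beta> + iform \<alpha>1 \<alpha>2"
    and \<sigma>1: "\<sigma>1 0 \<noteq> 0"
begin

private abbreviation "a \<equiv> nf_op 1 g1 h1 \<alpha>1 \<sigma>1 d1"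
private abbreviation "b \<equiv> nf_op (int N) g2 h2 \<alpha>2 \<sigma>2 d2"
private abbreviation "e \<equiv> iform \<alpha>1 \<alpha>2 + 1"
private abbreviation "no \<equiv> normal_mode g1 h1 g2 h2"

text \<open>Coefficient of (z_1 - u' z_2) times the normally ordered product divided by z_1, after
  the factor z_1 - u z_2 has been written as z_1 times 1 - u z_2/z_1. Since \<open>a\<close> acts
  after \<open>b\<close>, its degree is d1 (\<beta> + \<alpha>2) = d1 \<beta> + e - 1; the extra
  factor z_1 accounts for the remaining 1 in k - e - d1 \<beta>.\<close>

private definition "nc \<beta> k l p = (if int N dvd l - d2 \<beta> then fock_scale (\<sigma>1 (\<beta> + \<alpha>2) * \<sigma>2 \<beta>)
    (no (k - e - d1 \<beta>) ((l - d2 \<beta>) div int N) p - fock_scale u' (no (k - e - d1 \<beta> + 1) ((l - d2 \<beta>) div int N - 1) p)) else 0)"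

private definition "nv v k l = (\<Sum>\<beta>\<in>Poly_Mapping.keys v. tensor_e (nc \<beta> k l (Poly_Mapping.lookup v \<beta>)) (\<beta> + (\<alpha>1 + \<alpha>2)))"

private lemma N_pos': "int N > 0" by (simp add: N_def)

private lemma nc_zero: "nc \<beta> k l 0 = 0"
  by (simp add: nc_def normal_mode_zero)

private lemma nv_lookup: "Poly_Mapping.lookup (nv v k l) (\<beta> + (\<alpha>1 + \<alpha>2)) = nc \<beta> k l (Poly_Mapping.lookup v \<beta>)"
  unfolding nv_def by (rule lookup_tensor_sum) (rule nc_zero)

private lemma nv_laurent: "in_laurent2 (nv v)"
proof -
  have "\<exists>L. \<forall>k l. k < L \<or> l < L \<longrightarrow> nc \<beta> k l (Poly_Mapping.lookup v \<beta>) = 0" for \<beta>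
  proof -
    let ?p = "Poly_Mapping.lookup v \<beta>"
    obtain D where D: "\<forall>l>D. ann_exp h2 l ?p = 0" "\<forall>l l'. l > D \<longrightarrow> ann_exp h1 l (ann_exp h2 l' ?p) = 0"
      using normal_mode_bound by blast
    \<comment> \<open>The term - 1 accounts for the second summand of \<open>nc\<close>, whose first
      mode index is larger by 1.\<close>
    define L where "L = min (e + d1 \<beta> - 1 - int D) (d2 \<beta> - int N * int D)"
    have "nc \<beta> k l ?p = 0" if "k < L \<or> l < L" for k l
    proof (cases "int N dvd l - d2 \<beta>")
      case True
      then obtain y where y: "l - d2 \<beta> = int N * y" by blast
      have "y < - int D" if "l < L"
      proof -
        have "int N * y < int N * (- int D)" using that y by (simp add: L_def)
        then show ?thesis using N_pos' by (simp only: mult_less_cancel_left_pos)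
      qed
      moreover have "(l - d2 \<beta>) div int N = y" using y N_pos' by simp
      moreover have "k - e - d1 \<beta> + 1 < - int D" if "k < L" using that by (simp add: L_def)
      ultimately have "no (k - e - d1 \<beta>) ((l - d2 \<beta>) div int N) ?p = 0"
        "no (k - e - d1 \<beta> + 1) ((l - d2 \<beta>) div int N - 1) ?p = 0"
        using that by (intro normal_mode_vanish[OF D]; fastforce)+
      then show ?thesis by (simp add: nc_def)
    qed (simp add: nc_def)
    then show ?thesis by blast
  qed
  then obtain L where L: "\<And>\<beta> k l. k < L \<beta> \<or> l < L \<beta> \<Longrightarrow> nc \<beta> k l (Poly_Mapping.lookup v \<beta>) = 0" by metis
  define L' where "L' = Min (insert 0 (L ` Poly_Mapping.keys v))"
  have "nv v k l = 0" if "k < L' \<or> l < L'" for k l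
    unfolding nv_def
  proof (intro sum.neutral ballI)
    fix \<beta> assume "\<beta> \<in> Poly_Mapping.keys v"
    then have "k < L \<beta> \<or> l < L \<beta>" using that by (auto simp: L'_def)
    then show "tensor_e (nc \<beta> k l (Poly_Mapping.lookup v \<beta>)) (\<beta> + (\<alpha>1 + \<alpha>2)) = 0" by (simp add: L)
  qed
  then show ?thesis unfolding in_laurent2_def by blast
qed

private lemma two_point_nv: "two_point a b v (k - 1) l - v_scale u (two_point a b v k (l - int N)) = nv v k l"
proof (rule vspace_shift_eqI[of _ "\<alpha>1 + \<alpha>2"])
  fix \<beta>
  let ?p = "Poly_Mapping.lookup v \<beta>"
  have tp: "Poly_Mapping.lookup (two_point a b v k l) (\<beta> + (\<alpha>1 + \<alpha>2)) =
    fock_scale (\<sigma>1 (\<beta> + \<alpha>2)) (mode g1 h1 (k - d1 (\<beta> + \<alpha>2)) (nf_coeff (int N) g2 h2 \<sigma>2 d2 \<beta> l ?p))" for k l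
  proof -
    have "\<beta> + (\<alpha>1 + \<alpha>2) = (\<beta> + \<alpha>2) + \<alpha>1" by (simp add: add_ac)
    then show ?thesis
      by (simp only: two_point_def nf_op_lookup[OF N_pos'] nf_op_lookup[OF zero_less_one] nf_coeff_def[of 1]) simp
  qed
  note lin = fock_linearD[OF fock_linear_mode]
  have dvd: "int N dvd l - int N - d2 \<beta> \<longleftrightarrow> int N dvd l - d2 \<beta>"
  proof -
    have "l - int N - d2 \<beta> = (l - d2 \<beta>) + (- 1) * int N" by simp
    then show ?thesis by (simp only: dvd_add_times_triv_right_iff)
  qed
  have div: "(l - int N - d2 \<beta>) div int N = (l - d2 \<beta>) div int N - 1"
  proof -
    have "l - int N - d2 \<beta> = (l - d2 \<beta>) + int N * (-1)" by simp
    then show ?thesis using N_pos' by (simp only: div_mult_self2)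
  qed
  have ix: "k - 1 - d1 (\<beta> + \<alpha>2) = k - e - d1 \<beta>" "k - d1 (\<beta> + \<alpha>2) = k - e - d1 \<beta> + 1"
    by (simp_all add: d1)
  show "Poly_Mapping.lookup (two_point a b v (k - 1) l - v_scale u (two_point a b v k (l - int N))) (\<beta> + (\<alpha>1 + \<alpha>2)) =
    Poly_Mapping.lookup (nv v k l) (\<beta> + (\<alpha>1 + \<alpha>2))"
  proof (cases "int N dvd l - d2 \<beta>")
    case True
    have "Poly_Mapping.lookup (two_point a b v (k - 1) l - v_scale u (two_point a b v k (l - int N))) (\<beta> + (\<alpha>1 + \<alpha>2)) =
      fock_scale (\<sigma>1 (\<beta> + \<alpha>2) * \<sigma>2 \<beta>) (mode g1 h1 (k - e - d1 \<beta>) (mode g2 h2 ((l - d2 \<beta>) div int N) ?p) -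
        fock_scale u (mode g1 h1 (k - e - d1 \<beta> + 1) (mode g2 h2 ((l - d2 \<beta>) div int N - 1) ?p)))"
      using True unfolding lookup_minus v_scale_lookup tp nf_coeff_def dvd div ix
      by (simp add: lin fock.scale_right_diff_distrib mult_ac)
    then show ?thesis unfolding nv_lookup using True by (simp only: nc_def mode_mode_pole[OF \<kappa>] if_True)
  next
    case False
    then show ?thesis unfolding lookup_minus v_scale_lookup tp nf_coeff_def dvd nv_lookup nc_def
      by (simp add: lin)
  qed
qed

private lemma a_zero: "a 0 = 0"
  using nf_op_add[of 1 g1 h1 \<alpha>1 \<sigma>1 d1 0 0] by simp

lemma compat_nf_op: "compat a b"
  by (rule compat_simple_pole[OF N_def a_zero op_component_nf_op[OF N_pos'] nv_laurent two_point_nv])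

private lemma bullet_nth: "(a \<bullet>\<^sub>q b) v $$ l = (if u \<in> range ((powi) qh) then
      Sum_any (\<lambda>k. v_scale (u powi (k - e)) (nv v k (l + int N * e - int N * k))) else 0)"
  by (rule bullet_simple_pole[OF N_def a_zero op_component_nf_op[OF N_pos'] nv_laurent two_point_nv])
    (simp add: wt_nf_op[of 1 \<sigma>1, OF _ \<sigma>1])

text \<open>The case u = 0 describes a contraction that is a polynomial in z_2/z_1; there is no pole
  to take a residue at.\<close>

lemma bullet_nf_op_zero:
  assumes "u = 0"
  shows "a \<bullet>\<^sub>q b = 0"
proof -
  have "u \<notin> range ((powi) qh)" using assms by auto
  then show ?thesis by (intro ext fls_eqI) (simp add: bullet_nth)
qed

text \<open>Evaluation at z_1 = u z_2: both summands of \<open>nc\<close> yield the same merged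
  mode, with total factor 1 - u'/u. The initial power z_1^(d1 \<beta>) turns into u^(d1 \<beta>)
  z^(d1 \<beta>), and the exponent e in the definition of the bullet product cancels the remaining
  powers of u and z.\<close>

lemma bullet_nf_op:
  assumes u: "u = qh powi s"
  shows "a \<bullet>\<^sub>q b = nf_op (int N) (\<lambda>j r. u ^ r * g1 j r + g2 j r) (\<lambda>j r. inverse u ^ r * h1 j r + h2 j r) (\<alpha>1 + \<alpha>2)
    (\<lambda>\<beta>. (1 - u' / u) * u powi d1 \<beta> * \<sigma>1 (\<beta> + \<alpha>2) * \<sigma>2 \<beta>) (\<lambda>\<beta>. d2 \<beta> + int N * d1 \<beta>)"
proof (intro ext fls_eqI vspace_shift_eqI[of _ "\<alpha>1 + \<alpha>2"])
  fix v :: "'n vspace" and l \<beta>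
  let ?p = "Poly_Mapping.lookup v \<beta>"
  let ?g = "\<lambda>j r. u ^ r * g1 j r + g2 j r" and ?h = "\<lambda>j r. inverse u ^ r * h1 j r + h2 j r"
  have u0: "u \<noteq> 0" by (simp add: u)
  have fin: "finite {k. v_scale (u powi (k - e)) (nv v k (l + int N * e - int N * k)) \<noteq> 0}"
    by (rule finite_subset[OF _ in_laurent2_subst_finite[OF N_def nv_laurent, of v "l + int N * e" 0]])
      (auto simp: v_scale_zero)
  have L: "Poly_Mapping.lookup ((a \<bullet>\<^sub>q b) v $$ l) (\<beta> + (\<alpha>1 + \<alpha>2)) =
    Sum_any (\<lambda>k. fock_scale (u powi (k - e)) (nc \<beta> k (l + int N * e - int N * k) ?p))"
  proof -
    have "u \<in> range ((powi) qh)" using u by auto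
    then show ?thesis by (simp only: bullet_nth if_True lookup_Sum_any[OF fin] v_scale_lookup nv_lookup)
  qed
  have R: "Poly_Mapping.lookup (nf_op (int N) ?g ?h (\<alpha>1 + \<alpha>2)
      (\<lambda>\<beta>. (1 - u' / u) * u powi d1 \<beta> * \<sigma>1 (\<beta> + \<alpha>2) * \<sigma>2 \<beta>) (\<lambda>\<beta>. d2 \<beta> + int N * d1 \<beta>) v $$ l) (\<beta> + (\<alpha>1 + \<alpha>2)) =
    (if int N dvd l - (d2 \<beta> + int N * d1 \<beta>) then fock_scale ((1 - u' / u) * u powi d1 \<beta> * \<sigma>1 (\<beta> + \<alpha>2) * \<sigma>2 \<beta>)
      (mode ?g ?h ((l - (d2 \<beta> + int N * d1 \<beta>)) div int N) ?p) else 0)"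
    by (simp only: nf_op_lookup[OF N_pos'] nf_coeff_def)
  have dvd1: "int N dvd (l + int N * e - int N * k) - d2 \<beta> \<longleftrightarrow> int N dvd l - d2 \<beta>" for k
  proof -
    have "(l + int N * e - int N * k) - d2 \<beta> = (l - d2 \<beta>) + (e - k) * int N" by (simp add: algebra_simps)
    then show ?thesis by (simp only: dvd_add_times_triv_right_iff)
  qed
  have dvd2: "int N dvd l - (d2 \<beta> + int N * d1 \<beta>) \<longleftrightarrow> int N dvd l - d2 \<beta>"
  proof -
    have "l - (d2 \<beta> + int N * d1 \<beta>) = (l - d2 \<beta>) + (- d1 \<beta>) * int N" by (simp add: algebra_simps)
    then show ?thesis by (simp only: dvd_add_times_triv_right_iff)
  qed
  show "Poly_Mapping.lookup ((a \<bullet>\<^sub>q b) v $$ l) (\<beta> + (\<alpha>1 + \<alpha>2)) = Poly_Mapping.lookup (nf_op (int N) ?g ?h (\<alpha>1 + \<alpha>2)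
      (\<lambda>\<beta>. (1 - u' / u) * u powi d1 \<beta> * \<sigma>1 (\<beta> + \<alpha>2) * \<sigma>2 \<beta>) (\<lambda>\<beta>. d2 \<beta> + int N * d1 \<beta>) v $$ l) (\<beta> + (\<alpha>1 + \<alpha>2))"
  proof (cases "int N dvd l - d2 \<beta>")
    case False
    then show ?thesis unfolding L R nc_def dvd1 dvd2 by simp
  next
    case True
    then obtain y where y: "l - d2 \<beta> = int N * y" by blast
    define m where "m = y - d1 \<beta>"
    define X where "X = \<sigma>1 (\<beta> + \<alpha>2) * \<sigma>2 \<beta> * u powi d1 \<beta>"
    define f where "f t = fock_scale (u powi t) (no t (m - t) ?p)" for t
    define G where "G t = fock_scale X (f t + fock_scale (- (u' / u)) (f (t + 1)))" for t
    have "(l + int N * e - int N * k - d2 \<beta>) div int N = y + e - k" for k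
    proof -
      have "l + int N * e - int N * k - d2 \<beta> = int N * (y + e - k)" using y by (simp add: algebra_simps)
      then show ?thesis using N_pos' by simp
    qed
    then have nc: "nc \<beta> k (l + int N * e - int N * k) ?p = fock_scale (\<sigma>1 (\<beta> + \<alpha>2) * \<sigma>2 \<beta>)
      (no (k - e - d1 \<beta>) (y + e - k) ?p - fock_scale u' (no (k - e - d1 \<beta> + 1) (y + e - k - 1) ?p))" for k
      unfolding nc_def dvd1 using True by simp
    have G: "fock_scale (u powi (k - e)) (nc \<beta> k (l + int N * e - int N * k) ?p) = G (k - (e + d1 \<beta>))" for k
    proof -
      define t where "t = k - (e + d1 \<beta>)"
      have i: "k - e = t + d1 \<beta>" "y + e - k = m - t" "t + d1 \<beta> - d1 \<beta> = t" "m - (t + 1) = m - t - 1"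
        by (simp_all add: t_def m_def)
      have e: "u powi (t + d1 \<beta>) * (\<sigma>1 (\<beta> + \<alpha>2) * \<sigma>2 \<beta>) = X * u powi t"
        "X * u powi t * u' = X * (u' / u) * u powi (t + 1)"
        using u0 by (simp_all add: X_def power_int_add)
      have "fock_scale A (fock_scale B (P - fock_scale u' R)) = fock_scale (A * B) P - fock_scale (A * B * u') R"
        for A B and P R :: "'n fock"
        by (simp add: fock.scale_right_diff_distrib mult.assoc)
      moreover have "fock_scale X (fock_scale A P + fock_scale (- B) (fock_scale C R)) = fock_scale (X * A) P - fock_scale (X * B * C) R"
        for A B C and P R :: "'n fock"
        by (simp add: fock.scale_right_distrib fock.scale_right_diff_distrib mult.assoc)
      ultimately show ?thesis unfolding nc i t_def[symmetric] G_def f_def by (simp only: e)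
    qed
    have finf: "finite {t. f t \<noteq> 0}" unfolding f_def by (rule normal_mode_diagonal_finite[OF u0])
    have "{t. f (t + 1) \<noteq> 0} = (\<lambda>t. t - 1) ` {t. f t \<noteq> 0}"
      by (auto simp: image_iff) (metis add_diff_cancel_right')
    then have finf1: "finite {t. f (t + 1) \<noteq> 0}" using finf by simp
    have finf2: "finite {t. fock_scale c (f (t + 1)) \<noteq> 0}" for c
      by (rule finite_subset[OF _ finf1]) auto
    have bij: "bij (\<lambda>k. k + c :: int)" for c by (rule o_bij[of "\<lambda>k. k - c"]) auto
    \<comment> \<open>A sum over all t is invariant under translation, so the two summands of
      \<open>nc\<close> differ only by the scalar - u'/u.\<close>
    have sh: "Sum_any (\<lambda>t. f (t + 1)) = Sum_any f"
      using Sum_any.reindex_cong[OF bij refl, of f 1] by (simp add: comp_def)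
    have "Sum_any (\<lambda>k. G (k - (e + d1 \<beta>))) = Sum_any G"
      using Sum_any.reindex_cong[OF bij refl, of G "- (e + d1 \<beta>)"]
      by (simp only: comp_def add_uminus_conv_diff)
    also have "\<dots> = fock_scale X (Sum_any (\<lambda>t. f t + fock_scale (- (u' / u)) (f (t + 1))))"
      unfolding G_def by (rule Sum_any_fock_scale)
        (rule finite_subset[of _ "{t. f t \<noteq> 0} \<union> {t. f (t + 1) \<noteq> 0}"], use finf finf1 in auto)
    also have "Sum_any (\<lambda>t. f t + fock_scale (- (u' / u)) (f (t + 1))) =
      Sum_any f + fock_scale (- (u' / u)) (Sum_any f)"
      by (simp only: Sum_any.distrib[OF finf finf2] Sum_any_fock_scale[OF finf1] sh)
    also have "\<dots> = fock_scale (1 - u' / u) (Sum_any f)"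
      by (simp add: fock.scale_left_diff_distrib)
    also have "Sum_any f = mode ?g ?h m ?p"
      unfolding f_def by (rule normal_mode_diagonal[OF u0])
    finally have "Poly_Mapping.lookup ((a \<bullet>\<^sub>q b) v $$ l) (\<beta> + (\<alpha>1 + \<alpha>2)) =
      fock_scale X (fock_scale (1 - u' / u) (mode ?g ?h m ?p))"
      unfolding L G .
    moreover have "(l - (d2 \<beta> + int N * d1 \<beta>)) div int N = m"
    proof -
      have "l - (d2 \<beta> + int N * d1 \<beta>) = int N * m" using y by (simp add: m_def algebra_simps)
      then show ?thesis using N_pos' by simp
    qed
    ultimately show ?thesis unfolding R dvd2 using True by (simp add: X_def mult_ac)
  qed
qed

end

end

section \<open>The generators in normal form\<close>

lemma qq_powi: "qq powi k = qh powi (2 * k)"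
  by (simp add: qq_def power_int_power)

lemma qh_powi_power: "(qh powi a) ^ r = qh powi (a * int r)"
  by (rule power_int_power')

lemma inverse_qh_powi: "inverse (qh powi a) = qh powi (- a)"
  by (simp add: power_int_minus)

lemma qh_powi_mult: "qh powi a * qh powi b = qh powi (a + b)" "qh powi a * (qh powi b * x) = qh powi (a + b) * x"
  by (simp_all add: power_int_add)

lemma qq_minus_inverse_nonzero: "qq - inverse qq \<noteq> 0"
proof
  assume "qq - inverse qq = 0"
  then have "qh powi 2 = qh powi (- 2)"
    using qq_powi[of 1] qq_powi[of "- 1"] by (simp add: power_int_minus)
  then show False by (simp only: qh_powi_inject)
qed

lemma qint_mult: "(qq - inverse qq) * qint m = qq powi m - qq powi (- m)"
  using qq_minus_inverse_nonzero by (simp add: qint_def)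

lemma qint_nonzero: "m \<noteq> 0 \<Longrightarrow> qint m \<noteq> 0"
proof
  assume m: "m \<noteq> 0" and "qint m = 0"
  then have "qq powi m = qq powi (- m)" using qint_mult[of m] by simp
  then have "2 * m = 2 * - m" unfolding qq_powi qh_powi_inject .
  with m show False by simp
qed

lemma qint_minus: "qint (- m) = - qint m"
  by (simp add: qint_def minus_divide_left)

lemma qint_0 [simp]: "qint 0 = 0"
  by (simp add: qint_def)

lemma qint_double: "qint (2 * m) = qint m * (qq powi m + qq powi (- m))"
proof -
  have "qq powi (2 * m) = qq powi m * qq powi m" for m
    by (simp add: qq_powi qh_powi_mult)
  from this[of m] this[of "- m"] show ?thesis
    by (simp add: qint_def algebra_simps)
qed

text \<open>As a function of a, [a m] is annihilated by the q-deformed second difference. This gives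
  the zeros off the diagonal when the deformed Cartan matrix is inverted.\<close>

lemma qint_three_term: "qint (2 * m) * qint (a * m) = qint m * (qint ((a - 1) * m) + qint ((a + 1) * m))"
proof -
  have "qint (2 * m) * qint (a * m) = qint m * ((qq powi m + qq powi (- m)) * qint (a * m))"
    by (simp add: qint_double)
  also have "(qq powi m + qq powi (- m)) * qint (a * m) = qint ((a - 1) * m) + qint ((a + 1) * m)"
    unfolding qint_def by (simp add: qq_powi qh_powi_mult algebra_simps flip: add_divide_distrib)
  finally show ?thesis .
qed

text \<open>A Wronskian identity for two solutions of the three-term relation; it gives the diagonal
  entry, where the two pieces of the inverse matrix meet.\<close>

lemma qint_product_difference: "qint ((a + 1) * m) * qint (b * m) - qint (a * m) * qint ((b - 1) * m) = qint m * qint ((a + b) * m)"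
proof -
  let ?\<delta> = "qq - inverse qq"
  \<comment> \<open>Multiplying by (q - 1/q)^2 turns each q-integer into a difference of two powers,
    after which only exponents are compared.\<close>
  have *: "d * d * (A * B - C * E) = (d * A) * (d * B) - (d * C) * (d * E)" "(d * A) * (d * B) = d * d * (A * B)"
    for d A B C E :: qfield by (simp_all add: algebra_simps)
  have "?\<delta> * ?\<delta> * (qint ((a + 1) * m) * qint (b * m) - qint (a * m) * qint ((b - 1) * m)) =
    (?\<delta> * qint ((a + 1) * m)) * (?\<delta> * qint (b * m)) - (?\<delta> * qint (a * m)) * (?\<delta> * qint ((b - 1) * m))"
    by (rule *(1))
  also have "\<dots> = (?\<delta> * qint m) * (?\<delta> * qint ((a + b) * m))"
    unfolding qint_mult by (simp add: qq_powi qh_powi_mult algebra_simps)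
  finally have "?\<delta> * ?\<delta> * (qint ((a + 1) * m) * qint (b * m) - qint (a * m) * qint ((b - 1) * m)) =
    ?\<delta> * ?\<delta> * (qint m * qint ((a + b) * m))"
    by (rule trans[OF _ *(2)])
  then show ?thesis using qq_minus_inverse_nonzero by simp
qed

lemma fock_deriv_weight_add: "fock_deriv (\<lambda>x. c x + c' x) p = fock_deriv c p + fock_deriv c' p"
  by (simp add: fock_deriv_def distrib_left single_add sum.distrib)

lemma fock_deriv_weight_zero: "fock_deriv (\<lambda>x. 0) p = 0"
  by (simp add: fock_deriv_def)

lemma fock_deriv_weight_scale: "fock_deriv (\<lambda>x. a * c x) p = fock_scale a (fock_deriv c p)"
  by (simp add: fock_deriv_def fock.scale_sum_right) (simp add: fock_scale_def mult_single mult_ac)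

lemma ann_weight_scale: "ann (\<lambda>k r. a r * h k r) r p = fock_scale (a r) (ann h r p)"
  unfolding ann_def fock_deriv_weight_scale[symmetric]
  by (rule arg_cong2[where f = fock_deriv]) (auto simp: fun_eq_iff)

lemma ann_weight_sum: "ann (\<lambda>k r. \<Sum>j\<in>A. h j k r) r p = (\<Sum>j\<in>A. ann (h j) r p)"
proof (induction A rule: infinite_finite_induct)
  case (insert j A)
  have "ann (\<lambda>k r. \<Sum>j\<in>insert j A. h j k r) r p = ann (h j) r p + ann (\<lambda>k r. \<Sum>j\<in>A. h j k r) r p"
    unfolding ann_def fock_deriv_weight_add[symmetric]
    by (rule arg_cong2[where f = fock_deriv]) (use insert in \<open>auto simp: fun_eq_iff\<close>)
  then show ?case using insert by simp
qed (simp_all add: ann_def case_prod_unfold fock_deriv_weight_zero)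

text \<open>The scalar in the commutator of a_j(r) with a_k(-r).\<close>

definition heis_weight :: "'n::{finite,linorder} \<Rightarrow> 'n \<Rightarrow> nat \<Rightarrow> qfield" where
  "heis_weight j k r = qint (cartan j k * int r) * qint (int r) / of_nat r"

lemma heis_pos: "r \<ge> 1 \<Longrightarrow> heis j (int r) p = ann (heis_weight j) r p"
  unfolding heis_def ann_def by (auto intro!: arg_cong2[where f = fock_deriv] simp: fun_eq_iff heis_weight_def)

lemma heis_neg: "r \<ge> 1 \<Longrightarrow> heis j (- int r) p = fock_var (j, r - 1) * p"
  by (auto simp: heis_def nat_diff_distrib)

lemma cre_single: "cre (\<lambda>k r. if k = j then c r else 0) r = fock_scale (c r) (fock_var (j, r - 1))"
  by (simp add: cre_def if_distrib[of "\<lambda>c. fock_scale c _"] cong: if_cong)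

lemma iform_root: "iform (simple_root j) \<beta> = \<beta> $ j"
  by (subst iform_def, subst form_sym) (simp add: form_root)

lemma iform_root_scale: "iform (s *s simple_root j) \<beta> = s * \<beta> $ j"
proof -
  have "form (s *s simple_root j) \<beta> = of_int s * form (simple_root j) \<beta>"
    by (simp add: form_def sum_distrib_left mult.assoc)
  also have "\<dots> = of_int (s * \<beta> $ j)"
    by (subst form_sym) (simp add: form_root)
  finally show ?thesis unfolding iform_def by (simp only: floor_of_int)
qed

definition x_cre :: "int \<Rightarrow> 'n::{finite,linorder} \<Rightarrow> 'n \<Rightarrow> nat \<Rightarrow> qfield" where
  "x_cre s j k r = (if k = j then of_int s * qh powi (- s * int r) / qint (int r) else 0)"

definition x_ann :: "int \<Rightarrow> 'n::{finite,linorder} \<Rightarrow> 'n \<Rightarrow> nat \<Rightarrow> qfield" where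
  "x_ann s j k r = - (of_int s * qh powi (- s * int r) / qint (int r)) * heis_weight j k r"

definition psi_ann :: "'n::{finite,linorder} \<Rightarrow> 'n \<Rightarrow> nat \<Rightarrow> qfield" where
  "psi_ann j k r = (qq - inverse qq) * heis_weight j k r"

lemma x_op_nf: "x_op s j = nf_op 1 (x_cre s j) (x_ann s j) (s *s simple_root j) (twist (s *s simple_root j)) (\<lambda>\<beta>. s * \<beta> $ j)"
  unfolding x_op_def nf_op_def iform_root
proof (rule vertex_op_cong)
  fix r :: nat and p :: "'a fock" assume r: "r \<ge> 1"
  show "fock_scale (of_int s * qh powi (- s * int r) / qint (int r)) (heis j (- int r) p) = cre (x_cre s j) r * p"
    using r by (simp add: heis_neg x_cre_def[abs_def] cre_single fock_scale_mult)
  show "fock_scale (- (of_int s * qh powi (- s * int r) / qint (int r))) (heis j (int r) p) = ann (x_ann s j) r p"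
    unfolding x_ann_def[abs_def] ann_weight_scale heis_pos[OF r] ..
qed

lemma psi_op_nf: "psi_op j = nf_op 1 (\<lambda>k r. 0) (psi_ann j) 0 (\<lambda>\<beta>. qq powi \<beta> $ j) (\<lambda>\<beta>. 0)"
  unfolding psi_op_def nf_op_def iform_root
  by (rule vertex_op_cong) (simp_all add: heis_pos psi_ann_def[abs_def] ann_weight_scale cre_def)

lemma phi_op_nf: "phi_op j = nf_op 1 (\<lambda>k r. if k = j then - (qq - inverse qq) else 0) (\<lambda>k r. 0) 0 (\<lambda>\<beta>. qq powi (- \<beta> $ j)) (\<lambda>\<beta>. 0)"
  unfolding phi_op_def nf_op_def iform_root
  by (rule vertex_op_cong) (simp_all add: heis_neg ann_def case_prod_unfold fock_deriv_weight_zero cre_single fock_scale_mult)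

definition Y_cre :: "'n::{finite,linorder} \<Rightarrow> 'n \<Rightarrow> nat \<Rightarrow> qfield" where
  "Y_cre i k r = qh powi int r / qint (int r) * mcoeff i k (- int r)"

text \<open>Contractions pair the annihilation parts of generators on the left with the creation
  part of the right factor; this part and the weight are what is recorded explicitly.\<close>

lemma Y_op_nf: "\<exists>h \<sigma> d. Y_op i = nf_op (int CARD('n) + 1) (Y_cre i) h (fund_weight (i :: 'n::{finite,linorder})) \<sigma> d"
proof (intro exI)
  let ?h = "\<lambda>k r. \<Sum>j\<in>UNIV. (- (qh powi int r / qint (int r)) * mcoeff i j (int r)) * heis_weight j k r"
  show "Y_op i = nf_op (int CARD('n) + 1) (Y_cre i) ?h (fund_weight i)
     (\<lambda>\<beta>. twist (fund_weight i) \<beta> *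
        minus_one_rat_pow
          ((if i = Max UNIV then 0 else of_nat (pos i)) * form (fund_weight (Max UNIV)) \<beta>))
     (\<lambda>\<beta>. \<lfloor>of_nat (CARD('n) + 1) * form (fund_weight i) \<beta>\<rfloor>)"
    unfolding Y_op_def nf_op_def
  proof (rule vertex_op_cong)
    fix r :: nat and p :: "'n fock" assume r: "r \<ge> 1"
    show "fock_scale (qh powi int r / qint (int r)) (heis_star i (- int r) p) = cre (Y_cre i) r * p"
      using r by (simp add: heis_star_def heis_neg cre_def Y_cre_def fock.scale_sum_right sum_distrib_right fock_scale_mult)
    show "fock_scale (- (qh powi int r / qint (int r))) (heis_star i (int r) p) = ann ?h r p"
      unfolding ann_weight_sum ann_weight_scale[of "\<lambda>r. - (qh powi int r / qint (int r)) * mcoeff i _ (int r)"]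
      using r by (simp only: heis_star_def heis_pos fock.scale_sum_right fock.scale_scale)
  qed
qed

section \<open>States\<close>

text \<open>The fundamental representation with highest weight \<open>\<lambda>\<^sub>i\<close> has a basis indexed by the subsets \<open>S\<close> of
  \<open>{1, \<dots>, n + 1}\<close> with \<open>i\<close> elements, and \<open>box_pow\<close>, \<open>y_pow\<close> describe its q-character: for the state
  \<open>S\<close> the variable \<open>Y\<^sub>p\<^sub>,\<^sub>a\<close> occurs with \<open>a = q\<^bsup>box_exp i S p\<^esup>\<close> if \<open>p \<in> S\<close>, \<open>p + 1 \<notin> S\<close>, and \<open>Y\<^sub>p\<^sub>,\<^sub>a\<^sup>-\<^sup>1\<close> occurs with
  \<open>a = q\<^bsup>box_exp i S (p + 1) + 1\<^esup>\<close> if \<open>p \<notin> S\<close>, \<open>p + 1 \<in> S\<close>.\<close>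

definition box_exp :: "int \<Rightarrow> nat set \<Rightarrow> nat \<Rightarrow> int" where
  "box_exp c S p = c + int p - 2 * int (card (S \<inter> {..p}))"

definition box_pow :: "int \<Rightarrow> nat set \<Rightarrow> nat \<Rightarrow> nat \<Rightarrow> qfield" where
  "box_pow c S p r = (if p \<in> S then qh powi (2 * box_exp c S p * int r) else 0)"

definition y_pow :: "int \<Rightarrow> nat set \<Rightarrow> nat \<Rightarrow> nat \<Rightarrow> qfield" where
  "y_pow c S p r = box_pow c S p r - qh powi (2 * int r) * box_pow c S (Suc p) r"

text \<open>The sum of epsilon_p over p in S in fundamental weight coordinates, where alpha_j =
  epsilon_j - epsilon_(j+1).\<close>

definition state_weight :: "nat set \<Rightarrow> 'n::{finite,linorder} weight" where
  "state_weight S = (\<chi> j. of_bool (pos j \<in> S) - of_bool (Suc (pos j) \<in> S))"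

text \<open>Up to the factor [r]/r the left side is the commutator of a_j(r) with the creation part,
  which determines all contractions with generators. The factor q^(r/2) is the one in the creation
  part of \<open>Y_op\<close>.\<close>

definition state_cre :: "int \<Rightarrow> nat set \<Rightarrow> ('n::{finite,linorder} \<Rightarrow> nat \<Rightarrow> qfield) \<Rightarrow> bool" where
  "state_cre c S g \<longleftrightarrow> (\<forall>j. \<forall>r\<ge>1. (\<Sum>k\<in>UNIV. g k r * qint (cartan j k * int r)) = qh powi int r * y_pow c S (pos j) r)"

text \<open>Quantifying over \<sigma> lets a state absorb all scalars and signs that products
  create, and makes 0 a state as well. The offset \<open>c\<close> stays constant under the
  generators.\<close>

definition is_state :: "int \<Rightarrow> nat set \<Rightarrow> 'n::{finite,linorder} vop \<Rightarrow> bool" where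
  "is_state c S b \<longleftrightarrow> (\<exists>g h \<sigma> d. b = nf_op (int CARD('n) + 1) g h (state_weight S) \<sigma> d \<and> state_cre c S g)"

text \<open>Two neighbouring elements contribute Y_p and its inverse with the same spectral
  parameter, because \<open>box_exp\<close> drops by 1 from p to Suc p.\<close>

lemma y_pow_both:
  assumes "p \<in> S" "Suc p \<in> S"
  shows "y_pow c S p r = 0"
proof -
  have "S \<inter> {..Suc p} = insert (Suc p) (S \<inter> {..p})" using assms by auto
  then have e: "box_exp c S (Suc p) = box_exp c S p - 1" by (simp add: box_exp_def)
  have "2 * int r + 2 * box_exp c S (Suc p) * int r = 2 * box_exp c S p * int r" unfolding e by (simp add: algebra_simps)
  then show ?thesis using assms by (simp add: y_pow_def box_pow_def qh_powi_mult)
qed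

section \<open>Moving one element of a subset\<close>

context
  fixes S S' :: "nat set" and p :: nat
  assumes p: "p \<in> S" "Suc p \<notin> S" and S': "S' = insert (Suc p) (S - {p})"
begin

text \<open>\<open>box_exp\<close> counts the elements up to q, and replacing p by Suc p changes
  this count only at q = p.\<close>

lemma box_exp_move: "q \<noteq> p \<Longrightarrow> box_exp c S' q = box_exp c S q"
proof -
  assume q: "q \<noteq> p"
  have "card (S' \<inter> {..q}) = card (S \<inter> {..q})"
  proof (cases "q < p")
    case True
    then have "S' \<inter> {..q} = S \<inter> {..q}" using p S' by auto
    then show ?thesis by simp
  next
    case False
    then have "S' \<inter> {..q} = insert (Suc p) (S \<inter> {..q} - {p})" using q S' by auto
    then have "card (S' \<inter> {..q}) = Suc (card (S \<inter> {..q} - {p}))" using p by simp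
    also have "\<dots> = card (S \<inter> {..q})" by (rule card_Suc_Diff1) (use False p in auto)
    finally show ?thesis .
  qed
  then show ?thesis by (simp add: box_exp_def)
qed

lemma box_exp_Suc_move: "box_exp c S (Suc p) = box_exp c S p + 1" "box_exp c S' (Suc p) = box_exp c S p + 1"
proof -
  have "S \<inter> {..Suc p} = S \<inter> {..p}" using p by (auto simp: le_Suc_eq)
  then show "box_exp c S (Suc p) = box_exp c S p + 1" by (simp add: box_exp_def)
  then show "box_exp c S' (Suc p) = box_exp c S p + 1" by (simp add: box_exp_move)
qed

lemma box_pow_move: "box_pow c S' q r =
    (if q = p then 0 else if q = Suc p then qh powi (2 * (box_exp c S p + 1) * int r) else box_pow c S q r)"
  using p S' box_exp_Suc_move(2) box_exp_move[of q c] by (auto simp: box_pow_def)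

text \<open>The move multiplies the q-character monomial by the inverse of the affine root variable
  A_(j,a) with a = q^(box_exp c S p + 1). The quotient of q-integers is the entry of the q-deformed
  Cartan matrix: q^r + q^(-r), -1 or 0.\<close>

lemma y_pow_move:
  assumes "p = pos (j :: 'n::{finite,linorder})" "r \<ge> 1"
  shows "y_pow c S' (pos k) r = y_pow c S (pos k) r -
    qh powi (2 * (box_exp c S p + 1) * int r) * (qint (cartan k j * int r) / qint (int r))"
proof -
  let ?q = "pos k"
  have r: "qint (int r) \<noteq> 0" using assms by (intro qint_nonzero) simp
  have Sp: "box_pow c S p r = qh powi (2 * box_exp c S p * int r)" "box_pow c S (Suc p) r = 0"
    using p by (simp_all add: box_pow_def)
  consider "?q = p" | "?q = Suc p" | "Suc ?q = p" | "?q \<noteq> p" "?q \<noteq> Suc p" "Suc ?q \<noteq> p" by blast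
  then show ?thesis
  proof cases
    case 1
    then have "k = j" using assms by (simp add: pos_eq_iff)
    have "qint (2 * int r) = qint (int r) * (qh powi (2 * int r) + qh powi (2 * - int r))"
      by (simp only: qint_double qq_powi)
    then have "qint (cartan k j * int r) / qint (int r) = qh powi (2 * int r) + qh powi (2 * - int r)"
      using r \<open>k = j\<close> by (simp add: cartan_def)
    then show ?thesis unfolding y_pow_def box_pow_move using 1 Sp
      by (simp add: qh_powi_mult algebra_simps)
  next
    case 2
    then have "cartan k j = - 1" using assms by (auto simp: cartan_def)
    then have "qint (cartan k j * int r) / qint (int r) = - 1"
      using r by (simp add: qint_minus)
    then show ?thesis unfolding y_pow_def box_pow_move using 2 Sp by simp
  next
    case 3
    then have "cartan k j = - 1" using assms by (auto simp: cartan_def)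
    then have "qint (cartan k j * int r) / qint (int r) = - 1"
      using r by (simp add: qint_minus)
    then show ?thesis unfolding y_pow_def box_pow_move using 3 Sp
      by (auto simp: qh_powi_mult algebra_simps)
  next
    case 4
    then have "cartan k j = 0" using assms by (auto simp: cartan_def)
    then show ?thesis unfolding y_pow_def box_pow_move using 4 by simp
  qed
qed

lemma state_weight_move:
  assumes "p = pos (j :: 'n::{finite,linorder})"
  shows "state_weight S' = - simple_root j + (state_weight S :: 'n weight)"
proof (rule vec_eq_iff[THEN iffD2, rule_format])
  fix k :: 'n
  consider "pos k = p" | "pos k = Suc p" | "Suc (pos k) = p" | "pos k \<noteq> p" "pos k \<noteq> Suc p" "Suc (pos k) \<noteq> p" by blast
  then show "state_weight S' $ k = (- simple_root j + state_weight S) $ k"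
  proof cases
    case 1
    then have "cartan j k = 2" using assms by (simp add: cartan_def pos_eq_iff)
    then show ?thesis using p S' 1 by (simp add: state_weight_def simple_root_def)
  next
    case 2
    then have "cartan j k = - 1" using assms by (auto simp: cartan_def)
    then show ?thesis using p S' 2 by (simp add: state_weight_def simple_root_def)
  next
    case 3
    then have "cartan j k = - 1" using assms by (auto simp: cartan_def)
    then show ?thesis using p S' 3 by (auto simp: state_weight_def simple_root_def)
  next
    case 4
    then have "cartan j k = 0" using assms by (auto simp: cartan_def)
    then show ?thesis using p S' 4 by (auto simp: state_weight_def simple_root_def)
  qed
qed

end

text \<open>Since G vanishes at 0 and n + 1, the boundary nodes obey the same three-term formula as
  the inner ones.\<close>

lemma sum_cartan_function:
  fixes f :: "int \<Rightarrow> qfield" and G :: "nat \<Rightarrow> qfield" and j :: "'n::{finite,linorder}"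
  assumes "f 0 = 0" "G 0 = 0" "G (CARD('n) + 1) = 0"
  shows "(\<Sum>k\<in>UNIV. G (pos k) * f (cartan j k)) = f 2 * G (pos j) + f (- 1) * (G (pos j - 1) + G (pos j + 1))"
proof -
  obtain p where p: "pos j = Suc p" using pos_bounds[of j] by (cases "pos j") auto
  have p_le: "Suc p \<le> CARD('n)" using pos_bounds(2)[of j] p by simp
  let ?F = "\<lambda>m. (if m = Suc p then f 2 * G m else 0) + (if m = p then f (- 1) * G m else 0) + (if m = p + 2 then f (- 1) * G m else 0)"
  have "(\<Sum>k\<in>UNIV. G (pos k) * f (cartan j k)) = (\<Sum>k\<in>(UNIV :: 'n set). ?F (pos k))"
    using assms(1) p by (intro sum.cong) (auto simp: cartan_def pos_eq_iff[symmetric])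
  also have "\<dots> = (\<Sum>m=1..CARD('n). ?F m)" by (rule sum_pos)
  also have "\<dots> = f 2 * G (Suc p) + f (- 1) * G p + f (- 1) * G (p + 2)"
  proof -
    have z: "G (Suc (Suc p)) = 0" if "\<not> Suc (Suc p) \<le> CARD('n)"
    proof -
      have "CARD('n) + 1 = Suc (Suc p)" using that p_le by simp
      then show ?thesis using assms(3) by simp
    qed
    have s1: "(\<Sum>m=1..CARD('n). if m = Suc p then f 2 * G m else 0) = f 2 * G (Suc p)"
      by (subst sum.delta) (use p_le in auto)
    have s2: "(\<Sum>m=1..CARD('n). if m = p then f (- 1) * G m else 0) = f (- 1) * G p"
      by (subst sum.delta) (use p_le assms(2) in \<open>auto simp: not_less_eq_eq\<close>)
    have s3: "(\<Sum>m=1..CARD('n). if m = p + 2 then f (- 1) * G m else 0) = f (- 1) * G (p + 2)"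
      by (subst sum.delta) (use z in auto)
    show ?thesis by (simp only: sum.distrib s1 s2 s3)
  qed
  finally show ?thesis by (simp add: p algebra_simps)
qed

text \<open>\<open>mcoeff\<close> inverts the q-deformed Cartan matrix, up to normalisation. On each
  side of i it is proportional to a q-integer in the distance to the end of the diagram, which the
  three-term relation kills; at i the two pieces meet.\<close>

lemma mcoeff_sum:
  fixes i j :: "'n::{finite,linorder}"
  assumes r: "r \<ge> 1"
  shows "(\<Sum>k\<in>UNIV. mcoeff i k (- int r) * qint (cartan j k * int r)) = (if j = i then qint (int r) else 0)"
proof -
  define n1 where "n1 = int CARD('n) + 1"
  define P where "P = int (pos i)"
  define D where "D = qint (n1 * int r) * qint (int r)"
  \<comment> \<open>\<open>G\<close> extends the coefficients from the nodes to 0..n + 1, with zeros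
    at both ends.\<close>
  define G where "G m = qint (min (int m) P * int r) * qint ((n1 - max (int m) P) * int r) / D" for m
  have nz: "qint (int r) \<noteq> 0" "qint (n1 * int r) \<noteq> 0" using r by (auto intro!: qint_nonzero simp: n1_def)
  then have D: "D \<noteq> 0" by (simp add: D_def)
  have P: "1 \<le> P" "P < n1" using pos_bounds[of i] by (simp_all add: P_def n1_def)
  \<comment> \<open>All four q-integers change sign under r -> -r, so the quotient is
    unchanged.\<close>
  have m: "mcoeff i k (- int r) = G (pos k)" for k
  proof -
    have le: "k \<le> i \<longleftrightarrow> pos k \<le> pos i" using pos_less_iff[of i k] by (simp add: linorder_not_less[symmetric])
    have e: "int CARD('n) - x + 1 = n1 - x" for x by (simp add: n1_def)
    show ?thesis unfolding mcoeff_def Let_def le G_def D_def e n1_def[symmetric]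
      by (auto simp: qint_minus P_def min_def max_def)
  qed
  have "(\<Sum>k\<in>UNIV. mcoeff i k (- int r) * qint (cartan j k * int r)) =
    qint (2 * int r) * G (pos j) + qint (- 1 * int r) * (G (pos j - 1) + G (pos j + 1))"
    unfolding m
    by (rule sum_cartan_function[where f = "\<lambda>a. qint (a * int r)"]) (use P in \<open>auto simp: G_def n1_def\<close>)
  also have "\<dots> = (if j = i then qint (int r) else 0)"
  proof -
    obtain a where a: "pos j = Suc a" using pos_bounds[of j] by (cases "pos j") auto
    define q where "q = int (pos j)"
    have q: "int (pos j - 1) = q - 1" "int (pos j + 1) = q + 1" by (simp_all add: q_def a)
    let ?L = "qint (2 * int r) * G (pos j) + qint (- 1 * int r) * (G (pos j - 1) + G (pos j + 1))"
    have L: "D * ?L = qint (2 * int r) * (D * G (pos j)) - qint (int r) * (D * G (pos j - 1) + D * G (pos j + 1))"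
      by (simp add: qint_minus algebra_simps)
    have G: "D * G m = qint (min (int m) P * int r) * qint ((n1 - max (int m) P) * int r)" for m
      using D by (simp add: G_def)
    consider "q < P" | "q = P" | "q > P" by linarith
    then have "D * ?L = (if q = P then D * qint (int r) else 0)"
    proof cases
      case 1
      then have "D * ?L = qint ((n1 - P) * int r) * (qint (2 * int r) * qint (q * int r) -
          qint (int r) * (qint ((q - 1) * int r) + qint ((q + 1) * int r)))"
        unfolding L G q q_def[symmetric] by (simp add: min_def max_def right_diff_distrib distrib_left mult_ac)
      then show ?thesis unfolding qint_three_term using 1 by simp
    next
      case 2
      have "D * ?L = qint ((n1 - P) * int r) * (qint (2 * int r) * qint (P * int r) - qint (int r) * qint ((P - 1) * int r)) -
          qint (int r) * (qint (P * int r) * qint ((n1 - P - 1) * int r))"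
        unfolding L G q q_def[symmetric] 2 by (simp add: min_def max_def right_diff_distrib distrib_left mult_ac diff_diff_eq)
      also have "\<dots> = qint (int r) * (qint ((P + 1) * int r) * qint ((n1 - P) * int r) - qint (P * int r) * qint ((n1 - P - 1) * int r))"
        unfolding qint_three_term by (simp add: algebra_simps)
      also have "\<dots> = qint (int r) * D"
        unfolding qint_product_difference by (simp add: D_def)
      finally show ?thesis using 2 by simp
    next
      case 3
      have e: "n1 - (q - 1) = (n1 - q) + 1" "n1 - (q + 1) = (n1 - q) - 1" by simp_all
      have mm: "min q P = P" "max q P = q" "min (q - 1) P = P" "max (q - 1) P = q - 1" "min (q + 1) P = P" "max (q + 1) P = q + 1"
        using 3 by auto
      have "D * ?L = qint (P * int r) * (qint (2 * int r) * qint ((n1 - q) * int r) -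
          qint (int r) * (qint ((n1 - q - 1) * int r) + qint ((n1 - q + 1) * int r)))"
        unfolding L G q q_def[symmetric] mm e by (simp only: right_diff_distrib distrib_left mult_ac add_ac)
      then show ?thesis unfolding qint_three_term using 3 by simp
    qed
    moreover have "q = P \<longleftrightarrow> j = i" by (simp add: q_def P_def pos_eq_iff)
    ultimately have "D * ?L = D * (if j = i then qint (int r) else 0)" by simp
    then show ?thesis by (rule mult_left_cancel[OF D, THEN iffD1])
  qed
  finally show ?thesis .
qed

text \<open>For the highest weight state {1..i} all neighbouring pairs cancel and a single variable
  Y_i survives; the offset c = i gives it the spectral parameter q^0, as i + i - 2 i = 0.\<close>

lemma is_state_Y_op: "is_state (int (pos i)) {1..pos i} (Y_op (i :: 'n::{finite,linorder}))"
proof -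
  have w: "state_weight {1..pos i} = fund_weight i"
    using pos_bounds(1) by (auto simp: vec_eq_iff state_weight_def fund_weight_def pos_eq_iff[symmetric])
  have box: "box_pow (int (pos i)) {1..pos i} q r = (if q \<le> pos i then qh powi (2 * (int (pos i) - int q) * int r) else 0)"
    if "q \<ge> 1" for q r
  proof (cases "q \<le> pos i")
    case True
    then have "{1..pos i} \<inter> {..q} = {1..q}" by auto
    then show ?thesis using True that by (simp add: box_pow_def box_exp_def)
  qed (simp add: box_pow_def)
  have y: "y_pow (int (pos i)) {1..pos i} (pos j) r = (if j = i then 1 else 0)" for j r
  proof -
    have b: "box_pow (int (pos i)) {1..pos i} (Suc (pos j)) r =
      (if Suc (pos j) \<le> pos i then qh powi (2 * (int (pos i) - int (Suc (pos j))) * int r) else 0)"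
      by (rule box) simp
    consider "pos j < pos i" | "pos j = pos i" | "pos j > pos i" by linarith
    then show ?thesis unfolding y_pow_def b box[OF pos_bounds(1)]
      by cases (auto simp: qh_powi_mult algebra_simps pos_eq_iff[symmetric])
  qed
  have "state_cre (int (pos i)) {1..pos i} (Y_cre i)"
    unfolding state_cre_def
  proof (intro allI impI)
    fix j and r :: nat assume r: "r \<ge> 1"
    have "(\<Sum>k\<in>UNIV. Y_cre i k r * qint (cartan j k * int r)) =
      qh powi int r / qint (int r) * (\<Sum>k\<in>UNIV. mcoeff i k (- int r) * qint (cartan j k * int r))"
      by (simp only: Y_cre_def sum_distrib_left mult.assoc)
    also have "\<dots> = qh powi int r * (if j = i then 1 else 0)"
      unfolding mcoeff_sum[OF r] using r qint_nonzero[of "int r"] by simp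
    finally show "(\<Sum>k\<in>UNIV. Y_cre i k r * qint (cartan j k * int r)) = qh powi int r * y_pow (int (pos i)) {1..pos i} (pos j) r"
      by (simp only: y)
  qed
  then show ?thesis using Y_op_nf[of i] unfolding is_state_def w by blast
qed

lemma qh_powi_divide: "qh powi a / qh powi b = qh powi (a - b)"
  by (simp add: power_int_diff)

section \<open>Signs\<close>

lemma bcoord_minus: "bcoord l (- \<alpha>) = - bcoord l \<alpha>"
  using bcoord_add[of l \<alpha> "- \<alpha>"] by (simp add: bcoord_zero)

lemma minus_one_powi_parity: "even (a - b) \<Longrightarrow> (- 1 :: qfield) powi a = (- 1) powi b"
  by (simp add: power_int_minus_left)

text \<open>The cocycle is a sign depending on coordinates modulo 2, where a weight and its negative
  agree.\<close>

lemma twist_minus_right: "twist \<alpha> (- \<beta>) = twist \<alpha> \<beta>" and twist_minus_left: "twist (- \<alpha>) \<beta> = twist \<alpha> \<beta>"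
  unfolding twist_def by (rule minus_one_powi_parity, simp add: bcoord_minus sum_negf)+

text \<open>The root \<open>\<alpha>\<^sub>1\<close> does not belong to the basis of the weight lattice used for the cocycle.\<close>

lemma bcoord_first_root:
  fixes j :: "'n::{finite,linorder}"
  assumes "pos j = 1" "2 \<le> l" "l \<le> CARD('n) + 1"
  shows "bcoord l (simple_root j) = (if l \<le> CARD('n) then - int l else int l)"
proof -
  \<comment> \<open>The value int l reflects alpha_1 = (n + 1) lambda_n - 2 alpha_2 - ... - n
    alpha_n.\<close>
  have "(\<Sum>k\<in>UNIV. max 0 (int l - int (pos k)) * cartan j k) =
    2 * max 0 (int l - 1) - (if CARD('n) = 1 then 0 else max 0 (int l - 2))"
    using sum_cartan_pos[of j "\<lambda>i. max 0 (int l - int i)"] assms(1) by (simp add: mult.commute)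
  also have "\<dots> = int l" using assms by (auto simp: max_def)
  finally show ?thesis using assms by (simp add: bcoord_eq simple_root_def)
qed

text \<open>The two exponents are the coordinates of the left root just above and just below pos j2.
  They vanish unless that root is alpha_1, whose coordinate at l has the parity of l; and the two
  positions differ by 2.\<close>

lemma twist_root_far:
  fixes j1 j2 :: "'n::{finite,linorder}"
  assumes "Suc (pos j1) < pos j2"
  shows "twist (simple_root j1) (simple_root j2) = twist (simple_root j2) (simple_root j1)"
proof -
  let ?E = "\<lambda>\<alpha> \<beta>. \<Sum>k=2..CARD('n). bcoord (k + 1) \<alpha> * bcoord k (\<beta> :: 'n weight)"
  have b: "pos j2 \<le> CARD('n)" "1 \<le> pos j1" using pos_bounds by auto
  have b2: "bcoord l (simple_root j2) = (if l = pos j2 then 1 else 0)" if "l \<le> CARD('n) + 1" for l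
    using that assms b by (intro bcoord_root) auto
  have "?E (simple_root j1) (simple_root j2) = (\<Sum>k=2..CARD('n). if k = pos j2 then bcoord (k + 1) (simple_root j1) else 0)"
    by (intro sum.cong) (auto simp: b2)
  also have "\<dots> = bcoord (pos j2 + 1) (simple_root j1)"
    by (subst sum.delta) (use assms b in auto)
  finally have 1: "?E (simple_root j1) (simple_root j2) = bcoord (pos j2 + 1) (simple_root j1)" .
  have "?E (simple_root j2) (simple_root j1) = (\<Sum>k=2..CARD('n). if k = pos j2 - 1 then bcoord k (simple_root j1) else 0)"
    using assms by (intro sum.cong) (auto simp: b2)
  also have "\<dots> = bcoord (pos j2 - 1) (simple_root j1)"
    by (subst sum.delta) (use assms b in auto)
  finally have 2: "?E (simple_root j2) (simple_root j1) = bcoord (pos j2 - 1) (simple_root j1)" .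
  have "even (bcoord (pos j2 + 1) (simple_root j1) - bcoord (pos j2 - 1) (simple_root j1))"
  proof (cases "pos j1 = 1")
    case True
    have "int (pos j2 - 1) = int (pos j2) - 1" using assms by simp
    moreover have "pos j2 - 1 \<le> CARD('n)" using b by simp
    ultimately show ?thesis using True assms b by (simp add: bcoord_first_root)
  next
    case False
    then have "2 \<le> pos j1" using b by simp
    then show ?thesis using assms b by (simp add: bcoord_root)
  qed
  then show ?thesis unfolding twist_def 1 2 by (rule minus_one_powi_parity)
qed

text \<open>The exponent is a sum of products of consecutive coordinates. For alpha_1 these are k (k
  + 1) up to sign, hence even; for any other root one of the two factors is 0.\<close>

lemma twist_root_self:
  fixes j :: "'n::{finite,linorder}"
  shows "twist (simple_root j) (simple_root j) = 1"
proof -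
  have "even (\<Sum>k=2..CARD('n). bcoord (k + 1) (simple_root j) * bcoord k (simple_root j))"
  proof (intro dvd_sum)
    fix k assume k: "k \<in> {2..CARD('n)}"
    show "even (bcoord (k + 1) (simple_root j) * bcoord k (simple_root j))"
    proof (cases "pos j = 1")
      case True
      then show ?thesis using k by (simp add: bcoord_first_root)
    next
      case False
      then have "2 \<le> pos j" using pos_bounds(1)[of j] by simp
      then show ?thesis using k by (simp add: bcoord_root)
    qed
  qed
  then show ?thesis unfolding twist_def by (simp add: power_int_minus_left)
qed

text \<open>By the cocycle identity the product is the twist of a root with its negative, which is
  1. Thus moving an element there and back leaves no sign.\<close>

lemma twist_opposite: "twist (simple_root j) (- simple_root j + \<delta>) * twist (- simple_root j) \<delta> = 1"
  "twist (- simple_root j) (simple_root j + \<delta>) * twist (simple_root j) \<delta> = 1"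
  using twist_cocycle[of "simple_root j" "- simple_root j" \<delta>] twist_cocycle[of "- simple_root j" "simple_root j" \<delta>]
  by (simp_all add: twist_minus_left twist_minus_right twist_root_self twist_zero)

lemma twist_commute_far:
  assumes "Suc (pos j1) < pos j2 \<or> Suc (pos j2) < pos j1"
  shows "twist (simple_root j1) (- simple_root j2 + \<delta>) * twist (- simple_root j2) \<delta> =
    twist (- simple_root j2) (simple_root j1 + \<delta>) * twist (simple_root j1) \<delta>"
proof -
  have "twist (simple_root j1) (- simple_root j2) = twist (- simple_root j2) (simple_root j1)"
    using assms twist_root_far by (auto simp: twist_minus_left twist_minus_right)
  then show ?thesis
    using twist_cocycle[of "simple_root j1" "- simple_root j2" \<delta>] twist_cocycle[of "- simple_root j2" "simple_root j1" \<delta>]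
    by (simp add: add.commute)
qed

section \<open>Action of the generators on states\<close>

text \<open>The factor [r] in \<open>heis_weight\<close> cancels the denominator in the vertex
  operator, and the remaining sum is the one fixed by \<open>state_cre\<close>.\<close>

lemma x_contraction:
  assumes "state_cre c S g" "r \<ge> 1"
  shows "(\<Sum>k\<in>UNIV. g k r * x_ann s j k r) = - of_int s * qh powi (int r - s * int r) * y_pow c S (pos j) r / of_nat r"
proof -
  have nz: "qint (int r) \<noteq> 0" using assms by (intro qint_nonzero) simp
  have "(\<Sum>k\<in>UNIV. g k r * x_ann s j k r) =
    (\<Sum>k\<in>UNIV. - of_int s * qh powi (- s * int r) / of_nat r * (g k r * qint (cartan j k * int r)))"
    using nz by (intro sum.cong) (simp_all add: x_ann_def heis_weight_def)
  also have "\<dots> = - of_int s * qh powi (- s * int r) / of_nat r * (qh powi int r * y_pow c S (pos j) r)"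
    using assms unfolding state_cre_def sum_distrib_left[symmetric] by simp
  finally have "(\<Sum>k\<in>UNIV. g k r * x_ann s j k r) =
    - of_int s * (qh powi (- s * int r) * qh powi int r) * y_pow c S (pos j) r / of_nat r" by simp
  moreover have "- s * int r + int r = int r - s * int r" by simp
  ultimately show ?thesis by (simp only: qh_powi_mult)
qed

text \<open>Here (q - 1/q) [r] = q^r - q^(-r) survives, so a single variable Y contributes both a
  pole and a zero.\<close>

lemma psi_contraction:
  assumes "state_cre c S g" "r \<ge> 1"
  shows "(\<Sum>k\<in>UNIV. g k r * psi_ann j k r) = (qh powi (3 * int r) - qh powi (- int r)) * y_pow c S (pos j) r / of_nat r"
proof -
  have "(\<Sum>k\<in>UNIV. g k r * psi_ann j k r) =
    (\<Sum>k\<in>UNIV. (qq - inverse qq) * qint (int r) / of_nat r * (g k r * qint (cartan j k * int r)))"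
    by (intro sum.cong) (simp_all add: psi_ann_def heis_weight_def)
  also have "\<dots> = (qq - inverse qq) * qint (int r) / of_nat r * (qh powi int r * y_pow c S (pos j) r)"
    using assms unfolding state_cre_def sum_distrib_left[symmetric] by simp
  also have "\<dots> = ((qq - inverse qq) * qint (int r)) * qh powi int r * y_pow c S (pos j) r / of_nat r"
    by simp
  also have "((qq - inverse qq) * qint (int r)) * qh powi int r = qh powi (3 * int r) - qh powi (- int r)"
    unfolding qint_mult unfolding qq_powi left_diff_distrib qh_powi_mult by simp
  finally show ?thesis .
qed

definition movable_down :: "nat \<Rightarrow> nat set \<Rightarrow> bool" where
  "movable_down p S \<longleftrightarrow> p \<in> S \<and> Suc p \<notin> S"

definition movable_up :: "nat \<Rightarrow> nat set \<Rightarrow> bool" where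
  "movable_up p S \<longleftrightarrow> p \<notin> S \<and> Suc p \<in> S"

definition move_down :: "nat \<Rightarrow> nat set \<Rightarrow> nat set" where
  "move_down p S = insert (Suc p) (S - {p})"

definition move_up :: "nat \<Rightarrow> nat set \<Rightarrow> nat set" where
  "move_up p S = insert p (S - {Suc p})"

text \<open>The third case unites two patterns: neither of p and Suc p lies in S, or both do and
  their contributions cancel.\<close>

lemma y_pow_eq:
  "movable_down p S \<Longrightarrow> y_pow c S p r = qh powi (2 * box_exp c S p * int r)"
  "movable_up p S \<Longrightarrow> y_pow c S p r = - (qh powi ((2 * box_exp c S (Suc p) + 2) * int r))"
  "\<not> movable_down p S \<Longrightarrow> \<not> movable_up p S \<Longrightarrow> y_pow c S p r = 0"
proof -
  show "movable_down p S \<Longrightarrow> y_pow c S p r = qh powi (2 * box_exp c S p * int r)"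
    by (simp add: y_pow_def box_pow_def movable_down_def)
  have "2 * int r + 2 * box_exp c S (Suc p) * int r = (2 * box_exp c S (Suc p) + 2) * int r"
    by (simp add: algebra_simps)
  then show "movable_up p S \<Longrightarrow> y_pow c S p r = - (qh powi ((2 * box_exp c S (Suc p) + 2) * int r))"
    by (simp add: y_pow_def box_pow_def movable_up_def qh_powi_mult)
  show "\<not> movable_down p S \<Longrightarrow> \<not> movable_up p S \<Longrightarrow> y_pow c S p r = 0"
    using y_pow_both[of p S c r] by (auto simp: movable_down_def movable_up_def y_pow_def box_pow_def)
qed

section \<open>Products of the generators with a single state\<close>

context
  fixes g h :: "'n::{finite,linorder} \<Rightarrow> nat \<Rightarrow> qfield" and \<sigma> :: "'n weight \<Rightarrow> qfield" and d :: "'n weight \<Rightarrow> int"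
    and c :: int and S :: "nat set"
  assumes st: "state_cre c S g"
begin

private abbreviation "state_op \<equiv> nf_op (int CARD('n) + 1) g h (state_weight S) \<sigma> d"

private lemma x_degree: "s * (\<beta> + \<gamma>) $ j = s * \<beta> $ j + iform (s *s simple_root j) \<gamma>"
  by (simp add: iform_root_scale distrib_left)

private lemma psi_degree: "0 = 0 + iform 0 \<gamma>"
  using iform_root_scale[of 0 j \<gamma>] by simp

private lemma x_twist: "twist (s *s simple_root j) 0 \<noteq> 0"
  by (simp add: twist_zero)

private lemma x_bullet:
  assumes "\<forall>r\<ge>1. - of_int s * qh powi (int r - s * int r) * y_pow c S (pos j) r = u ^ r - u' ^ r"
  shows "compat (x_op s j) state_op"
    and "u = 0 \<Longrightarrow> x_op s j \<bullet>\<^sub>q state_op = 0"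
    and "u = qh powi t \<Longrightarrow> x_op s j \<bullet>\<^sub>q state_op = nf_op (int CARD('n) + 1) (\<lambda>k r. u ^ r * x_cre s j k r + g k r)
      (\<lambda>k r. inverse u ^ r * x_ann s j k r + h k r) (s *s simple_root j + state_weight S)
      (\<lambda>\<beta>. (1 - u' / u) * u powi (s * \<beta> $ j) * twist (s *s simple_root j) (\<beta> + state_weight S) * \<sigma> \<beta>)
      (\<lambda>\<beta>. d \<beta> + (int CARD('n) + 1) * (s * \<beta> $ j))"
proof -
  have \<kappa>: "\<forall>r\<ge>1. (\<Sum>k\<in>UNIV. g k r * x_ann s j k r) = (u ^ r - u' ^ r) / of_nat r"
  proof (intro allI impI)
    fix r :: nat assume r: "r \<ge> 1"
    show "(\<Sum>k\<in>UNIV. g k r * x_ann s j k r) = (u ^ r - u' ^ r) / of_nat r"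
      unfolding x_contraction[OF st r] using assms[rule_format, OF r] by (simp only:)
  qed
  have d1: "\<And>\<beta>. (\<lambda>\<beta>. s * \<beta> $ j) (\<beta> + state_weight S) = (\<lambda>\<beta>. s * \<beta> $ j) \<beta> + iform (s *s simple_root j) (state_weight S)"
    by (rule x_degree)
  show "compat (x_op s j) state_op"
    unfolding x_op_nf
    using compat_nf_op[OF refl \<kappa>, where ?\<sigma>1.0 = "twist (s *s simple_root j)" and ?d1.0 = "\<lambda>\<beta>. s * \<beta> $ j", OF d1 x_twist, of "x_cre s j" h \<sigma> d]
    by (simp only: of_nat_add of_nat_1)
  show "x_op s j \<bullet>\<^sub>q state_op = 0" if "u = 0"
    unfolding x_op_nf
    using bullet_nf_op_zero[OF refl \<kappa>, where ?\<sigma>1.0 = "twist (s *s simple_root j)" and ?d1.0 = "\<lambda>\<beta>. s * \<beta> $ j", OF d1 x_twist that, of "x_cre s j" h \<sigma> d]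
    by (simp only: of_nat_add of_nat_1)
  show "x_op s j \<bullet>\<^sub>q state_op = nf_op (int CARD('n) + 1) (\<lambda>k r. u ^ r * x_cre s j k r + g k r)
      (\<lambda>k r. inverse u ^ r * x_ann s j k r + h k r) (s *s simple_root j + state_weight S)
      (\<lambda>\<beta>. (1 - u' / u) * u powi (s * \<beta> $ j) * twist (s *s simple_root j) (\<beta> + state_weight S) * \<sigma> \<beta>)
      (\<lambda>\<beta>. d \<beta> + (int CARD('n) + 1) * (s * \<beta> $ j))" if "u = qh powi t"
    unfolding x_op_nf
    using bullet_nf_op[OF refl \<kappa>, where ?\<sigma>1.0 = "twist (s *s simple_root j)" and ?d1.0 = "\<lambda>\<beta>. s * \<beta> $ j", OF d1 x_twist that, of "x_cre s j" h \<sigma> d]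
    by (simp only: of_nat_add of_nat_1)
qed

private lemma psi_bullet:
  assumes "\<forall>r\<ge>1. (qh powi (3 * int r) - qh powi (- int r)) * y_pow c S (pos j) r = u ^ r - u' ^ r"
  shows "compat (psi_op j) state_op"
    and "u = 0 \<Longrightarrow> psi_op j \<bullet>\<^sub>q state_op = 0"
    and "u = qh powi t \<Longrightarrow> psi_op j \<bullet>\<^sub>q state_op = nf_op (int CARD('n) + 1) (\<lambda>k r. u ^ r * 0 + g k r)
      (\<lambda>k r. inverse u ^ r * psi_ann j k r + h k r) (0 + state_weight S)
      (\<lambda>\<beta>. (1 - u' / u) * u powi 0 * qq powi ((\<beta> + state_weight S) $ j) * \<sigma> \<beta>)
      (\<lambda>\<beta>. d \<beta> + (int CARD('n) + 1) * 0)"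
proof -
  have \<kappa>: "\<forall>r\<ge>1. (\<Sum>k\<in>UNIV. g k r * psi_ann j k r) = (u ^ r - u' ^ r) / of_nat r"
  proof (intro allI impI)
    fix r :: nat assume r: "r \<ge> 1"
    show "(\<Sum>k\<in>UNIV. g k r * psi_ann j k r) = (u ^ r - u' ^ r) / of_nat r"
      unfolding psi_contraction[OF st r] using assms[rule_format, OF r] by (simp only:)
  qed
  have d1: "\<And>\<beta>. (\<lambda>\<beta>. 0 :: int) (\<beta> + state_weight S) = (\<lambda>\<beta>. 0) \<beta> + iform 0 (state_weight S :: 'n weight)"
    by (rule psi_degree)
  have \<sigma>1: "(\<lambda>\<beta>. qq powi (\<beta> :: 'n weight) $ j) 0 \<noteq> 0" by simp
  show "compat (psi_op j) state_op"
    unfolding psi_op_nf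
    using compat_nf_op[OF refl \<kappa>, where ?\<sigma>1.0 = "\<lambda>\<beta>. qq powi \<beta> $ j" and ?d1.0 = "\<lambda>\<beta>. 0", OF d1 \<sigma>1, of "\<lambda>k r. 0" h \<sigma> d]
    by (simp only: of_nat_add of_nat_1)
  show "psi_op j \<bullet>\<^sub>q state_op = 0" if "u = 0"
    unfolding psi_op_nf
    using bullet_nf_op_zero[OF refl \<kappa>, where ?\<sigma>1.0 = "\<lambda>\<beta>. qq powi \<beta> $ j" and ?d1.0 = "\<lambda>\<beta>. 0", OF d1 \<sigma>1 that, of "\<lambda>k r. 0" h \<sigma> d]
    by (simp only: of_nat_add of_nat_1)
  show "psi_op j \<bullet>\<^sub>q state_op = nf_op (int CARD('n) + 1) (\<lambda>k r. u ^ r * 0 + g k r)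
      (\<lambda>k r. inverse u ^ r * psi_ann j k r + h k r) (0 + state_weight S)
      (\<lambda>\<beta>. (1 - u' / u) * u powi 0 * qq powi ((\<beta> + state_weight S) $ j) * \<sigma> \<beta>)
      (\<lambda>\<beta>. d \<beta> + (int CARD('n) + 1) * 0)" if "u = qh powi t"
    unfolding psi_op_nf
    using bullet_nf_op[OF refl \<kappa>, where ?\<sigma>1.0 = "\<lambda>\<beta>. qq powi \<beta> $ j" and ?d1.0 = "\<lambda>\<beta>. 0", OF d1 \<sigma>1 that, of "\<lambda>k r. 0" h \<sigma> d]
    by (simp only: of_nat_add of_nat_1)
qed

lemma phi_bullet: "compat (phi_op j) state_op" "phi_op j \<bullet>\<^sub>q state_op = 0"
proof -
  have \<kappa>: "\<forall>r\<ge>1. (\<Sum>k\<in>UNIV. g k r * 0) = ((0 :: qfield) ^ r - 0 ^ r) / of_nat r" by simp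
  have d1: "\<And>\<beta>. (\<lambda>\<beta>. 0 :: int) (\<beta> + state_weight S) = (\<lambda>\<beta>. 0) \<beta> + iform 0 (state_weight S :: 'n weight)"
    by (rule psi_degree)
  have \<sigma>1: "(\<lambda>\<beta>. qq powi (- (\<beta> :: 'n weight) $ j)) 0 \<noteq> 0" by simp
  show "compat (phi_op j) state_op"
    unfolding phi_op_nf
    using compat_nf_op[OF refl \<kappa>, where ?\<sigma>1.0 = "\<lambda>\<beta>. qq powi (- \<beta> $ j)" and ?d1.0 = "\<lambda>\<beta>. 0", OF d1 \<sigma>1, of _ h \<sigma> d]
    by (simp only: of_nat_add of_nat_1)
  show "phi_op j \<bullet>\<^sub>q state_op = 0"
    unfolding phi_op_nf
    using bullet_nf_op_zero[OF refl \<kappa>, where ?\<sigma>1.0 = "\<lambda>\<beta>. qq powi (- \<beta> $ j)" and ?d1.0 = "\<lambda>\<beta>. 0", OF d1 \<sigma>1 refl, of _ h \<sigma> d]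
    by (simp only: of_nat_add of_nat_1)
qed

text \<open>For x^- a variable Y gives the pole, at q^(box_exp + 1). An inverse variable gives only
  a zero: the contraction is 1 - u' t, encoded by u = 0.\<close>

private lemma x_minus_poles:
  "movable_down (pos j) S \<Longrightarrow> \<forall>r\<ge>1. - of_int (- 1) * qh powi (int r - (- 1) * int r) * y_pow c S (pos j) r =
    (qh powi (2 * box_exp c S (pos j) + 2)) ^ r - 0 ^ r"
  "\<not> movable_down (pos j) S \<Longrightarrow> \<exists>u'. \<forall>r\<ge>1. - of_int (- 1) * qh powi (int r - (- 1) * int r) * y_pow c S (pos j) r = 0 ^ r - u' ^ r"
proof -
  show "movable_down (pos j) S \<Longrightarrow> \<forall>r\<ge>1. - of_int (- 1) * qh powi (int r - (- 1) * int r) * y_pow c S (pos j) r =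
    (qh powi (2 * box_exp c S (pos j) + 2)) ^ r - 0 ^ r"
    by (simp add: y_pow_eq qh_powi_power qh_powi_mult algebra_simps)
  assume d: "\<not> movable_down (pos j) S"
  show "\<exists>u'. \<forall>r\<ge>1. - of_int (- 1) * qh powi (int r - (- 1) * int r) * y_pow c S (pos j) r = 0 ^ r - u' ^ r"
  proof (cases "movable_up (pos j) S")
    case True
    then show ?thesis
      by (intro exI[of _ "qh powi (2 * box_exp c S (Suc (pos j)) + 4)"])
        (simp add: y_pow_eq qh_powi_power qh_powi_mult algebra_simps)
  next
    case False
    with d show ?thesis by (intro exI[of _ 0]) (simp add: y_pow_eq)
  qed
qed

text \<open>The sign of the contraction is reversed, so the inverse variable gives the pole and Y
  the zero.\<close>

private lemma x_plus_poles:
  "movable_up (pos j) S \<Longrightarrow> \<forall>r\<ge>1. - of_int 1 * qh powi (int r - 1 * int r) * y_pow c S (pos j) r =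
    (qh powi (2 * box_exp c S (Suc (pos j)) + 2)) ^ r - 0 ^ r"
  "\<not> movable_up (pos j) S \<Longrightarrow> \<exists>u'. \<forall>r\<ge>1. - of_int 1 * qh powi (int r - 1 * int r) * y_pow c S (pos j) r = 0 ^ r - u' ^ r"
proof -
  show "movable_up (pos j) S \<Longrightarrow> \<forall>r\<ge>1. - of_int 1 * qh powi (int r - 1 * int r) * y_pow c S (pos j) r =
    (qh powi (2 * box_exp c S (Suc (pos j)) + 2)) ^ r - 0 ^ r"
    by (simp add: y_pow_eq qh_powi_power)
  assume d: "\<not> movable_up (pos j) S"
  show "\<exists>u'. \<forall>r\<ge>1. - of_int 1 * qh powi (int r - 1 * int r) * y_pow c S (pos j) r = 0 ^ r - u' ^ r"
  proof (cases "movable_down (pos j) S")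
    case True
    then show ?thesis
      by (intro exI[of _ "qh powi (2 * box_exp c S (pos j))"]) (simp add: y_pow_eq qh_powi_power)
  next
    case False
    with d show ?thesis by (intro exI[of _ 0]) (simp add: y_pow_eq)
  qed
qed

lemma x_minus_stop: "\<not> movable_down (pos j) S \<Longrightarrow> x_op (- 1) j \<bullet>\<^sub>q state_op = 0"
  by (elim exE[OF x_minus_poles(2)]) (rule x_bullet(2)[OF _ refl])

lemma x_plus_stop: "\<not> movable_up (pos j) S \<Longrightarrow> x_op 1 j \<bullet>\<^sub>q state_op = 0"
  by (elim exE[OF x_plus_poles(2)]) (rule x_bullet(2)[OF _ refl])

lemma x_compat: "compat (x_op (- 1) j) state_op" "compat (x_op 1 j) state_op"
proof -
  show "compat (x_op (- 1) j) state_op"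
  proof (cases "movable_down (pos j) S")
    case True
    show ?thesis by (rule x_bullet(1)[OF x_minus_poles(1)[OF True]])
  next
    case False
    show ?thesis by (rule exE[OF x_minus_poles(2)[OF False]]) (rule x_bullet(1))
  qed
  show "compat (x_op 1 j) state_op"
  proof (cases "movable_up (pos j) S")
    case True
    show ?thesis by (rule x_bullet(1)[OF x_plus_poles(1)[OF True]])
  next
    case False
    show ?thesis by (rule exE[OF x_plus_poles(2)[OF False]]) (rule x_bullet(1))
  qed
qed

text \<open>The contraction has no zero (u' = 0), so the residue factor is 1. At the pole, the
  creation part of x^- changes the pairings by exactly the inverse affine root variable of
  \<open>y_pow_move\<close>.\<close>

lemma
  assumes m: "movable_down (pos j) S" and u: "u = qh powi (2 * box_exp c S (pos j) + 2)"
  shows x_minus_move: "x_op (- 1) j \<bullet>\<^sub>q state_op = nf_op (int CARD('n) + 1) (\<lambda>k r. u ^ r * x_cre (- 1) j k r + g k r)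
      (\<lambda>k r. inverse u ^ r * x_ann (- 1) j k r + h k r) (state_weight (move_down (pos j) S))
      (\<lambda>\<beta>. u powi (- \<beta> $ j) * twist (- simple_root j) (\<beta> + state_weight S) * \<sigma> \<beta>)
      (\<lambda>\<beta>. d \<beta> - (int CARD('n) + 1) * \<beta> $ j)"
    and state_cre_move_down: "state_cre c (move_down (pos j) S) (\<lambda>k r. u ^ r * x_cre (- 1) j k r + g k r)"
    and state_weight_move_down: "state_weight (move_down (pos j) S) = - simple_root j + (state_weight S :: 'n weight)"
proof -
  note p = m[unfolded movable_down_def]
  have w: "(- 1) *s simple_root j = - simple_root j"
    by (simp add: vec_eq_iff)
  show w': "state_weight (move_down (pos j) S) = - simple_root j + (state_weight S :: 'n weight)"
    by (rule state_weight_move) (use p in \<open>auto simp: move_down_def\<close>)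
  show "x_op (- 1) j \<bullet>\<^sub>q state_op = nf_op (int CARD('n) + 1) (\<lambda>k r. u ^ r * x_cre (- 1) j k r + g k r)
      (\<lambda>k r. inverse u ^ r * x_ann (- 1) j k r + h k r) (state_weight (move_down (pos j) S))
      (\<lambda>\<beta>. u powi (- \<beta> $ j) * twist (- simple_root j) (\<beta> + state_weight S) * \<sigma> \<beta>)
      (\<lambda>\<beta>. d \<beta> - (int CARD('n) + 1) * \<beta> $ j)"
    unfolding x_bullet(3)[OF x_minus_poles(1)[OF m, folded u] u] w'
    by (rule nf_op_cong) (simp_all add: w)
  show "state_cre c (move_down (pos j) S) (\<lambda>k r. u ^ r * x_cre (- 1) j k r + g k r)"
    unfolding state_cre_def
  proof (intro allI impI)
    fix k :: 'n and r :: nat assume r: "r \<ge> 1"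
    have y: "y_pow c (move_down (pos j) S) (pos k) r = y_pow c S (pos k) r -
       qh powi (2 * (box_exp c S (pos j) + 1) * int r) * (qint (cartan k j * int r) / qint (int r))"
      by (rule y_pow_move) (use p r in \<open>auto simp: move_down_def\<close>)
    have "(\<Sum>l\<in>UNIV. (u ^ r * x_cre (- 1) j l r + g l r) * qint (cartan k l * int r)) =
      (\<Sum>l\<in>UNIV. if l = j then - (u ^ r * qh powi int r / qint (int r) * qint (cartan k j * int r)) else 0) +
      (\<Sum>l\<in>UNIV. g l r * qint (cartan k l * int r))"
      unfolding sum.distrib[symmetric] by (intro sum.cong) (auto simp: x_cre_def distrib_right)
    also have "\<dots> = qh powi int r * y_pow c (move_down (pos j) S) (pos k) r"
      using st r unfolding state_cre_def y u by (simp add: qh_powi_power algebra_simps)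
    finally show "(\<Sum>l\<in>UNIV. (u ^ r * x_cre (- 1) j l r + g l r) * qint (cartan k l * int r)) =
      qh powi int r * y_pow c (move_down (pos j) S) (pos k) r" .
  qed
qed

text \<open>Here \<open>y_pow_move\<close> is read backwards: S arises from the new set by moving
  pos j down.\<close>

lemma
  assumes m: "movable_up (pos j) S" and u: "u = qh powi (2 * box_exp c S (Suc (pos j)) + 2)"
  shows x_plus_move: "x_op 1 j \<bullet>\<^sub>q state_op = nf_op (int CARD('n) + 1) (\<lambda>k r. u ^ r * x_cre 1 j k r + g k r)
      (\<lambda>k r. inverse u ^ r * x_ann 1 j k r + h k r) (state_weight (move_up (pos j) S))
      (\<lambda>\<beta>. u powi (\<beta> $ j) * twist (simple_root j) (\<beta> + state_weight S) * \<sigma> \<beta>)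
      (\<lambda>\<beta>. d \<beta> + (int CARD('n) + 1) * \<beta> $ j)"
    and state_cre_move_up: "state_cre c (move_up (pos j) S) (\<lambda>k r. u ^ r * x_cre 1 j k r + g k r)"
    and state_weight_move_up: "state_weight (move_up (pos j) S) = simple_root j + (state_weight S :: 'n weight)"
proof -
  let ?S = "move_up (pos j) S"
  have p: "pos j \<in> ?S" "Suc (pos j) \<notin> ?S" "S = insert (Suc (pos j)) (?S - {pos j})"
    using m by (auto simp: movable_up_def move_up_def)
  have "state_weight S = - simple_root j + (state_weight ?S :: 'n weight)"
    by (rule state_weight_move[OF p refl])
  then show w': "state_weight ?S = simple_root j + (state_weight S :: 'n weight)" by simp
  have w: "1 *s simple_root j = simple_root j"
    by (simp add: vec_eq_iff)
  show "x_op 1 j \<bullet>\<^sub>q state_op = nf_op (int CARD('n) + 1) (\<lambda>k r. u ^ r * x_cre 1 j k r + g k r)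
      (\<lambda>k r. inverse u ^ r * x_ann 1 j k r + h k r) (state_weight (move_up (pos j) S))
      (\<lambda>\<beta>. u powi (\<beta> $ j) * twist (simple_root j) (\<beta> + state_weight S) * \<sigma> \<beta>)
      (\<lambda>\<beta>. d \<beta> + (int CARD('n) + 1) * \<beta> $ j)"
    unfolding x_bullet(3)[OF x_plus_poles(1)[OF m, folded u] u] w'
    by (rule nf_op_cong) (simp_all add: w)
  show "state_cre c ?S (\<lambda>k r. u ^ r * x_cre 1 j k r + g k r)"
    unfolding state_cre_def
  proof (intro allI impI)
    fix k :: 'n and r :: nat assume r: "r \<ge> 1"
    have "y_pow c S (pos k) r = y_pow c ?S (pos k) r -
       qh powi (2 * (box_exp c ?S (pos j) + 1) * int r) * (qint (cartan k j * int r) / qint (int r))"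
      by (rule y_pow_move[OF p refl r])
    then have y: "y_pow c ?S (pos k) r = y_pow c S (pos k) r +
       qh powi (2 * box_exp c S (Suc (pos j)) * int r) * (qint (cartan k j * int r) / qint (int r))"
      by (simp add: box_exp_Suc_move(2)[OF p])
    \<comment> \<open>With t the exponent at Suc (pos j), the factor q^(-r/2) of x^+ differs from
      q^(r/2) in \<open>state_cre\<close> by q^r; the pole position q^(t + 1) instead of q^t makes
      up for it.\<close>
    have "(2 * box_exp c S (Suc (pos j)) + 2) * int r + - int r = int r + 2 * box_exp c S (Suc (pos j)) * int r"
      by (simp add: algebra_simps)
    then have e: "u ^ r * qh powi (- int r) = qh powi int r * qh powi (2 * box_exp c S (Suc (pos j)) * int r)"
      unfolding u qh_powi_power qh_powi_mult by simp
    have "(\<Sum>l\<in>UNIV. (u ^ r * x_cre 1 j l r + g l r) * qint (cartan k l * int r)) =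
      (\<Sum>l\<in>UNIV. if l = j then u ^ r * qh powi (- int r) * (qint (cartan k j * int r) / qint (int r)) else 0) +
      (\<Sum>l\<in>UNIV. g l r * qint (cartan k l * int r))"
      unfolding sum.distrib[symmetric] by (intro sum.cong) (auto simp: x_cre_def distrib_right)
    also have "\<dots> = qh powi int r * y_pow c ?S (pos k) r"
      using st r unfolding state_cre_def y e by (simp add: distrib_left mult.assoc add.commute)
    finally show "(\<Sum>l\<in>UNIV. (u ^ r * x_cre 1 j l r + g l r) * qint (cartan k l * int r)) =
      qh powi int r * y_pow c ?S (pos k) r" .
  qed
qed

text \<open>Pole and zero differ by a factor q^2, in a direction that depends on whether Y or its
  inverse occurs; this fixes the residue factor 1 - u'/u.\<close>

private lemma psi_poles:
  "movable_down (pos j) S \<Longrightarrow> \<forall>r\<ge>1. (qh powi (3 * int r) - qh powi (- int r)) * y_pow c S (pos j) r =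
    (qh powi (2 * box_exp c S (pos j) + 3)) ^ r - (qh powi (2 * box_exp c S (pos j) - 1)) ^ r"
  "movable_up (pos j) S \<Longrightarrow> \<forall>r\<ge>1. (qh powi (3 * int r) - qh powi (- int r)) * y_pow c S (pos j) r =
    (qh powi (2 * box_exp c S (Suc (pos j)) + 1)) ^ r - (qh powi (2 * box_exp c S (Suc (pos j)) + 5)) ^ r"
  "\<not> movable_down (pos j) S \<Longrightarrow> \<not> movable_up (pos j) S \<Longrightarrow>
    \<forall>r\<ge>1. (qh powi (3 * int r) - qh powi (- int r)) * y_pow c S (pos j) r = 0 ^ r - 0 ^ r"
proof -
  have "3 * int r + 2 * t * int r = (2 * t + 3) * int r" "- int r + 2 * t * int r = (2 * t - 1) * int r"
    "3 * int r + (2 * t + 2) * int r = (2 * t + 5) * int r" "- int r + (2 * t + 2) * int r = (2 * t + 1) * int r" for r t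
    by (simp_all add: algebra_simps)
  note e = this
  show "movable_down (pos j) S \<Longrightarrow> \<forall>r\<ge>1. (qh powi (3 * int r) - qh powi (- int r)) * y_pow c S (pos j) r =
    (qh powi (2 * box_exp c S (pos j) + 3)) ^ r - (qh powi (2 * box_exp c S (pos j) - 1)) ^ r"
    by (simp only: y_pow_eq qh_powi_power left_diff_distrib qh_powi_mult e) simp
  show "movable_up (pos j) S \<Longrightarrow> \<forall>r\<ge>1. (qh powi (3 * int r) - qh powi (- int r)) * y_pow c S (pos j) r =
    (qh powi (2 * box_exp c S (Suc (pos j)) + 1)) ^ r - (qh powi (2 * box_exp c S (Suc (pos j)) + 5)) ^ r"
    by (simp only: y_pow_eq qh_powi_power left_diff_distrib mult_minus_right qh_powi_mult e) simp
  show "\<not> movable_down (pos j) S \<Longrightarrow> \<not> movable_up (pos j) S \<Longrightarrow>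
    \<forall>r\<ge>1. (qh powi (3 * int r) - qh powi (- int r)) * y_pow c S (pos j) r = 0 ^ r - 0 ^ r"
    by (simp add: y_pow_eq)
qed

lemma psi_stop: "\<not> movable_down (pos j) S \<Longrightarrow> \<not> movable_up (pos j) S \<Longrightarrow> psi_op j \<bullet>\<^sub>q state_op = 0"
  by (rule psi_bullet(2)[OF psi_poles(3) refl])

lemma psi_compat: "compat (psi_op j) state_op"
proof -
  consider "movable_down (pos j) S" | "movable_up (pos j) S" | "\<not> movable_down (pos j) S" "\<not> movable_up (pos j) S" by blast
  then show ?thesis
    by cases (rule psi_bullet(1)[OF psi_poles(1)] psi_bullet(1)[OF psi_poles(2)] psi_bullet(1)[OF psi_poles(3)]; assumption)+
qed

lemma psi_down:
  assumes "movable_down (pos j) S" "u = qh powi (2 * box_exp c S (pos j) + 3)"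
  shows "psi_op j \<bullet>\<^sub>q state_op = nf_op (int CARD('n) + 1) g (\<lambda>k r. inverse u ^ r * psi_ann j k r + h k r) (state_weight S)
      (\<lambda>\<beta>. (1 - qh powi (- 4)) * qh powi (2 * \<beta> $ j + 2) * \<sigma> \<beta>) d"
proof -
  have e: "qh powi (2 * box_exp c S (pos j) - 1) / u = qh powi (- 4)"
    unfolding assms(2) qh_powi_divide by simp
  \<comment> \<open>This value enters through K_j, which acts on the weight already shifted by the
    state and so contributes one more q.\<close>
  have "state_weight S $ j = 1" using assms by (simp add: state_weight_def movable_down_def)
  then show ?thesis
    unfolding psi_bullet(3)[OF psi_poles(1)[OF assms(1), folded assms(2)] assms(2)] e
    by (intro nf_op_cong) (simp_all add: qq_powi distrib_left)
qed

lemma psi_up: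
  assumes "movable_up (pos j) S" "u = qh powi (2 * box_exp c S (Suc (pos j)) + 1)"
  shows "psi_op j \<bullet>\<^sub>q state_op = nf_op (int CARD('n) + 1) g (\<lambda>k r. inverse u ^ r * psi_ann j k r + h k r) (state_weight S)
      (\<lambda>\<beta>. (1 - qh powi 4) * qh powi (2 * \<beta> $ j - 2) * \<sigma> \<beta>) d"
proof -
  have e: "qh powi (2 * box_exp c S (Suc (pos j)) + 5) / u = qh powi 4"
    unfolding assms(2) qh_powi_divide by simp
  have "state_weight S $ j = - 1" using assms by (simp add: state_weight_def movable_up_def)
  then show ?thesis
    unfolding psi_bullet(3)[OF psi_poles(2)[OF assms(1), folded assms(2)] assms(2)] e
    by (intro nf_op_cong) (simp_all add: qq_powi right_diff_distrib)
qed

end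

lemma bullet_zero:
  fixes a :: "'n::{finite,linorder} vop"
  assumes "a 0 = 0"
  shows "a \<bullet>\<^sub>q 0 = 0"
proof -
  have "q_dilate s a 0 = 0" for s
    by (simp add: q_dilate_def assms v_scale_zero zero_fls_def[symmetric])
  then have "bullet_wt 0 a 0 = 0"
    by (simp add: bullet_wt_def Let_def rprod_zero z_pow_mult_zero[OF refl])
  then show ?thesis
    by (simp add: bullet_homogeneous[of a 0 0, OF assms op_component_zero[OF refl]])
qed

lemma x_op_add: "x_op s j (v + w) = x_op s j v + x_op s j w"
  unfolding x_op_nf by (rule nf_op_add) simp

lemma x_op_zero: "x_op s j 0 = 0"
  using x_op_add[of s j 0 0] by simp

text \<open>With t the exponent at pos j, x^- is evaluated at q^(t+1), then x^+ at q^(t+2), and the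
  pole of psi is their geometric mean. The half powers of q in the vertex operators make the
  creation parts cancel and the annihilation parts combine to q^r - q^(-r). The scalars agree by (1
  - q^(-2)) q^(b+1) = (q - 1/q) q^b with b = \<beta> $ j.\<close>

lemma diagonal_down:
  fixes g h :: "'n::{finite,linorder} \<Rightarrow> nat \<Rightarrow> qfield"
  assumes st: "state_cre c S g" and m: "movable_down (pos j) S"
    and b: "b = nf_op (int CARD('n) + 1) g h (state_weight S) \<sigma> d"
  shows "x_op 1 j \<bullet>\<^sub>q x_op (- 1) j \<bullet>\<^sub>q b = op_scale (1 / (qq - inverse qq)) (psi_op j \<bullet>\<^sub>q b)"
proof -
  let ?t = "box_exp c S (pos j)" and ?S' = "move_down (pos j) S"
  define u1 where "u1 = qh powi (2 * ?t + 2)"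
  define u2 where "u2 = qh powi (2 * ?t + 4)"
  define u3 where "u3 = qh powi (2 * ?t + 3)"
  have p: "pos j \<in> S" "Suc (pos j) \<notin> S" using m by (simp_all add: movable_down_def)
  have m': "movable_up (pos j) ?S'" and S: "move_up (pos j) ?S' = S"
    using p by (auto simp: movable_up_def move_up_def move_down_def)
  have "box_exp c ?S' (Suc (pos j)) = ?t + 1"
    by (rule box_exp_Suc_move(2)[OF p]) (simp add: move_down_def)
  then have u2: "u2 = qh powi (2 * box_exp c ?S' (Suc (pos j)) + 2)" by (simp add: u2_def algebra_simps)
  have "x_op 1 j \<bullet>\<^sub>q x_op (- 1) j \<bullet>\<^sub>q b = nf_op (int CARD('n) + 1)
      (\<lambda>k r. u2 ^ r * x_cre 1 j k r + (u1 ^ r * x_cre (- 1) j k r + g k r))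
      (\<lambda>k r. inverse u2 ^ r * x_ann 1 j k r + (inverse u1 ^ r * x_ann (- 1) j k r + h k r)) (state_weight S)
      (\<lambda>\<beta>. u2 powi (\<beta> $ j) * twist (simple_root j) (\<beta> + state_weight ?S') *
         (u1 powi (- \<beta> $ j) * twist (- simple_root j) (\<beta> + state_weight S) * \<sigma> \<beta>))
      (\<lambda>\<beta>. d \<beta> - (int CARD('n) + 1) * \<beta> $ j + (int CARD('n) + 1) * \<beta> $ j)"
    unfolding b x_minus_move[OF st m u1_def] x_plus_move[OF state_cre_move_down[OF st m u1_def] m' u2] S ..
  also have "\<dots> = nf_op (int CARD('n) + 1) g (\<lambda>k r. inverse u3 ^ r * psi_ann j k r + h k r) (state_weight S)
      (\<lambda>\<beta>. 1 / (qq - inverse qq) * ((1 - qh powi (- 4)) * qh powi (2 * \<beta> $ j + 2) * \<sigma> \<beta>)) d"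
  proof (rule nf_op_cong)
    fix k and r :: nat assume r: "r \<ge> 1"
    have nz: "qint (int r) \<noteq> 0" using r by (intro qint_nonzero) simp
    have "(2 * ?t + 4) * int r + - int r = (2 * ?t + 2) * int r + int r" by (simp add: algebra_simps)
    then have "u2 ^ r * qh powi (- int r) = u1 ^ r * qh powi int r"
      unfolding u1_def u2_def qh_powi_power qh_powi_mult by (simp only:)
    then show "u2 ^ r * x_cre 1 j k r + (u1 ^ r * x_cre (- 1) j k r + g k r) = g k r"
      by (simp add: x_cre_def)
    have "- ((2 * ?t + 4) * int r) + - int r = - ((2 * ?t + 3) * int r) + - (2 * int r)"
      "- ((2 * ?t + 2) * int r) + int r = - ((2 * ?t + 3) * int r) + 2 * int r" by (simp_all add: algebra_simps)
    then have e: "inverse u2 ^ r * qh powi (- int r) = inverse u3 ^ r * qq powi (- int r)"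
      "inverse u1 ^ r * qh powi int r = inverse u3 ^ r * qq powi int r"
      unfolding u1_def u2_def u3_def inverse_qh_powi qh_powi_power qq_powi qh_powi_mult mult_minus_left mult_minus_right by (simp_all only:)
    have "inverse u2 ^ r * x_ann 1 j k r + inverse u1 ^ r * x_ann (- 1) j k r =
      (inverse u1 ^ r * qh powi int r - inverse u2 ^ r * qh powi (- int r)) * (heis_weight j k r / qint (int r))"
      by (simp add: x_ann_def algebra_simps diff_divide_distrib)
    also have "\<dots> = inverse u3 ^ r * ((qq - inverse qq) * qint (int r)) * (heis_weight j k r / qint (int r))"
      unfolding e qint_mult by (simp add: algebra_simps)
    also have "\<dots> = inverse u3 ^ r * psi_ann j k r"
      using nz by (simp add: psi_ann_def)
    finally show "inverse u2 ^ r * x_ann 1 j k r + (inverse u1 ^ r * x_ann (- 1) j k r + h k r) =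
      inverse u3 ^ r * psi_ann j k r + h k r" by (simp add: add.assoc[symmetric])
  next
    fix \<beta> :: "'n weight"
    have "twist (simple_root j) (\<beta> + state_weight ?S') * twist (- simple_root j) (\<beta> + state_weight S) = 1"
      using twist_opposite(1)[of j "\<beta> + state_weight S"] unfolding state_weight_move_down[OF st m u1_def]
      by (simp add: add_ac)
    then have "u2 powi (\<beta> $ j) * twist (simple_root j) (\<beta> + state_weight ?S') *
         (u1 powi (- \<beta> $ j) * twist (- simple_root j) (\<beta> + state_weight S) * \<sigma> \<beta>) =
      (u2 powi (\<beta> $ j) * u1 powi (- \<beta> $ j)) * \<sigma> \<beta>"
      by (simp add: mult_ac)
    also have "u2 powi (\<beta> $ j) * u1 powi (- \<beta> $ j) = qh powi (2 * \<beta> $ j)"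
    proof -
      have "(2 * ?t + 4) * \<beta> $ j + (2 * ?t + 2) * - \<beta> $ j = 2 * \<beta> $ j" by (simp add: algebra_simps)
      then show ?thesis unfolding u1_def u2_def power_int_mult[symmetric] qh_powi_mult by simp
    qed
    also have "\<dots> = 1 / (qq - inverse qq) * ((1 - qh powi (- 4)) * qh powi (2 * \<beta> $ j + 2))"
    proof -
      have "(1 - qh powi (- 4)) * qh powi (2 * \<beta> $ j + 2) = (qq powi 1 - qq powi (- 1)) * qh powi (2 * \<beta> $ j)"
        unfolding qq_powi left_diff_distrib qh_powi_mult by (simp add: add.commute)
      then show ?thesis using qq_minus_inverse_nonzero by (simp add: power_int_minus)
    qed
    finally show "u2 powi (\<beta> $ j) * twist (simple_root j) (\<beta> + state_weight ?S') *
         (u1 powi (- \<beta> $ j) * twist (- simple_root j) (\<beta> + state_weight S) * \<sigma> \<beta>) =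
      1 / (qq - inverse qq) * ((1 - qh powi (- 4)) * qh powi (2 * \<beta> $ j + 2) * \<sigma> \<beta>)"
      by (simp only: mult.assoc)
  qed simp_all
  also have "\<dots> = op_scale (1 / (qq - inverse qq)) (psi_op j \<bullet>\<^sub>q b)"
    unfolding b psi_down[OF st m u3_def] by (rule nf_op_scale[symmetric]) simp
  finally show ?thesis .
qed

text \<open>The mirror case, with t the exponent at Suc (pos j): x^+ at q^(t+1), then x^- at q^t,
  and psi at q^(t+1/2). The sign comes from (1 - q^2) q^(b-1) = - (q - 1/q) q^b and matches the
  second term of the commutator.\<close>

lemma diagonal_up:
  fixes g h :: "'n::{finite,linorder} \<Rightarrow> nat \<Rightarrow> qfield"
  assumes st: "state_cre c S g" and m: "movable_up (pos j) S"
    and b: "b = nf_op (int CARD('n) + 1) g h (state_weight S) \<sigma> d"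
  shows "x_op (- 1) j \<bullet>\<^sub>q x_op 1 j \<bullet>\<^sub>q b = op_scale (- 1 / (qq - inverse qq)) (psi_op j \<bullet>\<^sub>q b)"
proof -
  let ?t = "box_exp c S (Suc (pos j))" and ?S' = "move_up (pos j) S"
  define u1 where "u1 = qh powi (2 * ?t + 2)"
  define u2 where "u2 = qh powi (2 * ?t)"
  define u3 where "u3 = qh powi (2 * ?t + 1)"
  have p: "pos j \<notin> S" "Suc (pos j) \<in> S" using m by (simp_all add: movable_up_def)
  have m': "movable_down (pos j) ?S'" and S: "move_down (pos j) ?S' = S"
    using p by (auto simp: movable_down_def move_up_def move_down_def)
  have "?t = box_exp c ?S' (pos j) + 1"
    by (rule box_exp_Suc_move(2)) (use p in \<open>auto simp: move_up_def\<close>)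
  then have u2: "u2 = qh powi (2 * box_exp c ?S' (pos j) + 2)" by (simp add: u2_def)
  have "x_op (- 1) j \<bullet>\<^sub>q x_op 1 j \<bullet>\<^sub>q b = nf_op (int CARD('n) + 1)
      (\<lambda>k r. u2 ^ r * x_cre (- 1) j k r + (u1 ^ r * x_cre 1 j k r + g k r))
      (\<lambda>k r. inverse u2 ^ r * x_ann (- 1) j k r + (inverse u1 ^ r * x_ann 1 j k r + h k r)) (state_weight S)
      (\<lambda>\<beta>. u2 powi (- \<beta> $ j) * twist (- simple_root j) (\<beta> + state_weight ?S') *
         (u1 powi (\<beta> $ j) * twist (simple_root j) (\<beta> + state_weight S) * \<sigma> \<beta>))
      (\<lambda>\<beta>. d \<beta> + (int CARD('n) + 1) * \<beta> $ j - (int CARD('n) + 1) * \<beta> $ j)"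
    unfolding b x_plus_move[OF st m u1_def] x_minus_move[OF state_cre_move_up[OF st m u1_def] m' u2] S ..
  also have "\<dots> = nf_op (int CARD('n) + 1) g (\<lambda>k r. inverse u3 ^ r * psi_ann j k r + h k r) (state_weight S)
      (\<lambda>\<beta>. - 1 / (qq - inverse qq) * ((1 - qh powi 4) * qh powi (2 * \<beta> $ j - 2) * \<sigma> \<beta>)) d"
  proof (rule nf_op_cong)
    fix k and r :: nat assume r: "r \<ge> 1"
    have nz: "qint (int r) \<noteq> 0" using r by (intro qint_nonzero) simp
    have "(2 * ?t + 2) * int r + - int r = (2 * ?t) * int r + int r" by (simp add: algebra_simps)
    then have "u1 ^ r * qh powi (- int r) = u2 ^ r * qh powi int r"
      unfolding u1_def u2_def qh_powi_power qh_powi_mult by (simp only:)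
    then show "u2 ^ r * x_cre (- 1) j k r + (u1 ^ r * x_cre 1 j k r + g k r) = g k r"
      by (simp add: x_cre_def)
    have "- ((2 * ?t + 2) * int r) + - int r = - ((2 * ?t + 1) * int r) + - (2 * int r)"
      "- ((2 * ?t) * int r) + int r = - ((2 * ?t + 1) * int r) + 2 * int r" by (simp_all add: algebra_simps)
    then have e: "inverse u1 ^ r * qh powi (- int r) = inverse u3 ^ r * qq powi (- int r)"
      "inverse u2 ^ r * qh powi int r = inverse u3 ^ r * qq powi int r"
      unfolding u1_def u2_def u3_def inverse_qh_powi qh_powi_power qq_powi qh_powi_mult mult_minus_left mult_minus_right by (simp_all only:)
    have "inverse u2 ^ r * x_ann (- 1) j k r + inverse u1 ^ r * x_ann 1 j k r =
      (inverse u2 ^ r * qh powi int r - inverse u1 ^ r * qh powi (- int r)) * (heis_weight j k r / qint (int r))"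
      by (simp add: x_ann_def algebra_simps diff_divide_distrib)
    also have "\<dots> = inverse u3 ^ r * ((qq - inverse qq) * qint (int r)) * (heis_weight j k r / qint (int r))"
      unfolding e qint_mult by (simp add: algebra_simps)
    also have "\<dots> = inverse u3 ^ r * psi_ann j k r"
      using nz by (simp add: psi_ann_def)
    finally show "inverse u2 ^ r * x_ann (- 1) j k r + (inverse u1 ^ r * x_ann 1 j k r + h k r) =
      inverse u3 ^ r * psi_ann j k r + h k r" by (simp add: add.assoc[symmetric])
  next
    fix \<beta> :: "'n weight"
    have "twist (- simple_root j) (\<beta> + state_weight ?S') * twist (simple_root j) (\<beta> + state_weight S) = 1"
      using twist_opposite(2)[of j "\<beta> + state_weight S"] unfolding state_weight_move_up[OF st m u1_def]
      by (simp add: add_ac)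
    then have "u2 powi (- \<beta> $ j) * twist (- simple_root j) (\<beta> + state_weight ?S') *
         (u1 powi (\<beta> $ j) * twist (simple_root j) (\<beta> + state_weight S) * \<sigma> \<beta>) =
      (u2 powi (- \<beta> $ j) * u1 powi (\<beta> $ j)) * \<sigma> \<beta>"
      by (simp add: mult_ac)
    also have "u2 powi (- \<beta> $ j) * u1 powi (\<beta> $ j) = qh powi (2 * \<beta> $ j)"
    proof -
      have "(2 * ?t) * - \<beta> $ j + (2 * ?t + 2) * \<beta> $ j = 2 * \<beta> $ j" by (simp add: algebra_simps)
      then show ?thesis unfolding u1_def u2_def power_int_mult[symmetric] qh_powi_mult by simp
    qed
    also have "\<dots> = - 1 / (qq - inverse qq) * ((1 - qh powi 4) * qh powi (2 * \<beta> $ j - 2))"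
    proof -
      have "(1 - qh powi 4) * qh powi (2 * \<beta> $ j - 2) = - ((qq powi 1 - qq powi (- 1)) * qh powi (2 * \<beta> $ j))"
        unfolding qq_powi left_diff_distrib qh_powi_mult by (simp add: add.commute)
      then show ?thesis using qq_minus_inverse_nonzero by (simp add: power_int_minus)
    qed
    finally show "u2 powi (- \<beta> $ j) * twist (- simple_root j) (\<beta> + state_weight ?S') *
         (u1 powi (\<beta> $ j) * twist (simple_root j) (\<beta> + state_weight S) * \<sigma> \<beta>) =
      - 1 / (qq - inverse qq) * ((1 - qh powi 4) * qh powi (2 * \<beta> $ j - 2) * \<sigma> \<beta>)"
      by (simp only: mult.assoc)
  qed simp_all
  also have "\<dots> = op_scale (- 1 / (qq - inverse qq)) (psi_op j \<bullet>\<^sub>q b)"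
    unfolding b psi_up[OF st m u3_def] by (rule nf_op_scale[symmetric]) simp
  finally show ?thesis .
qed

text \<open>For adjacent nodes both orders vanish, since the first move blocks the second. For
  distant nodes the moves touch disjoint pairs of elements, so neither displaces the pole of the
  other and the cocycle signs agree.\<close>

lemma off_diagonal:
  fixes g h :: "'n::{finite,linorder} \<Rightarrow> nat \<Rightarrow> qfield"
  assumes st: "state_cre c S g" and neq: "j1 \<noteq> j2"
    and b: "b = nf_op (int CARD('n) + 1) g h (state_weight S) \<sigma> d"
  shows "x_op 1 j1 \<bullet>\<^sub>q x_op (- 1) j2 \<bullet>\<^sub>q b = x_op (- 1) j2 \<bullet>\<^sub>q x_op 1 j1 \<bullet>\<^sub>q b"
proof -
  let ?p1 = "pos j1" and ?p2 = "pos j2"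
  let ?S1 = "move_up ?p1 S" and ?S2 = "move_down ?p2 S"
  have neq': "?p1 \<noteq> ?p2" using neq by (simp add: pos_eq_iff)
  have plus: "x_op 1 j1 \<bullet>\<^sub>q x_op (- 1) j2 \<bullet>\<^sub>q b = 0" if "\<not> (movable_down ?p2 S \<and> movable_up ?p1 ?S2)"
  proof (cases "movable_down ?p2 S")
    case True
    then show ?thesis using that
      unfolding b x_minus_move[OF st True refl] by (intro x_plus_stop[OF state_cre_move_down[OF st True refl]]) simp
  next
    case False
    then show ?thesis unfolding b x_minus_stop[OF st False] by (simp add: bullet_zero x_op_zero)
  qed
  have minus: "x_op (- 1) j2 \<bullet>\<^sub>q x_op 1 j1 \<bullet>\<^sub>q b = 0" if "\<not> (movable_up ?p1 S \<and> movable_down ?p2 ?S1)"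
  proof (cases "movable_up ?p1 S")
    case True
    then show ?thesis using that
      unfolding b x_plus_move[OF st True refl] by (intro x_minus_stop[OF state_cre_move_up[OF st True refl]]) simp
  next
    case False
    then show ?thesis unfolding b x_plus_stop[OF st False] by (simp add: bullet_zero x_op_zero)
  qed
  show ?thesis
  proof (cases "movable_down ?p2 S \<and> movable_up ?p1 S \<and> ?p1 \<noteq> Suc ?p2 \<and> ?p2 \<noteq> Suc ?p1")
    case False
    then have "\<not> (movable_down ?p2 S \<and> movable_up ?p1 ?S2)" "\<not> (movable_up ?p1 S \<and> movable_down ?p2 ?S1)"
      using neq' by (auto simp: movable_down_def movable_up_def move_down_def move_up_def)
    then show ?thesis by (simp add: plus minus)
  next
    case True
    then have m1: "movable_up ?p1 S" and m2: "movable_down ?p2 S" and far: "?p1 \<noteq> Suc ?p2" "?p2 \<noteq> Suc ?p1" by auto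
    have m1': "movable_up ?p1 ?S2" and m2': "movable_down ?p2 ?S1" and SS: "move_up ?p1 ?S2 = move_down ?p2 ?S1"
      using m1 m2 far neq' by (auto simp: movable_down_def movable_up_def move_down_def move_up_def)
    define u1 where "u1 = qh powi (2 * box_exp c S (Suc ?p1) + 2)"
    define u2 where "u2 = qh powi (2 * box_exp c S ?p2 + 2)"
    have "box_exp c ?S2 (Suc ?p1) = box_exp c S (Suc ?p1)"
      by (rule box_exp_move) (use m2 far in \<open>auto simp: movable_down_def move_down_def\<close>)
    then have u1: "u1 = qh powi (2 * box_exp c ?S2 (Suc ?p1) + 2)" by (simp add: u1_def)
    have "box_exp c S ?p2 = box_exp c ?S1 ?p2"
      by (rule box_exp_move[of ?p1]) (use m1 neq' in \<open>auto simp: movable_up_def move_up_def\<close>)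
    then have u2: "u2 = qh powi (2 * box_exp c ?S1 ?p2 + 2)" by (simp add: u2_def)
    have far': "Suc ?p1 < ?p2 \<or> Suc ?p2 < ?p1" using far neq' by linarith
    show ?thesis
      unfolding b x_minus_move[OF st m2 u2_def] x_plus_move[OF state_cre_move_down[OF st m2 u2_def] m1' u1]
        x_plus_move[OF st m1 u1_def] x_minus_move[OF state_cre_move_up[OF st m1 u1_def] m2' u2] SS
    proof (rule nf_op_cong)
      fix \<beta> :: "'n weight"
      have *: "twist (simple_root j1) (\<beta> + state_weight ?S2) * twist (- simple_root j2) (\<beta> + state_weight S) =
        twist (- simple_root j2) (\<beta> + state_weight ?S1) * twist (simple_root j1) (\<beta> + state_weight S)"
        using twist_commute_far[OF far', of "\<beta> + state_weight S"]
        unfolding state_weight_move_down[OF st m2 u2_def] state_weight_move_up[OF st m1 u1_def]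
        by (simp add: add_ac)
      show "u1 powi (\<beta> $ j1) * twist (simple_root j1) (\<beta> + state_weight ?S2) *
          (u2 powi (- \<beta> $ j2) * twist (- simple_root j2) (\<beta> + state_weight S) * \<sigma> \<beta>) =
        u2 powi (- \<beta> $ j2) * twist (- simple_root j2) (\<beta> + state_weight ?S1) *
          (u1 powi (\<beta> $ j1) * twist (simple_root j1) (\<beta> + state_weight S) * \<sigma> \<beta>)"
      proof -
        have "X * A * (Y * B * Z) = Y * C * (X * D * Z)" if "A * B = C * D" for X Y Z A B C D :: qfield
        proof -
          have "X * A * (Y * B * Z) = X * Y * (A * B) * Z" by (simp add: mult_ac)
          also have "\<dots> = Y * C * (X * D * Z)" unfolding that by (simp add: mult_ac)
          finally show ?thesis .
        qed
        then show ?thesis using * .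
      qed
    qed (simp_all add: add_ac)
  qed
qed

text \<open>On the diagonal at most one of the two moves is possible, so at most one order of the
  factors survives.\<close>

lemma x_commutator_state:
  fixes b :: "'n::{finite,linorder} vop"
  assumes "is_state c S b"
  shows "x_op 1 j1 \<bullet>\<^sub>q x_op (- 1) j2 \<bullet>\<^sub>q b - x_op (- 1) j2 \<bullet>\<^sub>q x_op 1 j1 \<bullet>\<^sub>q b =
    op_scale ((if j1 = j2 then 1 else 0) / (qq - inverse qq)) (psi_op j1 \<bullet>\<^sub>q b - phi_op j1 \<bullet>\<^sub>q b)"
proof -
  obtain g h \<sigma> d where b: "b = nf_op (int CARD('n) + 1) g h (state_weight S) \<sigma> d" and st: "state_cre c S g"
    using assms unfolding is_state_def by blast
  show ?thesis
  proof (cases "j1 = j2")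
    case False
    then show ?thesis by (simp add: off_diagonal[OF st False b])
  next
    case True
    have zero: "x_op 1 j2 \<bullet>\<^sub>q 0 = 0" "x_op (- 1) j2 \<bullet>\<^sub>q 0 = 0"
      by (simp_all add: bullet_zero x_op_zero)
    have phi: "phi_op j2 \<bullet>\<^sub>q b = 0" unfolding b by (rule phi_bullet(2)[OF st])
    consider "movable_down (pos j2) S" | "movable_up (pos j2) S" | "\<not> movable_down (pos j2) S" "\<not> movable_up (pos j2) S" by blast
    then show ?thesis
    proof cases
      case 1
      then have "\<not> movable_up (pos j2) S" by (simp add: movable_up_def movable_down_def)
      then have "x_op 1 j2 \<bullet>\<^sub>q b = 0" unfolding b by (rule x_plus_stop[OF st])
      then show ?thesis by (simp add: True zero phi diagonal_down[OF st 1 b])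
    next
      case 2
      then have "\<not> movable_down (pos j2) S" by (simp add: movable_up_def movable_down_def)
      then have "x_op (- 1) j2 \<bullet>\<^sub>q b = 0" unfolding b by (rule x_minus_stop[OF st])
      then show ?thesis by (simp add: True zero phi diagonal_up[OF st 2 b])
    next
      case 3
      have "x_op (- 1) j2 \<bullet>\<^sub>q b = 0" "x_op 1 j2 \<bullet>\<^sub>q b = 0" "psi_op j2 \<bullet>\<^sub>q b = 0"
        unfolding b using 3 by (simp_all add: x_minus_stop[OF st] x_plus_stop[OF st] psi_stop[OF st])
      then show ?thesis by (simp add: True zero phi)
    qed
  qed
qed

section \<open>Sums of states\<close>

lemma generator_nf:
  assumes "a \<in> generators"
  shows "(\<exists>j. a = x_op 1 j) \<or> (\<exists>j. a = x_op (- 1) j) \<or> (\<exists>j. a = psi_op j) \<or> (\<exists>j. a = phi_op j)"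
  using assms by (auto simp: generators_def x_plus_def x_minus_def)

lemma generator_add:
  assumes "a \<in> generators"
  shows "a (v + w) = a v + a w"
  using generator_nf[OF assms] by (auto simp: x_op_nf psi_op_nf phi_op_nf nf_op_add)

lemma generator_zero: "a \<in> generators \<Longrightarrow> a 0 = 0"
  using generator_add[of a 0 0] by simp

text \<open>Products without a pole vanish, so 0 has to count as a state for the class to be closed
  under the generators.\<close>

lemma is_state_zero:
  assumes "is_state c S (b :: 'n::{finite,linorder} vop)"
  shows "is_state c S (0 :: 'n vop)"
proof -
  obtain g where "state_cre c S (g :: 'n \<Rightarrow> nat \<Rightarrow> qfield)" using assms unfolding is_state_def by blast
  moreover have "(0 :: 'n vop) = nf_op (int CARD('n) + 1) g g (state_weight S) (\<lambda>\<beta>. 0) (\<lambda>\<beta>. 0)"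
    by (rule nf_op_zero[symmetric]) simp
  ultimately show ?thesis unfolding is_state_def by blast
qed

lemma is_state_scale:
  assumes "is_state c S (b :: 'n::{finite,linorder} vop)"
  shows "is_state c S (op_scale x b)"
proof -
  obtain g h \<sigma> d where "b = nf_op (int CARD('n) + 1) g h (state_weight S) \<sigma> d" "state_cre c S g"
    using assms unfolding is_state_def by blast
  moreover from this have "op_scale x b = nf_op (int CARD('n) + 1) g h (state_weight S) (\<lambda>\<beta>. x * \<sigma> \<beta>) d"
    by (simp add: nf_op_scale)
  ultimately show ?thesis unfolding is_state_def by blast
qed

lemma
  fixes b :: "'n::{finite,linorder} vop"
  assumes b: "is_state c S b" and a: "a \<in> generators"
  shows compat_state: "compat a b" and bullet_state: "\<exists>S'. is_state c S' (a \<bullet>\<^sub>q b)"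
proof -
  obtain g h \<sigma> d where b': "b = nf_op (int CARD('n) + 1) g h (state_weight S) \<sigma> d" and st: "state_cre c S g"
    using b unfolding is_state_def by blast
  show "compat a b"
    using generator_nf[OF a] unfolding b' by (auto intro: x_compat[OF st] psi_compat[OF st] phi_bullet(1)[OF st])
  have z: "\<exists>S'. is_state c S' (a \<bullet>\<^sub>q b)" if "a \<bullet>\<^sub>q b = 0"
    using is_state_zero[OF b] that by auto
  from generator_nf[OF a] consider j where "a = x_op 1 j" | j where "a = x_op (- 1) j" | j where "a = psi_op j" | j where "a = phi_op j"
    by blast
  then show "\<exists>S'. is_state c S' (a \<bullet>\<^sub>q b)"
  proof cases
    case (1 j)
    show ?thesis
    proof (cases "movable_up (pos j) S")
      case True
      then show ?thesis unfolding 1 b' is_state_def x_plus_move[OF st True refl]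
        using state_cre_move_up[OF st True refl] by blast
    qed (rule z, simp add: 1 b' x_plus_stop[OF st])
  next
    case (2 j)
    show ?thesis
    proof (cases "movable_down (pos j) S")
      case True
      then show ?thesis unfolding 2 b' is_state_def x_minus_move[OF st True refl]
        using state_cre_move_down[OF st True refl] by blast
    qed (rule z, simp add: 2 b' x_minus_stop[OF st])
  next
    case (3 j)
    consider "movable_down (pos j) S" | "movable_up (pos j) S" | "\<not> movable_down (pos j) S" "\<not> movable_up (pos j) S" by blast
    then show ?thesis
    proof cases
      case m: 1
      show ?thesis unfolding 3 b' is_state_def psi_down[OF st m refl] using st by blast
    next
      case m: 2
      show ?thesis unfolding 3 b' is_state_def psi_up[OF st m refl] using st by blast
    next
      case m: 3
      show ?thesis by (rule z) (simp add: 3 b' psi_stop[OF st m])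
    qed
  next
    case (4 j)
    show ?thesis by (rule z) (simp add: 4 b' phi_bullet(2)[OF st])
  qed
qed

text \<open>Elements of the span become sums of states with one common offset, the scalars being
  absorbed into the states. Adding one state at a time matches the form in which additivity of the
  bullet product is available.\<close>

inductive state_sum :: "int \<Rightarrow> 'n::{finite,linorder} vop \<Rightarrow> bool" for c where
  zero: "state_sum c 0"
| add: "is_state c S b \<Longrightarrow> state_sum c y \<Longrightarrow> state_sum c (b + y)"

lemma compat_state_sum:
  assumes "state_sum c y" "a \<in> generators"
  shows "compat a y"
  using assms(1)
proof induction
  case zero
  show ?case by (rule compat_zero[OF refl]) (simp add: generator_zero assms(2))
next
  case (add S b y)
  then show ?case using compat_state assms(2) by (intro compat_add[OF refl] generator_add) auto
qed

lemma bullet_add_state_sum: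
  assumes "is_state c S b" "state_sum c y" "a \<in> generators"
  shows "a \<bullet>\<^sub>q (b + y) = a \<bullet>\<^sub>q b + a \<bullet>\<^sub>q y"
  using assms compat_state compat_state_sum by (intro bullet_add[OF refl] generator_add) auto

lemma bullet_state_sum:
  assumes "state_sum c y" "a \<in> generators"
  shows "state_sum c (a \<bullet>\<^sub>q y)"
  using assms(1)
proof induction
  case zero
  have "state_sum c (a \<bullet>\<^sub>q 0)"
    unfolding bullet_zero[of a, OF generator_zero[OF assms(2)]] by (rule state_sum.zero)
  then show ?case .
next
  case (add S b y)
  then obtain S' where "is_state c S' (a \<bullet>\<^sub>q b)" using bullet_state assms(2) by blast
  then have "state_sum c (a \<bullet>\<^sub>q (b + y))"
    unfolding bullet_add_state_sum[OF add(1,2) assms(2)] using add.IH by (rule state_sum.add)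
  then show ?case .
qed

lemma Y_words_state: "w \<in> Y_words i \<Longrightarrow> \<exists>S. is_state (int (pos i)) S w"
  by (induction rule: Y_words.induct) (use is_state_Y_op bullet_state in blast)+

lemma Y_space_state_sum: "a \<in> Y_space i \<Longrightarrow> state_sum (int (pos i)) a"
  unfolding Y_space_def
proof (induction rule: op_space.span_induct_alt)
  case base
  show ?case by (rule state_sum.zero)
next
  case (step x w y)
  then show ?case using Y_words_state is_state_scale state_sum.add by blast
qed

theorem lemma2p14:
  fixes i j\<^sub>1 j\<^sub>2 :: "'n::{finite,linorder}"
    and a :: "'n vop"
  assumes "a \<in> Y_space i"
  shows "x_plus j\<^sub>1 \<bullet>\<^sub>q x_minus j\<^sub>2 \<bullet>\<^sub>q a - x_minus j\<^sub>2 \<bullet>\<^sub>q x_plus j\<^sub>1 \<bullet>\<^sub>q a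
       = op_scale ((if j\<^sub>1 = j\<^sub>2 then 1 else 0) / (qq - inverse qq)) (psi_op j\<^sub>1 \<bullet>\<^sub>q a - phi_op j\<^sub>1 \<bullet>\<^sub>q a)"
proof -
  have gen: "x_plus j \<in> generators" "x_minus j \<in> generators" "psi_op j \<in> generators" "phi_op j \<in> generators" for j :: 'n
    by (auto simp: generators_def)
  from Y_space_state_sum[OF assms] show ?thesis
  proof induction
    case zero
    have z: "g \<bullet>\<^sub>q 0 = 0" if "g \<in> generators" for g :: "'n vop"
      by (rule bullet_zero[of g, OF generator_zero[OF that]])
    have "x_plus j\<^sub>1 \<bullet>\<^sub>q x_minus j\<^sub>2 \<bullet>\<^sub>q 0 - x_minus j\<^sub>2 \<bullet>\<^sub>q x_plus j\<^sub>1 \<bullet>\<^sub>q 0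
       = op_scale ((if j\<^sub>1 = j\<^sub>2 then 1 else 0) / (qq - inverse qq)) (psi_op j\<^sub>1 \<bullet>\<^sub>q 0 - phi_op j\<^sub>1 \<bullet>\<^sub>q 0)"
      by (simp only: z[OF gen(1)] z[OF gen(2)] z[OF gen(3)] z[OF gen(4)] diff_self op_space.scale_zero_right)
    then show ?case .
  next
    case (add S b y)
    have split: "g \<bullet>\<^sub>q (b + y) = g \<bullet>\<^sub>q b + g \<bullet>\<^sub>q y" if "g \<in> generators" for g
      using add that by (simp add: bullet_add_state_sum)
    \<comment> \<open>The outer product distributes because the inner products are again a state and
      a sum of states, hence compatible with every generator.\<close>
    have split2: "g' \<bullet>\<^sub>q g \<bullet>\<^sub>q (b + y) = g' \<bullet>\<^sub>q g \<bullet>\<^sub>q b + g' \<bullet>\<^sub>q g \<bullet>\<^sub>q y" if gen: "g \<in> generators" "g' \<in> generators" for g g'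
    proof -
      obtain S' where "is_state (int (pos i)) S' (g \<bullet>\<^sub>q b)" using bullet_state[OF add(1) gen(1)] by blast
      then show ?thesis using add gen by (simp add: split bullet_add_state_sum bullet_state_sum)
    qed
    have "x_plus j\<^sub>1 \<bullet>\<^sub>q x_minus j\<^sub>2 \<bullet>\<^sub>q b - x_minus j\<^sub>2 \<bullet>\<^sub>q x_plus j\<^sub>1 \<bullet>\<^sub>q b
       = op_scale ((if j\<^sub>1 = j\<^sub>2 then 1 else 0) / (qq - inverse qq)) (psi_op j\<^sub>1 \<bullet>\<^sub>q b - phi_op j\<^sub>1 \<bullet>\<^sub>q b)"
      unfolding x_plus_def x_minus_def by (rule x_commutator_state[OF add(1)])
    moreover have "x_plus j\<^sub>1 \<bullet>\<^sub>q x_minus j\<^sub>2 \<bullet>\<^sub>q y - x_minus j\<^sub>2 \<bullet>\<^sub>q x_plus j\<^sub>1 \<bullet>\<^sub>q y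
       = op_scale ((if j\<^sub>1 = j\<^sub>2 then 1 else 0) / (qq - inverse qq)) (psi_op j\<^sub>1 \<bullet>\<^sub>q y - phi_op j\<^sub>1 \<bullet>\<^sub>q y)"
      by (rule add.IH)
    ultimately have "x_plus j\<^sub>1 \<bullet>\<^sub>q x_minus j\<^sub>2 \<bullet>\<^sub>q (b + y) - x_minus j\<^sub>2 \<bullet>\<^sub>q x_plus j\<^sub>1 \<bullet>\<^sub>q (b + y)
       = op_scale ((if j\<^sub>1 = j\<^sub>2 then 1 else 0) / (qq - inverse qq)) (psi_op j\<^sub>1 \<bullet>\<^sub>q (b + y) - phi_op j\<^sub>1 \<bullet>\<^sub>q (b + y))"
      unfolding split2[OF gen(2,1)] split2[OF gen(1,2)] split[OF gen(3)] split[OF gen(4)] add_diff_add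
        op_space.scale_right_distrib by simp
    then show ?case .
  qed
qed

end
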